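(* Let $b\geqslant2$ be an integer, let $\alpha_1,\alpha_2>0$ and let $\eta>1$. Let $l_1$ be a sufficiently large integer (depending on $\eta$), let $\{l_i\}_{i\geqslant1}$ be the increasing sequence of integers defined by $l_{i+1}=\lfloor l_i\eta\rfloor$ for all $i\geqslant1$, and for each $i\geqslant 1$ let $\nu_i$ be the finite word $$\nu_i=0^{\lfloor l_i\eta\rfloor-l_i-1}1.$$ Let $y$ be the real number whose $b$-ary expansion is the infinite concatenation $\nu_1\nu_2\nu_3\cdots$. Then $\Delta^b(y)=\eta$, and the bivariate multifractal spectrum of the Lévy function $L_{\alpha_1}^b$ and the translated Lévy function $L_{\alpha_2}^{b,y}$ is given as follows. (1) If $H_1\in[0,\alpha_1]$ and $H_2=\frac{\alpha_2}{\alpha_1}H_1$, then $\mathcal{D}_{L_{\alpha_1}^b,L_{\alpha_2}^{b,y}}(H_1,H_2)=\dfrac{H_1}{\alpha_1}$. (2) One has $\mathcal{D}_{L_{\alpha_1}^b,L_{\alpha_2}^{b,y}}(H_1,H_2)=\min\left\{\dfrac{H_1}{\alpha_1},\dfrac{H_2}{\alpha_2}\right\}$ if at least one of the following holds: (a) $(H_1,H_2)\in\left[0,\frac{\alpha_1}{\eta}\right]\times\left[0,\frac{\alpha_2}{\eta}\right]$; (b) $H_2\in\left[\frac{\alpha_2}{\eta},\alpha_2\right]$ and $H_1\in\left[\frac{\alpha_1H_2^2}{\alpha_2^2},\frac{\alpha_1H_2}{\alpha_2}\right]$; (c) $H_1\in\left[\frac{\alpha_1}{\eta},\alpha_1\right]$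 and $H_2\in\left[\frac{\alpha_2H_1^2}{\alpha_1^2},\frac{\alpha_2H_1}{\alpha_1}\right]$. (3) In all other cases, $\mathcal{D}_{L_{\alpha_1}^b,L_{\alpha_2}^{b,y}}(H_1,H_2)=-\infty$.
   Context: Words and expansions: letters are in $\{0,1,\dots,b-1\}$; $0^m$ is the word made of $m$ letters $0$; a real number $x\in[0,1)$ has $b$-ary expansion $\varepsilon_1\varepsilon_2\cdots$ if $x=\sum_{i\geqslant1}\varepsilon_ib^{-i}$. Saw-tooth function: $\{x\}=x-\lfloor x\rfloor-\tfrac12$ if $x\notin\mathbb{Z}$ and $\{x\}=0$ if $x\in\mathbb{Z}$. For $\alpha>0$, an integer $b\geqslant2$ and $y\in\mathbb{R}$, the Lévy function and the translated Lévy function are, for $x\in\mathbb{R}$, $$L_\alpha^b(x)=\sum_{i=1}^\infty\frac{\{b^ix\}}{b^{\alpha i}},\qquad L_\alpha^{b,y}(x)=\sum_{i=1}^\infty\frac{\{b^i(x-y)\}}{b^{\alpha i}}=L_\alpha^b(x-y).$$ Hölder exponent: for a locally bounded $f:\mathbb{R}\to\mathbb{R}$, $\alpha>0$ and $x_0\in\mathbb{R}$, $f\in C^\alpha(x_0)$ if there exist $C>0$, $r>0$ and a polynomial $P$ with $\deg P<\alpha$ such that $|f(x)-P(x-x_0)|\leqslant C|x-x_0|^\alpha$ for all $x\in[x_0-r,x_0+r]$. The Hölder exponent is $h_f(x_0)=\sup\{\alpha\geqslant0: f\in C^\alpha(x_0)\}$ (equal to $0$ if $f\in C^\alpha(x_0)$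 for no $\alpha>0$). Bivariate multifractal spectrum: for functions $f,g$ and reals $H_1,H_2$, $\mathcal{D}_{f,g}(H_1,H_2)=\dim_H\{x\in\mathbb{R}: h_f(x)=H_1,\ h_g(x)=H_2\}$, where $\dim_H$ is the Hausdorff dimension, with the convention $\dim_H(\emptyset)=-\infty$. $b$-adic approximation exponent: for $x\in\mathbb{R}$, $$\Delta^b(x)=\sup\left\{\alpha\geqslant1:\ \|b^nx\|\leqslant b^{-n(\alpha-1)}\ \text{for infinitely many } n\in\mathbb{N}\right\}\in[1,+\infty],$$ where $\|\cdot\|$ denotes the distance to the nearest integer. *)

theory Defs
  imports
    "HOL-Analysis.Analysis"
    "HOL-Library.Stream"
    "HOL-Computational_Algebra.Polynomial"
begin

section \<open>Hausdorff measure and dimension\<close>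

text \<open>
  The \<open>s\<close>-th power of the diameter of a bounded set, with the usual conventions
  that the empty set has weight 0 and that \<open>0\<close> to the power \<open>0\<close> is 1 for nonempty
  sets (whereas \<open>0 powr 0 = 0\<close> in the library).
\<close>
definition diam_weight :: "real \<Rightarrow> 'a::metric_space set \<Rightarrow> ennreal" where
  "diam_weight s U =
     (if U = {} then 0 else if s = 0 then 1 else ennreal (diameter U powr s))"

text \<open>Covers are required to be bounded since \<open>diameter\<close> is only meaningful on bounded sets.\<close>
definition hausdorff_premeasure :: "real \<Rightarrow> real \<Rightarrow> 'a::metric_space set \<Rightarrow> ennreal" where
  "hausdorff_premeasure s \<delta> E =
     Inf {(\<Sum>i. diam_weight s (U i)) | U :: nat \<Rightarrow> 'a set.
            (\<forall>i. bounded (U i) \<and> diameter (U i) \<le> \<delta>) \<and> E \<subseteq> (\<Union>i. U i)}"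

definition hausdorff_measure :: "real \<Rightarrow> 'a::metric_space set \<Rightarrow> ennreal" where
  "hausdorff_measure s E = (SUP \<delta>\<in>{0<..}. hausdorff_premeasure s \<delta> E)"

definition hausdorff_dim :: "'a::metric_space set \<Rightarrow> ereal" where
  "hausdorff_dim E =
     (if E = {} then - \<infinity> else Inf {ereal s | s. s \<ge> 0 \<and> hausdorff_measure s E = 0})"

section \<open>Pointwise regularity and the bivariate spectrum\<close>

definition holder_at :: "(real \<Rightarrow> real) \<Rightarrow> real \<Rightarrow> real \<Rightarrow> bool" where
  "holder_at f \<alpha> x\<^sub>0 \<longleftrightarrow>
     (\<exists>C>0. \<exists>r>0. \<exists>P::real poly. real (degree P) < \<alpha> \<and>
        (\<forall>x\<in>{x\<^sub>0 - r..x\<^sub>0 + r}. \<bar>f x - poly P (x - x\<^sub>0)\<bar> \<le> C * \<bar>x - x\<^sub>0\<bar> powr \<alpha>))"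

definition holder_exponent :: "(real \<Rightarrow> real) \<Rightarrow> real \<Rightarrow> ereal" where
  "holder_exponent f x\<^sub>0 = Sup (insert 0 {ereal \<alpha> | \<alpha>. \<alpha> > 0 \<and> holder_at f \<alpha> x\<^sub>0})"

definition bivariate_spectrum ::
  "(real \<Rightarrow> real) \<Rightarrow> (real \<Rightarrow> real) \<Rightarrow> real \<Rightarrow> real \<Rightarrow> ereal" where
  "bivariate_spectrum f g H\<^sub>1 H\<^sub>2 =
     hausdorff_dim {x. holder_exponent f x = ereal H\<^sub>1 \<and> holder_exponent g x = ereal H\<^sub>2}"

section \<open>Levy functions\<close>

definition sawtooth :: "real \<Rightarrow> real" where
  "sawtooth x = (if x \<in> \<int> then 0 else x - of_int \<lfloor>x\<rfloor> - 1 / 2)"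

text \<open>Series over \<open>i \<ge> 1\<close> are indexed by \<open>Suc i\<close>.\<close>
definition levy :: "nat \<Rightarrow> real \<Rightarrow> real \<Rightarrow> real" where
  "levy b \<alpha> x = (\<Sum>i. sawtooth (real b ^ Suc i * x) / real b powr (\<alpha> * real (Suc i)))"

definition translated_levy :: "nat \<Rightarrow> real \<Rightarrow> real \<Rightarrow> real \<Rightarrow> real" where
  "translated_levy b \<alpha> y x =
     (\<Sum>i. sawtooth (real b ^ Suc i * (x - y)) / real b powr (\<alpha> * real (Suc i)))"

section \<open>Expansions and approximation by b-adic rationals\<close>

text \<open>\<open>infdist z \<int>\<close> is the distance from \<open>z\<close> to the nearest integer.\<close>
definition approx_exponent :: "nat \<Rightarrow> real \<Rightarrow> ereal" where
  "approx_exponent b x =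
     Sup {ereal \<alpha> | \<alpha>. \<alpha> \<ge> 1 \<and>
       (\<exists>\<^sub>\<infinity>n::nat. infdist (real b ^ n * x) \<int> \<le> real b powr (- (real n * (\<alpha> - 1))))}"

text \<open>The entry \<open>\<epsilon> !! i\<close> is the digit of weight \<open>b\<close> to the power \<open>-(i + 1)\<close>.\<close>
definition has_expansion :: "nat \<Rightarrow> real \<Rightarrow> nat stream \<Rightarrow> bool" where
  "has_expansion b x \<epsilon> \<longleftrightarrow> x \<in> {0..<1} \<and> (\<forall>i. \<epsilon> !! i < b) \<and>
     (\<lambda>i. real (\<epsilon> !! i) / real b ^ Suc i) sums x"

text \<open>
  The word consisting of \<open>\<lfloor>m\<eta>\<rfloor> - m - 1\<close> letters 0 followed by a letter 1.  The exponent is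
  nonnegative as soon as \<open>m (\<eta> - 1) \<ge> 1\<close>, so that \<open>nat\<close> does not truncate for large \<open>m\<close>.
\<close>
definition zeros_one :: "real \<Rightarrow> int \<Rightarrow> nat list" where
  "zeros_one \<eta> m = replicate (nat (\<lfloor>of_int m * \<eta>\<rfloor> - m - 1)) 0 @ [1]"

end

theory Submission
  imports Defs "HOL-Real_Asymp.Real_Asymp"
begin

text \<open>
  A Levy function jumps by about \<open>b powr (- \<alpha> n)\<close> at the \<open>b\<close>-adic rationals of level \<open>n\<close> and is smooth
  elsewhere, so its Hoelder exponent at \<open>x\<close> is \<open>\<alpha>\<close> divided by the approximation exponent \<open>\<Delta> x\<close>.  The
  spectrum is therefore the Hausdorff dimension of the sets on which \<open>\<Delta> x\<close> and \<open>\<Delta> (x - y)\<close> are prescribed.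

  The digits 1 of \<open>y\<close> sit at positions \<open>p\<^sub>k\<close> with \<open>p\<^sub>k\<^sub>+\<^sub>1 / p\<^sub>k\<close> tending to \<open>\<eta>\<close>.  A run of zeros of \<open>x\<close> from \<open>n\<close> to
  \<open>n \<delta>\<close> is a run of zeros of \<open>x - y\<close> (up to borrows) except that it is cut at the \<open>p\<^sub>k\<close> that it contains; a
  short run is cut at most once, which leaves a piece of ratio at least \<open>sqrt \<delta>\<close>, and a long run leaves a piece
  of ratio about \<open>\<eta>\<close>.  This gives the empty part of the spectrum.  The other values are attained on
  Cantor sets of numbers that vanish, or agree with \<open>y\<close>, on very sparse windows of positions and have
  free digits elsewhere.
\<close>

section \<open>Distance to the integers and approximation exponents\<close>

text \<open>Because of borrows, the digits of x - y are not differences of digits. Lower bounds for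
  the distance of b^n (x - y) to the integers are therefore read off short patterns, 01 against 000
  and 10 against 00, which force a distance of at least b^-3 whatever digits follow, even for b = 2.

  The exponents have to be exact at every point of the Cantor set, not only at almost every one. So
  the pattern 01 is forced once in every m positions outside the windows. This costs a proportion
  2/m of the free digits, and m is chosen last, depending on the dimension s to be exceeded.

  The dimension is the reciprocal of the larger exponent: the covers use this exponent alone, and on
  the Cantor side a window of ratio \<delta> leaves a proportion 1/\<delta> of free digits at its
  end, so that prescribing the other exponent costs nothing. The reflection x -> y - x swaps the
  exponents, so one may assume \<Delta> x \<ge> \<Delta> (x - y). If both are at least \<eta>, zero
  windows and copies of y alternate, and the digits 1 of y cap the unwanted exponent at \<eta>. If
  the smaller one is below \<eta>, each window is placed relative to a digit 1 of y.\<close>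

lemma infdist_Ints_le: "infdist z \<int> \<le> \<bar>z - of_int k\<bar>"
  using infdist_le[of "of_int k" \<int> z] by (simp add: dist_real_def)

lemma infdist_Ints_attained:
  obtains k where "infdist z \<int> = \<bar>z - of_int k\<bar>"
proof -
  obtain w where w: "w \<in> \<int>" "infdist z \<int> = dist z w"
    by (rule infdist_attains_inf[of "\<int>::real set" z]) (auto intro: closed_Ints)
  then obtain k where "w = of_int k" by (auto elim: Ints_cases)
  with w that show ?thesis by (simp add: dist_real_def)
qed

lemma infdist_Ints_le_1: "infdist (z::real) \<int> \<le> 1"
  using infdist_Ints_le[of z "\<lfloor>z\<rfloor>"] by linarith

lemma infdist_Ints_diff: "infdist (z - w) \<int> \<le> infdist z \<int> + infdist w \<int>" for z w :: real
proof -
  obtain j k where "infdist z \<int> = \<bar>z - of_int j\<bar>" "infdist w \<int> = \<bar>w - of_int k\<bar>"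
    by (meson infdist_Ints_attained)
  with infdist_Ints_le[of "z - w" "j - k"] show ?thesis by simp
qed

lemma infdist_Ints_uminus [simp]: "infdist (- z) \<int> = infdist z \<int>" for z :: real
  using infdist_Ints_diff[of 0 z] infdist_Ints_diff[of 0 "- z"] by simp

lemma infdist_Ints_power_mult:
  "infdist (real b ^ (n + j) * z) \<int> \<le> real b ^ j * infdist (real b ^ n * z) \<int>"
proof -
  obtain k where k: "infdist (real b ^ n * z) \<int> = \<bar>real b ^ n * z - of_int k\<bar>"
    by (rule infdist_Ints_attained)
  have "infdist (real b ^ (n + j) * z) \<int> \<le> \<bar>real b ^ (n + j) * z - of_int (int b ^ j * k)\<bar>"
    by (rule infdist_Ints_le)
  also have "real b ^ (n + j) * z - of_int (int b ^ j * k) = real b ^ j * (real b ^ n * z - of_int k)"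
    by (simp add: power_add algebra_simps)
  also have "\<bar>\<dots>\<bar> = real b ^ j * infdist (real b ^ n * z) \<int>"
    by (simp add: abs_mult k)
  finally show ?thesis .
qed

lemma infdist_Ints_ge:
  assumes "0 \<le> r" "r \<le> w" "w \<le> 1 - r"
  shows "r \<le> infdist (w + of_int j) \<int>"
proof -
  obtain k where k: "infdist (w + of_int j) \<int> = \<bar>w + of_int j - of_int k\<bar>"
    by (rule infdist_Ints_attained)
  have "j - k \<ge> 0 \<or> j - k \<le> -1"
    by linarith
  then have "real_of_int j - real_of_int k \<ge> 0 \<or> real_of_int j - real_of_int k \<le> -1"
    by linarith
  then show ?thesis using assms k by linarith
qed

lemma ereal_le_if_real_less:
  fixes a z :: ereal
  assumes "\<And>r. ereal r > a \<Longrightarrow> z \<le> ereal r"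
  shows "z \<le> a"
  by (metis assms ereal_dense2 leD leI)

lemma ereal_le_if_real_below:
  fixes a z :: ereal
  assumes "\<And>r. ereal r < a \<Longrightarrow> ereal r \<le> z"
  shows "a \<le> z"
  by (metis assms ereal_dense2 leD leI)

lemma powr_minus_nat: "b \<ge> 2 \<Longrightarrow> 1 / real b ^ n = real b powr - real n"
  by (simp add: powr_minus powr_realpow divide_simps)

lemma approx_exponent_ge_1: "1 \<le> approx_exponent b x"
proof -
  have "ereal 1 \<le> approx_exponent b x"
    unfolding approx_exponent_def
    using infdist_Ints_le_1 by (intro Sup_upper) (auto simp: INFM_nat)
  then show ?thesis by (simp add: one_ereal_def)
qed

lemma eventually_powr_dominated:
  assumes b: "b \<ge> 2" and cc: "c > 0"
  shows "\<forall>\<^sub>F n in sequentially. C \<le> real b powr (c * real n)"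
proof -
  have "filterlim (\<lambda>n. real b powr (c * real n)) at_top sequentially"
    using assms by real_asymp
  then show ?thesis by (simp add: filterlim_at_top)
qed

text \<open>A constant factor does not affect the exponent: for each \<open>a' < a\<close> it is
  absorbed by b powr ((a - a') n) for large n.\<close>

lemma approx_exponent_geI:
  assumes b: "b \<ge> 2"
    and inf: "\<exists>\<^sub>\<infinity>n. infdist (real b ^ n * x) \<int> \<le> C * real b powr (- (real n * (a - 1)))"
  shows "ereal a \<le> approx_exponent b x"
proof (rule ccontr)
  assume "\<not> ereal a \<le> approx_exponent b x"
  then obtain a' where a': "approx_exponent b x < ereal a'" "a' < a"
    by (metis ereal_dense2 less_ereal.simps(1) not_le_imp_less)
  have 1: "a' \<ge> 1" 
    using order.strict_trans1[OF approx_exponent_ge_1 a'(1)] by (simp add: one_ereal_def)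
  have "\<forall>\<^sub>F n in sequentially. C \<le> real b powr ((a - a') * real n)"
    using b a' by (intro eventually_powr_dominated) auto
  then have ev: "\<forall>\<^sub>\<infinity>n. C \<le> real b powr ((a - a') * real n)"
    by (simp add: cofinite_eq_sequentially)
  have "\<exists>\<^sub>\<infinity>n. infdist (real b ^ n * x) \<int> \<le> real b powr (- (real n * (a' - 1)))"
    using INFM_conjI[OF inf ev]
  proof (rule INFM_mono)
    fix n assume n: "infdist (real b ^ n * x) \<int> \<le> C * real b powr (- (real n * (a - 1)))
      \<and> C \<le> real b powr ((a - a') * real n)"
    then have "infdist (real b ^ n * x) \<int> \<le> real b powr ((a - a') * real n) * real b powr (- (real n * (a - 1)))"
      by (meson mult_right_mono order_trans powr_ge_zero)
    also have "\<dots> = real b powr (- (real n * (a' - 1)))"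
      using b by (simp add: powr_add[symmetric] algebra_simps)
    finally show "infdist (real b ^ n * x) \<int> \<le> real b powr (- (real n * (a' - 1)))" .
  qed
  with 1 have "ereal a' \<le> approx_exponent b x"
    unfolding approx_exponent_def by (intro Sup_upper) auto
  with a' show False by simp
qed

lemma approx_exponent_INFM:
  assumes "ereal a < approx_exponent b x"
  shows "\<exists>\<^sub>\<infinity>n. infdist (real b ^ n * x) \<int> \<le> real b powr (- (real n * (a - 1)))"
proof -
  obtain a' where a': "a < a'" 
    "\<exists>\<^sub>\<infinity>n. infdist (real b ^ n * x) \<int> \<le> real b powr (- (real n * (a' - 1)))"
    using assms unfolding approx_exponent_def by (auto simp: less_Sup_iff)
  from a'(2) show ?thesis
  proof (rule INFM_mono)
    fix n assume n: "infdist (real b ^ n * x) \<int> \<le> real b powr (- (real n * (a' - 1)))"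
    show "infdist (real b ^ n * x) \<int> \<le> real b powr (- (real n * (a - 1)))"
    \<comment> \<open>\<open>powr_mono\<close> needs a base of at least 1; for \<open>b = 0\<close>
      both powers are 0 by the convention of \<open>powr\<close>.\<close>
    proof (cases "b = 0")
      case False
      then have "real b powr (- (real n * (a' - 1))) \<le> real b powr (- (real n * (a - 1)))"
        using a' by (intro powr_mono) (auto intro: mult_left_mono)
      with n show ?thesis by simp
    qed (use n in auto)
  qed
qed

lemma approx_exponent_less_eventually:
  assumes "approx_exponent b x < ereal a"
  shows "\<forall>\<^sub>\<infinity>n. real b powr (- (real n * (a - 1))) < infdist (real b ^ n * x) \<int>"
proof (rule ccontr)
  assume "\<not> ?thesis"
  then have inf: "\<exists>\<^sub>\<infinity>n. infdist (real b ^ n * x) \<int> \<le> real b powr (- (real n * (a - 1)))"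
    by (simp add: not_MOST not_less)
  have "a \<ge> 1" 
    using order.strict_trans1[OF approx_exponent_ge_1 assms] by (simp add: one_ereal_def)
  with inf have "ereal a \<le> approx_exponent b x"
    unfolding approx_exponent_def by (intro Sup_upper) auto
  with assms show False by simp
qed

text \<open>
  Multiplying by \<open>b\<close> expands the distance to the integers by at most \<open>b\<close>, so it is enough to
  bound it from below along a set of exponents without too large multiplicative gaps.
\<close>
lemma approx_exponent_leI:
  assumes b: "b \<ge> 2" and c: "c > 0"
    and good: "\<forall>\<^sub>\<infinity>n. \<exists>n'\<ge>n. real n' \<le> a * real n + C \<and> c \<le> infdist (real b ^ n' * x) \<int>"
  shows "approx_exponent b x \<le> ereal a"
proof (rule ccontr)
  assume "\<not> approx_exponent b x \<le> ereal a"
  then obtain a' where a': "ereal a' < approx_exponent b x" "a < a'"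
    by (metis ereal_dense2 less_ereal.simps(1) not_le_imp_less)
  \<comment> \<open>The threshold is chosen so that the chain of estimates below ends in
    \<open>c \<le> c / 2\<close>.\<close>
  have "\<forall>\<^sub>F n in sequentially. 2 * real b powr C / c \<le> real b powr ((a' - a) * real n)"
    using b a' by (intro eventually_powr_dominated) auto
  then have ev: "\<forall>\<^sub>\<infinity>n. 2 * real b powr C / c \<le> real b powr ((a' - a) * real n)"
    by (simp add: cofinite_eq_sequentially)
  have "\<exists>n. infdist (real b ^ n * x) \<int> \<le> real b powr (- (real n * (a' - 1))) \<and>
      (\<exists>n'\<ge>n. real n' \<le> a * real n + C \<and> c \<le> infdist (real b ^ n' * x) \<int>) \<and>
      2 * real b powr C / c \<le> real b powr ((a' - a) * real n)"
    using INFM_conjI[OF approx_exponent_INFM[OF a'(1)] eventually_conj[OF good ev]]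
    by (rule frequently_ex)
  then obtain n where n: "infdist (real b ^ n * x) \<int> \<le> real b powr (- (real n * (a' - 1)))"
      "\<exists>n'\<ge>n. real n' \<le> a * real n + C \<and> c \<le> infdist (real b ^ n' * x) \<int>"
      "2 * real b powr C / c \<le> real b powr ((a' - a) * real n)"
    by blast
    from n(2) obtain n' where n': "n' \<ge> n" "real n' \<le> a * real n + C" "c \<le> infdist (real b ^ n' * x) \<int>"
      by auto
    have "c \<le> real b ^ (n' - n) * infdist (real b ^ n * x) \<int>"
      using infdist_Ints_power_mult[of b n "n' - n" x] n' by simp
    also have "\<dots> \<le> real b ^ (n' - n) * real b powr (- (real n * (a' - 1)))"
      using n by (intro mult_left_mono) auto
    also have "\<dots> = real b powr (real n' - real n * a')"
      using b n' by (simp add: powr_realpow[symmetric] powr_add[symmetric] of_nat_diff algebra_simps)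
    also have "\<dots> \<le> real b powr (C - (a' - a) * real n)"
      using b n' by (intro powr_mono) (auto simp: algebra_simps)
    also have "\<dots> = real b powr C / real b powr ((a' - a) * real n)"
      by (simp add: powr_diff)
    also have "\<dots> \<le> real b powr C / (2 * real b powr C / c)"
      using b c n by (intro divide_left_mono mult_pos_pos) auto
    also have "\<dots> = c / 2" using b by simp
    finally show False using c by simp
qed

lemma approx_exponent_uminus [simp]: "approx_exponent b (- x) = approx_exponent b x"
  by (simp add: approx_exponent_def)

section \<open>Hoelder exponents of Levy functions\<close>

lemma sawtooth_bound: "\<bar>sawtooth z\<bar> \<le> 1 / 2"
proof -
  have "\<bar>z - of_int \<lfloor>z\<rfloor> - 1 / 2\<bar> \<le> 1 / 2" by linarith
  then show ?thesis by (simp add: sawtooth_def)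
qed

lemma sawtooth_add:
  assumes "\<bar>h\<bar> < infdist z \<int>"
  shows "sawtooth (z + h) = sawtooth z + h"
proof -
  have 1: "\<bar>h\<bar> < z - \<lfloor>z\<rfloor>" and 2: "\<bar>h\<bar> < \<lfloor>z\<rfloor> + 1 - z"
    using assms infdist_Ints_le[of z "\<lfloor>z\<rfloor>"] infdist_Ints_le[of z "\<lfloor>z\<rfloor> + 1"] by linarith+
  then have fl: "\<lfloor>z + h\<rfloor> = \<lfloor>z\<rfloor>" by linarith
  have "z \<notin> \<int>" using 1 by (auto elim!: Ints_cases)
  moreover have "z + h \<notin> \<int>" 
  proof
    assume "z + h \<in> \<int>"
    then have "z + h = \<lfloor>z + h\<rfloor>" by (metis floor_of_int Ints_cases)
    with fl 1 show False by linarith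
  qed
  ultimately show ?thesis using fl by (simp add: sawtooth_def)
qed

lemma tendsto_sawtooth_jump:
  assumes c: "c > 0"
  shows "((\<lambda>t. sawtooth (w - c * t) - sawtooth (w + c * t)) \<longlongrightarrow> (if w \<in> \<int> then 1 else 0)) (at_right 0)"
proof -
  \<comment> \<open>\<open>d\<close> bounds how far one can go on either side of \<open>w\<close>
    without meeting another jump: at an integer the next jump is at distance 1.\<close>
  define d where "d = (if w \<in> \<int> then 1 else infdist w \<int>)"
  have "d > 0"
    using in_closed_iff_infdist_zero[of "\<int>::real set" w] infdist_nonneg[of w \<int>] by (auto simp: d_def order_less_le)
  have "\<forall>\<^sub>F t in at_right 0. 0 < t \<and> t < d / c"
    using \<open>d > 0\<close> c eventually_at_right[of 0 "d / c"]
    by (intro eventually_conj) (auto simp: eventually_at_right_field intro: exI[of _ "d / c"])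
  then have "\<forall>\<^sub>F t in at_right 0. (if w \<in> \<int> then 1 else 0) - 2 * c * t
      = sawtooth (w - c * t) - sawtooth (w + c * t)"
  proof eventually_elim
    case (elim t)
    define h where "h = c * t"
    have h: "0 < h" "h < d" using elim c by (auto simp: h_def field_simps)
    show ?case
    proof (cases "w \<in> \<int>")
      case True
      then obtain k where k: "w = of_int k" by (rule Ints_cases)
      have d: "h < 1" using h True by (simp add: d_def)
      have f: "\<lfloor>w + h\<rfloor> = k" "\<lfloor>w - h\<rfloor> = k - 1"
        using h d k by linarith+
      have "w + h \<notin> \<int>" "w - h \<notin> \<int>"
        using f h d k by (auto elim!: Ints_cases)
      then show ?thesis using f k True by (simp add: sawtooth_def h_def)
    next
      case False
      then have "\<bar>h\<bar> < infdist w \<int>" "\<bar>- h\<bar> < infdist w \<int>" using h by (auto simp: d_def)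
      then show ?thesis using sawtooth_add[of h w] sawtooth_add[of "-h" w] False by (simp add: h_def)
    qed
  qed
  moreover have "((\<lambda>t. (if w \<in> \<int> then 1 else 0) - 2 * c * t) \<longlongrightarrow> (if w \<in> \<int> then 1 else 0) - 2 * c * 0) (at_right 0)"
    by (intro tendsto_intros)
  ultimately show ?thesis
    by (auto intro: Lim_transform_eventually)
qed

section \<open>Convergence and jumps of the Levy series\<close>

lemma summable_powr_weights:
  assumes "b \<ge> 2" "c > 0"
  shows "summable (\<lambda>i. real b powr (- (c * real (Suc i))))"
proof -
  have "real b powr (- (c * real (Suc i))) = (real b powr (- c)) ^ Suc i" for i
    using assms by (simp add: powr_realpow[symmetric] powr_powr del: power_Suc)
  moreover have "real b powr (- c) < 1" using assms by (simp add: powr_less_one)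
  ultimately show ?thesis
    by (simp del: power_Suc add: summable_Suc_iff[of "\<lambda>i. (real b powr (- c)) ^ i"] summable_geometric)
qed

lemma levy_term_eq:
  "sawtooth (real b ^ Suc i * x) / real b powr (\<alpha> * real (Suc i))
    = sawtooth (real b ^ Suc i * x) * real b powr (- (\<alpha> * real (Suc i)))"
  by (simp only: powr_minus divide_inverse)

lemma summable_bounded_powr_weights:
  assumes "b \<ge> 2" "\<alpha> > 0" "\<And>i. \<bar>f i\<bar> \<le> (K::real)"
  shows "summable (\<lambda>i. f i * real b powr (- (\<alpha> * real (Suc i))))"
proof (rule summable_comparison_test')
  show "summable (\<lambda>i. K * real b powr (- (\<alpha> * real (Suc i))))"
    by (intro summable_mult summable_powr_weights assms)
qed (auto simp: abs_mult intro: mult_right_mono assms)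

lemma levy_sums:
  assumes "b \<ge> 2" "\<alpha> > 0"
  shows "(\<lambda>i. sawtooth (real b ^ Suc i * x) * real b powr (- (\<alpha> * real (Suc i)))) sums levy b \<alpha> x"
  unfolding levy_def levy_term_eq
  by (intro summable_sums summable_bounded_powr_weights[OF assms, of _ "1 / 2"] sawtooth_bound)

text \<open>At a given point every term has jump 0 or its full weight, all of the same sign, so the
  jumps cannot cancel and the n-th weight bounds the total from below. Tannery's theorem exchanges
  the sum with the one-sided limits. The fraction need not be in lowest terms.\<close>

lemma levy_jump:
  assumes b: "b \<ge> 2" and \<alpha>: "\<alpha> > 0" and n: "n \<ge> 1"
  obtains J where "real b powr (- (\<alpha> * real n)) \<le> J"
    and "((\<lambda>t. levy b \<alpha> (of_int k / real b ^ n - t) - levy b \<alpha> (of_int k / real b ^ n + t)) \<longlongrightarrow> J) (at_right 0)"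
proof -
  define s where "s = of_int k / real b ^ n"
  define w where "w = (\<lambda>i. real b powr (- (\<alpha> * real (Suc i))))"
  define D where "D = (\<lambda>i t. (sawtooth (real b ^ Suc i * s - real b ^ Suc i * t) - sawtooth (real b ^ Suc i * s + real b ^ Suc i * t)) * w i)"
  define l where "l = (\<lambda>i. (if real b ^ Suc i * s \<in> \<int> then 1 else 0) * w i)"
  have sumw: "summable w"
    unfolding w_def by (rule summable_powr_weights[OF b \<alpha>])
  have D_lim: "(D i \<longlongrightarrow> l i) (at_right 0)" for i
    unfolding D_def l_def using b by (intro tendsto_mult tendsto_const tendsto_sawtooth_jump) auto
  have D_bd: "norm (D i t) \<le> w i" for i t
  proof -
    have "\<bar>sawtooth (real b ^ Suc i * s - real b ^ Suc i * t) - sawtooth (real b ^ Suc i * s + real b ^ Suc i * t)\<bar> \<le> 1"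
      using sawtooth_bound[of "real b ^ Suc i * s - real b ^ Suc i * t"]
        sawtooth_bound[of "real b ^ Suc i * s + real b ^ Suc i * t"] by linarith
    then have "\<bar>sawtooth (real b ^ Suc i * s - real b ^ Suc i * t) - sawtooth (real b ^ Suc i * s + real b ^ Suc i * t)\<bar> * w i \<le> 1 * w i"
      by (intro mult_right_mono) (auto simp: w_def)
    then show ?thesis by (simp add: D_def abs_mult w_def)
  qed
  have T: "summable (\<lambda>i. l i)" "((\<lambda>t. \<Sum>i. D i t) \<longlongrightarrow> suminf l) (at_right 0)"
    using tannerys_theorem[of D l "at_right 0" w] D_lim D_bd sumw
    by (auto simp: always_eventually intro: summable_norm_cancel)
  have "levy b \<alpha> (s - t) - levy b \<alpha> (s + t) = (\<Sum>i. D i t)" for t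
    using sums_diff[OF levy_sums[OF b \<alpha>, of "s - t"] levy_sums[OF b \<alpha>, of "s + t"]]
    by (simp add: sums_iff D_def w_def algebra_simps)
  with T(2) have lim: "((\<lambda>t. levy b \<alpha> (s - t) - levy b \<alpha> (s + t)) \<longlongrightarrow> suminf l) (at_right 0)"
    by simp
  obtain n' where n': "n = Suc n'" using n by (cases n) auto
  have "real b ^ Suc n' * s = of_int k" using b by (simp add: s_def n')
  then have "l n' = real b powr (- (\<alpha> * real n))" by (simp add: l_def w_def n')
  moreover have "(\<Sum>i\<in>{n'}. l i) \<le> suminf l"
    by (rule sum_le_suminf[OF T(1)]) (auto simp: l_def w_def)
  ultimately show ?thesis using that[of "suminf l"] lim by (simp add: s_def)
qed

text \<open>The Taylor polynomial is continuous, so a jump at \<open>s\<close> near \<open>x\<close>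
  is at most \<open>2 * C * \<bar>s - x\<bar> powr \<beta>\<close>. For a b-adic \<open>s\<close> of
  level n with \<bar>s - x\<bar> at most b^(- n a) and jump at least b^(- \<alpha> n), letting n
  grow gives the inequality.\<close>

lemma levy_holder_le:
  assumes b: "b \<ge> 2" and \<alpha>: "\<alpha> > 0" and \<beta>: "\<beta> > 0" and hold: "holder_at (levy b \<alpha>) \<beta> x"
    and inf: "\<exists>\<^sub>\<infinity>n. infdist (real b ^ n * x) \<int> \<le> real b powr (- (real n * (a - 1)))"
  shows "a * \<beta> \<le> \<alpha>"
proof (rule ccontr)
  assume "\<not> a * \<beta> \<le> \<alpha>"
  from hold obtain C r P where C: "C > 0" and r: "r > 0" and
    H: "\<And>x'. x' \<in> {x - r..x + r} \<Longrightarrow> \<bar>levy b \<alpha> x' - poly P (x' - x)\<bar> \<le> C * \<bar>x' - x\<bar> powr \<beta>"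
    unfolding holder_at_def by metis
  have jump: "real b powr (- (\<alpha> * real n)) \<le> 2 * C * \<bar>s - x\<bar> powr \<beta>"
    if n: "n \<ge> 1" and s: "s = of_int k / real b ^ n" "\<bar>s - x\<bar> < r" for n k s
  proof -
    obtain J where J: "real b powr (- (\<alpha> * real n)) \<le> J"
      "((\<lambda>t. levy b \<alpha> (s - t) - levy b \<alpha> (s + t)) \<longlongrightarrow> J) (at_right 0)"
      using levy_jump[OF b \<alpha> n] s(1) by blast
    have "((\<lambda>t. levy b \<alpha> (s - t) - levy b \<alpha> (s + t) - (poly P (s - t - x) - poly P (s + t - x))) \<longlongrightarrow> J - (poly P (s - 0 - x) - poly P (s + 0 - x))) (at_right 0)"
      by (intro tendsto_diff J poly_isCont[THEN isCont_tendsto_compose] tendsto_intros)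
    moreover have "((\<lambda>t. C * \<bar>s - t - x\<bar> powr \<beta> + C * \<bar>s + t - x\<bar> powr \<beta>) \<longlongrightarrow>
        C * \<bar>s - 0 - x\<bar> powr \<beta> + C * \<bar>s + 0 - x\<bar> powr \<beta>) (at_right 0)"
      using \<beta> by (intro tendsto_intros tendsto_powr') auto
    moreover have "\<forall>\<^sub>F t in at_right 0. levy b \<alpha> (s - t) - levy b \<alpha> (s + t) - (poly P (s - t - x) - poly P (s + t - x))
        \<le> C * \<bar>s - t - x\<bar> powr \<beta> + C * \<bar>s + t - x\<bar> powr \<beta>"
    proof -
      have "\<forall>\<^sub>F t in at_right 0. 0 < t \<and> t < r - \<bar>s - x\<bar>"
        using s by (intro eventually_conj) (auto simp: eventually_at_right_field intro: exI[of _ "r - \<bar>s - x\<bar>"])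
      then show ?thesis
      proof eventually_elim
        case (elim t)
        have "s - t \<in> {x - r..x + r}" "s + t \<in> {x - r..x + r}" using elim by auto
        from this[THEN H] show ?case by linarith
      qed
    qed
    ultimately have "J - (poly P (s - 0 - x) - poly P (s + 0 - x)) \<le> C * \<bar>s - 0 - x\<bar> powr \<beta> + C * \<bar>s + 0 - x\<bar> powr \<beta>"
      by (intro tendsto_le[OF trivial_limit_at_right_real])
    with J(1) show ?thesis by simp
  qed
  have "\<forall>\<^sub>F n in sequentially. 2 * C + 1 \<le> real b powr ((a * \<beta> - \<alpha>) * real n)"
    using \<open>\<not> a * \<beta> \<le> \<alpha>\<close> b by (intro eventually_powr_dominated) auto
  moreover have "\<forall>\<^sub>F n in sequentially. 2 / r \<le> real b powr (1 * real n)"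
    using b by (intro eventually_powr_dominated) auto
  moreover have "\<forall>\<^sub>F n in sequentially. 1 \<le> n" by (rule eventually_ge_at_top)
  ultimately have ev: "\<forall>\<^sub>\<infinity>n. 2 * C + 1 \<le> real b powr ((a * \<beta> - \<alpha>) * real n) \<and> 2 / r \<le> real b powr (1 * real n) \<and> 1 \<le> n"
    unfolding cofinite_eq_sequentially by (intro eventually_conj)
  obtain n where n: "infdist (real b ^ n * x) \<int> \<le> real b powr (- (real n * (a - 1)))"
    "2 * C + 1 \<le> real b powr ((a * \<beta> - \<alpha>) * real n)" "2 / r \<le> real b powr (1 * real n)" "1 \<le> n"
    using frequently_ex[OF INFM_conjI[OF inf ev]] by blast
  obtain k where k: "infdist (real b ^ n * x) \<int> = \<bar>real b ^ n * x - of_int k\<bar>"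
    by (rule infdist_Ints_attained)
  define s where "s = of_int k / real b ^ n"
  have dist: "\<bar>s - x\<bar> = infdist (real b ^ n * x) \<int> / real b ^ n"
  proof -
    have "real b ^ n * x - of_int k = real b ^ n * (x - s)" using b by (simp add: s_def field_simps)
    then show ?thesis using b unfolding k by (simp add: abs_mult abs_minus_commute)
  qed
  also have "\<dots> \<le> 1 / real b ^ n" using b by (intro divide_right_mono infdist_Ints_le_1) auto
  also have "\<dots> < r" using n b r by (simp add: powr_realpow field_simps)
  finally have "\<bar>s - x\<bar> < r" .
  then have "real b powr (- (\<alpha> * real n)) \<le> 2 * C * \<bar>s - x\<bar> powr \<beta>"
    using jump[OF n(4)] s_def by blast
  also have "\<bar>s - x\<bar> \<le> real b powr (- (real n * a))"
  proof -
    have "\<bar>s - x\<bar> \<le> real b powr (- (real n * (a - 1))) / real b ^ n"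
      unfolding dist using n b by (intro divide_right_mono) auto
    also have "\<dots> = real b powr (- (real n * a))"
      using b by (simp add: powr_realpow[symmetric] powr_diff[symmetric] algebra_simps)
    finally show ?thesis .
  qed
  then have "2 * C * \<bar>s - x\<bar> powr \<beta> \<le> 2 * C * (real b powr (- (real n * a))) powr \<beta>"
    using C \<beta> by (intro mult_left_mono powr_mono2) auto
  also have "\<dots> = 2 * C * real b powr (- (real n * a * \<beta>))" by (simp add: powr_powr)
  also have "\<dots> < real b powr ((a * \<beta> - \<alpha>) * real n) * real b powr (- (real n * a * \<beta>))"
    using n b by (intro mult_strict_right_mono) auto
  also have "\<dots> = real b powr (- (\<alpha> * real n))"
    by (simp add: powr_add[symmetric] algebra_simps)
  finally show False by simp
qed

text \<open>The i-th term is affine around \<open>x\<close> as long as the increment h does not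
  reach its next jump, whose distance is at least of order b^(- a i). Beyond it the term is merely
  bounded. Interpolating between the two regimes bounds the error by a multiple of \<bar>h\<bar>
  powr \<beta> times b^(a \<beta> i), and \<open>a * \<beta> < \<alpha>\<close> makes the weighted
  sum converge.\<close>

lemma holder_at_levy:
  assumes b: "b \<ge> 2" and \<alpha>: "\<alpha> > 0" and \<beta>: "\<beta> > 0" and a: "a \<ge> 1" and less: "a * \<beta> < \<alpha>"
    and \<Delta>: "approx_exponent b x < ereal a"
  shows "holder_at (levy b \<alpha>) \<beta> x"
proof -
  note ev = approx_exponent_less_eventually[OF \<Delta>]
  \<comment> \<open>Once the distance vanishes it vanishes at all later levels, which contradicts
    the eventual lower bound. Positivity at the finitely many early levels then gives a uniform
    constant \<open>c\<close>.\<close>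
  have pos: "infdist (real b ^ n * x) \<int> > 0" for n
  proof (rule ccontr)
    assume "\<not> ?thesis"
    then have 0: "infdist (real b ^ n * x) \<int> = 0" 
      using infdist_nonneg[of "real b ^ n * x" \<int>] by linarith
    have z: "infdist (real b ^ (n + j) * x) \<int> \<le> 0" for j
      using infdist_Ints_power_mult[of b n j x] 0 by simp
    obtain N where "\<And>n'. n' \<ge> N \<Longrightarrow> real b powr (- (real n' * (a - 1))) < infdist (real b ^ n' * x) \<int>"
      using ev by (auto simp: MOST_nat_le)
    have "real b powr (- (real (n + N) * (a - 1))) < 0"
      by (rule order.strict_trans2[OF \<open>\<And>n'. n' \<ge> N \<Longrightarrow> real b powr (- (real n' * (a - 1))) < infdist (real b ^ n' * x) \<int>\<close> z]) simp
    then show False by (simp add: not_less[symmetric])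
  qed
  obtain c where c: "c > 0" "c \<le> 1" "\<And>n. c * real b powr (- (real n * (a - 1))) \<le> infdist (real b ^ n * x) \<int>"
  proof -
    obtain N where N: "\<And>n. n \<ge> N \<Longrightarrow> real b powr (- (real n * (a - 1))) < infdist (real b ^ n * x) \<int>"
      using ev by (auto simp: MOST_nat_le)
    define c where "c = Min (insert 1 ((\<lambda>n. infdist (real b ^ n * x) \<int>) ` {..<N}))"
    have 1: "c > 0" "c \<le> 1" using pos by (auto simp: c_def)
    moreover have "c * real b powr (- (real n * (a - 1))) \<le> infdist (real b ^ n * x) \<int>" for n
    proof (cases "n < N")
      case True
      then have "c \<le> infdist (real b ^ n * x) \<int>" by (auto simp: c_def)
      moreover have "real b powr (- (real n * (a - 1))) \<le> real b powr 0"
        using b a by (intro powr_mono) auto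
      then have "c * real b powr (- (real n * (a - 1))) \<le> c * 1"
        using 1 b by (intro mult_left_mono) auto
      ultimately show ?thesis by simp
    next
      case False
      have "c * real b powr (- (real n * (a - 1))) \<le> 1 * real b powr (- (real n * (a - 1)))"
        using 1 by (intro mult_right_mono) auto
      with N[of n] False show ?thesis by simp
    qed
    ultimately show ?thesis by (rule that)
  qed
  define w where "w = (\<lambda>i. real b powr (- (\<alpha> * real (Suc i))))"
  \<comment> \<open>\<open>q i h\<close> compares the increment with the guaranteed distance to the
    next jump of term i: \<open>q i h < 1\<close> means that no jump is crossed.\<close>
  define q where "q = (\<lambda>i h. \<bar>h\<bar> * real b powr (a * real (Suc i)) / c)"
  \<comment> \<open>The linear part of the Taylor polynomial has to be subtracted only if \<open>\<beta> > 1\<close>; otherwise it need not converge.\<close>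
  define \<kappa> :: real where "\<kappa> = (if \<beta> > 1 then 1 else 0)"
  define e where "e = (\<lambda>i h. sawtooth (real b ^ Suc i * (x + h)) - sawtooth (real b ^ Suc i * x) - \<kappa> * (real b ^ Suc i * h))"
  have small: "sawtooth (real b ^ Suc i * (x + h)) - sawtooth (real b ^ Suc i * x) = real b ^ Suc i * h"
    if "q i h < 1" for i h
  proof -
    have "\<bar>real b ^ Suc i * h\<bar> = real b powr (real (Suc i)) * \<bar>h\<bar>" 
      using b by (simp add: abs_mult powr_realpow del: power_Suc of_nat_Suc)
    also have "\<dots> = q i h * (c * real b powr (- (real (Suc i) * (a - 1))))"
      using c by (simp add: q_def powr_add[symmetric] algebra_simps del: of_nat_Suc)
    also have "\<dots> < 1 * (c * real b powr (- (real (Suc i) * (a - 1))))"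
      using c that b by (intro mult_strict_right_mono) auto
    also have "\<dots> \<le> infdist (real b ^ Suc i * x) \<int>" using c(3)[of "Suc i"] by simp
    finally show ?thesis
      using sawtooth_add[of "real b ^ Suc i * h" "real b ^ Suc i * x"] by (simp add: distrib_left del: power_Suc)
  qed
  have bh: "\<bar>real b ^ Suc i * h\<bar> \<le> q i h" for i h
  proof -
    have "\<bar>real b ^ Suc i * h\<bar> = \<bar>h\<bar> * real b powr (1 * real (Suc i))" 
      using b by (simp add: abs_mult powr_realpow del: power_Suc of_nat_Suc)
    also have "\<dots> \<le> \<bar>h\<bar> * real b powr (a * real (Suc i))"
      using a b by (intro mult_left_mono powr_mono mult_right_mono) auto
    also have "\<dots> \<le> q i h"
      using c by (simp add: q_def divide_simps mult_left_le)
    finally show ?thesis .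
  qed
  have q0: "q i h \<ge> 0" for i h using c by (simp add: q_def)
  have e_le: "\<bar>e i h\<bar> \<le> 2 * q i h powr \<beta>" for i h
  proof (cases "q i h < 1")
    case True
    show ?thesis
    proof (cases "\<beta> > 1")
      case True
      then show ?thesis using small[OF \<open>q i h < 1\<close>] by (simp add: e_def \<kappa>_def)
    next
      case False
      then have "\<bar>e i h\<bar> \<le> q i h" using small[OF True] bh[of i h] by (simp add: e_def \<kappa>_def)
      also have "\<dots> \<le> q i h powr \<beta>"
        using powr_mono'[of \<beta> 1 "q i h"] True False q0[of i h] by simp
      finally show ?thesis using powr_ge_zero[of "q i h" \<beta>] by linarith
    qed
  next
    case False
    have 1: "\<bar>sawtooth (real b ^ Suc i * (x + h)) - sawtooth (real b ^ Suc i * x)\<bar> \<le> 1"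
      using sawtooth_bound[of "real b ^ Suc i * (x + h)"] sawtooth_bound[of "real b ^ Suc i * x"] by linarith
    have 2: "1 \<le> q i h powr \<beta>" using False \<beta> by (intro ge_one_powr_ge_zero) auto
    show ?thesis
    proof (cases "\<beta> > 1")
      case True
      have "\<bar>e i h\<bar> \<le> 1 + q i h" using 1 bh[of i h] True unfolding e_def \<kappa>_def by simp
      moreover have "q i h \<le> q i h powr \<beta>" using powr_mono[of 1 \<beta> "q i h"] True False by simp
      ultimately show ?thesis using 2 by linarith
    qed (use 1 2 in \<open>auto simp: e_def \<kappa>_def\<close>)
  qed
  define v where "v = (\<lambda>i. real b powr (- ((\<alpha> - a * \<beta>) * real (Suc i))))"
  have sumv: "summable v" unfolding v_def using less by (intro summable_powr_weights b) auto
  have ew_le: "\<bar>e i h * w i\<bar> \<le> 2 * c powr (- \<beta>) * \<bar>h\<bar> powr \<beta> * v i" for i h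
  proof -
    have "\<bar>e i h * w i\<bar> \<le> 2 * q i h powr \<beta> * w i"
      using e_le[of i h] by (simp add: abs_mult w_def mult_right_mono)
    also have "\<dots> = 2 * c powr (- \<beta>) * \<bar>h\<bar> powr \<beta> * (real b powr (a * real (Suc i) * \<beta>) * w i)"
      using c by (simp add: q_def powr_mult powr_divide powr_powr powr_minus divide_inverse inverse_powr del: of_nat_Suc)
    also have "real b powr (a * real (Suc i) * \<beta>) * w i = v i"
      by (simp add: w_def v_def powr_add[symmetric] algebra_simps)
    finally show ?thesis .
  qed
  define lin where "lin = (\<lambda>i. \<kappa> * (real b ^ Suc i * w i))"
  have sumlin: "summable lin"
  proof (cases "\<beta> > 1")
    case True
    \<comment> \<open>As \<open>a \<ge> 1\<close>, the case \<open>\<beta> > 1\<close> forces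
      \<open>\<alpha> > 1\<close>, and then the series of slopes converges.\<close>
    then have "1 < a * \<beta>" using a by (metis less_le_trans mult_le_cancel_right1 not_one_less_zero order_less_le_trans linorder_not_less order.strict_trans zero_less_one)
    then have "summable (\<lambda>i. real b powr (- ((\<alpha> - 1) * real (Suc i))))"
      using less by (intro summable_powr_weights b) auto
    moreover have "lin i = real b powr (- ((\<alpha> - 1) * real (Suc i)))" for i
      using True b by (simp add: lin_def w_def \<kappa>_def powr_realpow[symmetric] powr_add[symmetric] algebra_simps del: power_Suc)
    ultimately show ?thesis by presburger
  qed (simp add: lin_def \<kappa>_def)
  define P where "P = [:levy b \<alpha> x, suminf lin:]"
  \<comment> \<open>For \<open>\<beta> \<le> 1\<close> the series \<open>lin\<close> vanishes and
    \<open>P\<close> is constant; otherwise degree 1 is allowed.\<close>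
  have "real (degree P) < \<beta>"
    using \<beta> by (cases "\<beta> > 1") (auto simp: P_def lin_def \<kappa>_def)
  moreover have "\<bar>levy b \<alpha> x' - poly P (x' - x)\<bar> \<le> (2 * c powr (- \<beta>) * suminf v) * \<bar>x' - x\<bar> powr \<beta>" for x'
  proof -
    define h where "h = x' - x"
    have "(\<lambda>i. sawtooth (real b ^ Suc i * (x + h)) * w i - sawtooth (real b ^ Suc i * x) * w i - h * lin i)
      sums (levy b \<alpha> (x + h) - levy b \<alpha> x - h * suminf lin)"
      unfolding w_def by (intro sums_diff levy_sums b \<alpha> sums_mult summable_sums sumlin)
    moreover have "sawtooth (real b ^ Suc i * (x + h)) * w i - sawtooth (real b ^ Suc i * x) * w i - h * lin i = e i h * w i" for i
      by (simp add: e_def lin_def algebra_simps)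
    ultimately have "(\<lambda>i. e i h * w i) sums (levy b \<alpha> x' - poly P (x' - x))"
      by (simp add: P_def h_def algebra_simps)
    then have "levy b \<alpha> x' - poly P (x' - x) = (\<Sum>i. e i h * w i)" by (simp add: sums_iff)
    also have "\<bar>\<dots>\<bar> \<le> (\<Sum>i. 2 * c powr (- \<beta>) * \<bar>h\<bar> powr \<beta> * v i)"
      using norm_suminf_le[of "\<lambda>i. e i h * w i" "\<lambda>i. 2 * c powr (- \<beta>) * \<bar>h\<bar> powr \<beta> * v i"] ew_le sumv
      by (simp add: summable_mult)
    also have "\<dots> = 2 * c powr (- \<beta>) * \<bar>h\<bar> powr \<beta> * suminf v" by (rule suminf_mult[OF sumv])
    finally show ?thesis by (simp add: h_def mult_ac)
  qed
  moreover have "v 0 > 0" using b by (simp add: v_def)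
  then have "suminf v > 0" using sumv by (intro suminf_pos2[of v 0]) (auto simp: v_def)
  then have "2 * c powr (- \<beta>) * suminf v > 0" using c by simp
  ultimately show ?thesis unfolding holder_at_def
    by (intro exI[of _ "2 * c powr (- \<beta>) * suminf v"] exI[of _ "1::real"] exI[of _ P] conjI) auto
qed

text \<open>For infinite \<Delta>, in particular at b-adic rationals, division in
  \<open>ereal\<close> gives the correct exponent 0.\<close>

lemma holder_exponent_levy:
  assumes b: "b \<ge> 2" and \<alpha>: "\<alpha> > 0"
  shows "holder_exponent (levy b \<alpha>) x = ereal \<alpha> / approx_exponent b x"
proof -
  define \<Delta> where "\<Delta> = approx_exponent b x"
  have \<Delta>1: "1 \<le> \<Delta>" unfolding \<Delta>_def by (rule approx_exponent_ge_1)
  have nonneg: "0 \<le> ereal \<alpha> / \<Delta>"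
    using \<Delta>1 \<alpha> by (cases \<Delta>) (auto simp: one_ereal_def)
  have up: "ereal \<beta> \<le> ereal \<alpha> / \<Delta>" if "\<beta> > 0" "holder_at (levy b \<alpha>) \<beta> x" for \<beta>
  proof -
    have "\<Delta> \<le> ereal (\<alpha> / \<beta>)" unfolding \<Delta>_def approx_exponent_def
    proof (rule Sup_least)
      fix z assume "z \<in> {ereal a | a. a \<ge> 1 \<and> (\<exists>\<^sub>\<infinity>n::nat. infdist (real b ^ n * x) \<int> \<le> real b powr (- (real n * (a - 1))))}"
      then obtain a where a: "z = ereal a" "\<exists>\<^sub>\<infinity>n::nat. infdist (real b ^ n * x) \<int> \<le> real b powr (- (real n * (a - 1)))"
        by blast
      from levy_holder_le[OF b \<alpha> that a(2)] a that show "z \<le> ereal (\<alpha> / \<beta>)" by (simp add: field_simps)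
    qed
    then show ?thesis using \<Delta>1 that \<alpha> by (cases \<Delta>) (auto simp: field_simps one_ereal_def)
  qed
  have low: "ereal \<beta> \<le> holder_exponent (levy b \<alpha>) x" if \<beta>: "\<beta> > 0" "ereal \<beta> < ereal \<alpha> / \<Delta>" for \<beta>
  proof -
    from \<beta> \<Delta>1 \<alpha> obtain d where d: "\<Delta> = ereal d" by (cases \<Delta>) (auto simp: zero_ereal_def)
    with \<Delta>1 have d1: "d \<ge> 1" by (simp add: one_ereal_def)
    have "d < \<alpha> / \<beta>" using \<beta> d d1 by (simp add: field_simps)
    then obtain a where a: "d < a" "a < \<alpha> / \<beta>" using dense by blast
    have "holder_at (levy b \<alpha>) \<beta> x"
      using a d1 \<beta> d b \<alpha> by (intro holder_at_levy[of b \<alpha> \<beta> a]) (auto simp: field_simps \<Delta>_def)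
    then show ?thesis unfolding holder_exponent_def using \<beta> by (intro Sup_upper) auto
  qed
  have "holder_exponent (levy b \<alpha>) x \<le> ereal \<alpha> / \<Delta>"
    unfolding holder_exponent_def using up nonneg by (intro Sup_least) auto
  moreover have "ereal \<alpha> / \<Delta> \<le> holder_exponent (levy b \<alpha>) x"
  proof (rule ereal_le_if_real_below)
    fix r assume r: "ereal r < ereal \<alpha> / \<Delta>"
    show "ereal r \<le> holder_exponent (levy b \<alpha>) x"
    proof (cases "r > 0")
      case False
      then have "ereal r \<le> 0" by (simp add: zero_ereal_def)
      also have "0 \<le> holder_exponent (levy b \<alpha>) x" unfolding holder_exponent_def by (intro Sup_upper) auto
      finally show ?thesis .
    qed (use low r in auto)
  qed
  ultimately show ?thesis by (simp add: \<Delta>_def)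
qed

lemma holder_exponent_translated_levy:
  assumes "b \<ge> 2" "\<alpha> > 0"
  shows "holder_exponent (translated_levy b \<alpha> y) x = ereal \<alpha> / approx_exponent b (x - y)"
proof -
  have eq: "translated_levy b \<alpha> y z = levy b \<alpha> (z - y)" for z
    by (simp add: translated_levy_def levy_def)
  have "(\<forall>z\<in>{x - r..x + r}. \<bar>translated_levy b \<alpha> y z - poly P (z - x)\<bar> \<le> C * \<bar>z - x\<bar> powr a) \<longleftrightarrow>
    (\<forall>z\<in>{x - y - r..x - y + r}. \<bar>levy b \<alpha> z - poly P (z - (x - y))\<bar> \<le> C * \<bar>z - (x - y)\<bar> powr a)"
    (is "?L \<longleftrightarrow> ?R") for r P C a
  proof
    assume L: ?L
    show ?R
    proof
      fix z assume "z \<in> {x - y - r..x - y + r}"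
      then have "z + y \<in> {x - r..x + r}" by auto
      with L have "\<bar>translated_levy b \<alpha> y (z + y) - poly P (z + y - x)\<bar> \<le> C * \<bar>z + y - x\<bar> powr a"
        by blast
      moreover have "z + y - x = z - (x - y)" by simp
      ultimately show "\<bar>levy b \<alpha> z - poly P (z - (x - y))\<bar> \<le> C * \<bar>z - (x - y)\<bar> powr a"
        by (simp only: eq add_diff_cancel_right')
    qed
  next
    assume R: ?R
    show ?L
    proof
      fix z assume "z \<in> {x - r..x + r}"
      then have "z - y \<in> {x - y - r..x - y + r}" by auto
      with R have "\<bar>levy b \<alpha> (z - y) - poly P (z - y - (x - y))\<bar> \<le> C * \<bar>z - y - (x - y)\<bar> powr a"
        by blast
      then show "\<bar>translated_levy b \<alpha> y z - poly P (z - x)\<bar> \<le> C * \<bar>z - x\<bar> powr a"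
        by (simp add: eq)
    qed
  qed
  then have "holder_at (translated_levy b \<alpha> y) a x \<longleftrightarrow> holder_at (levy b \<alpha>) a (x - y)" for a
    unfolding holder_at_def by simp
  then show ?thesis
    using holder_exponent_levy[OF assms, of "x - y"] by (simp add: holder_exponent_def)
qed

section \<open>Estimates of Hausdorff measures\<close>

lemma hausdorff_measure_eq_0I:
  assumes "\<And>\<delta> \<epsilon>. \<delta> > 0 \<Longrightarrow> \<epsilon> > 0 \<Longrightarrow>
    \<exists>U. (\<forall>i. bounded (U i) \<and> diameter (U i) \<le> \<delta>) \<and> E \<subseteq> (\<Union>i. U i) \<and> (\<Sum>i. diam_weight s (U i)) \<le> ennreal \<epsilon>"
  shows "hausdorff_measure s E = 0"
proof -
  have "hausdorff_premeasure s \<delta> E \<le> 0" if "\<delta> > 0" for \<delta>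
  proof (rule ennreal_le_epsilon)
    fix \<epsilon> :: real assume "\<epsilon> > 0"
    from assms[OF \<open>\<delta> > 0\<close> this]
    obtain U where U: "\<forall>i. bounded (U i) \<and> diameter (U i) \<le> \<delta>" "E \<subseteq> (\<Union>i. U i)"
      "(\<Sum>i. diam_weight s (U i)) \<le> ennreal \<epsilon>" by (elim exE conjE)
    have "hausdorff_premeasure s \<delta> E \<le> (\<Sum>i. diam_weight s (U i))"
      unfolding hausdorff_premeasure_def using U by (intro Inf_lower) blast
    also note U(3)
    finally show "hausdorff_premeasure s \<delta> E \<le> 0 + ennreal \<epsilon>" by simp
  qed
  then have "hausdorff_measure s E \<le> 0"
    unfolding hausdorff_measure_def by (intro SUP_least) auto
  then show ?thesis by simp
qed

lemma summable_poly_powr: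
  assumes b: "b \<ge> 2" and s: "s * a > 1" and s0: "s > 0"
  shows "summable (\<lambda>n. (2 * real n * real b ^ n + 1) * (2 * real b powr (- (real n * a))) powr s)"
proof -
  \<comment> \<open>\<open>q\<close> is the square root of the geometric ratio: one factor
    \<open>q ^ n\<close> absorbs the polynomial, the other one is summable.\<close>
  define q where "q = real b powr ((1 - s * a) / 2)"
  have q: "0 < q" "q < 1" using b s by (auto simp: q_def powr_less_one)
  have "summable (\<lambda>n. (2 * real n + 1) * (2 powr s * real b powr ((1 - s * a) * real n)))"
  proof (rule summable_comparison_test_ev)
    have "(\<lambda>n. (2 * real n + 1) * 2 powr s * q ^ n) \<longlonglongrightarrow> 0"
      using q by real_asymp
    then have "\<forall>\<^sub>F n in sequentially. (2 * real n + 1) * 2 powr s * q ^ n < 1"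
      by (rule order_tendstoD) simp
    then show "\<forall>\<^sub>F n in sequentially. norm ((2 * real n + 1) * (2 powr s * real b powr ((1 - s * a) * real n))) \<le> q ^ n"
    proof eventually_elim
      case (elim n)
      have "q ^ n = real b powr ((1 - s * a) / 2 * real n)"
        using b by (simp add: q_def powr_realpow[symmetric] powr_powr)
      moreover have "(1 - s * a) * real n = (1 - s * a) / 2 * real n + (1 - s * a) / 2 * real n"
        by (simp add: field_simps)
      ultimately have "real b powr ((1 - s * a) * real n) = q ^ n * q ^ n"
        by (simp only: powr_add)
      then have "norm ((2 * real n + 1) * (2 powr s * real b powr ((1 - s * a) * real n))) = ((2 * real n + 1) * 2 powr s * q ^ n) * q ^ n"
        using q by (simp add: abs_mult mult_ac)
      also have "\<dots> \<le> 1 * q ^ n" using elim q by (intro mult_right_mono) auto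
      finally show ?case by simp
    qed
  qed (use q in simp)
  then show ?thesis
  proof (rule summable_comparison_test'[where N = 0])
    fix n
    have "(2 * real b powr (- (real n * a))) powr s = 2 powr s * real b powr (- (s * a * real n))"
      by (simp add: powr_mult powr_powr mult_ac)
    moreover have "2 * real n * real b ^ n + 1 \<le> (2 * real n + 1) * real b ^ n"
      using b by (simp add: distrib_right)
    ultimately have "norm ((2 * real n * real b ^ n + 1) * (2 * real b powr (- (real n * a))) powr s)
      \<le> (2 * real n + 1) * real b ^ n * (2 powr s * real b powr (- (s * a * real n)))"
      by (simp add: abs_mult mult_right_mono)
    also have "\<dots> = (2 * real n + 1) * (2 powr s * (real b powr real n * real b powr (- (s * a * real n))))"
      using b by (simp add: powr_realpow)
    also have "\<dots> = (2 * real n + 1) * (2 powr s * real b powr ((1 - s * a) * real n))"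
      by (simp add: powr_add[symmetric] algebra_simps)
    finally show "norm ((2 * real n * real b ^ n + 1) * (2 * real b powr (- (real n * a))) powr s)
      \<le> (2 * real n + 1) * (2 powr s * real b powr ((1 - s * a) * real n))" .
  qed
qed

text \<open>The points of \<open>E\<close> in the interval from \<open>-n\<close> to \<open>n\<close> that are approximated at level \<open>n\<close> are covered by
  \<open>2 n b^n + 1\<close> intervals of length \<open>2 b powr (- n a)\<close>.\<close>
lemma hausdorff_measure_approximable_eq_0:
  assumes b: "b \<ge> 2" and s: "s * a > 1" and s0: "s > 0" and a0: "a \<ge> 1"
    and E: "\<And>x. x \<in> E \<Longrightarrow> \<exists>\<^sub>\<infinity>n. infdist (real b ^ n * x) \<int> \<le> real b powr (- (real n * (a - 1)))"
  shows "hausdorff_measure s E = 0"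
proof (rule hausdorff_measure_eq_0I)
  fix \<delta> \<epsilon> :: real assume \<delta>: "\<delta> > 0" and \<epsilon>: "\<epsilon> > 0"
  define g where "g = (\<lambda>n. (2 * real n * real b ^ n + 1) * (2 * real b powr (- (real n * a))) powr s)"
  have sg: "summable g" unfolding g_def by (rule summable_poly_powr[OF b s s0])
  have g0: "g n \<ge> 0" for n by (simp add: g_def)
  have "\<forall>\<^sub>F N in sequentially. norm (\<Sum>n. g (n + N)) < \<epsilon>"
    using suminf_exist_split[OF \<epsilon> sg] by (auto simp: eventually_sequentially add.commute)
  moreover have "\<forall>\<^sub>F n in sequentially. 2 / \<delta> \<le> real b powr (a * real n)"
    using b a0 by (intro eventually_powr_dominated) auto
  then have "\<forall>\<^sub>F N in sequentially. \<forall>n\<ge>N. 2 / \<delta> \<le> real b powr (a * real n)"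
    by (rule eventually_all_ge_at_top)
  ultimately have "\<forall>\<^sub>F N in sequentially. norm (\<Sum>n. g (n + N)) < \<epsilon> \<and> (\<forall>n\<ge>N. 2 / \<delta> \<le> real b powr (a * real n))"
    by (rule eventually_conj)
  then obtain N where N: "norm (\<Sum>n. g (n + N)) < \<epsilon>" "\<And>n. n \<ge> N \<Longrightarrow> 2 / \<delta> \<le> real b powr (a * real n)"
    unfolding eventually_sequentially by blast
  define V where "V = (\<lambda>(n::nat, k::nat). if k \<le> 2 * (n + N) * b ^ (n + N)
    then cball ((real k - real ((n + N) * b ^ (n + N))) / real b ^ (n + N)) (real b powr (- (real (n + N) * a)))
    else {})"
  define U where "U = V \<circ> prod_decode"
  have diamV: "diameter (V (n, k)) \<le> \<delta>" "bounded (V (n, k))" for n k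
  proof -
    have "2 * real b powr (- (real (n + N) * a)) \<le> \<delta>"
    proof -
      have "real b powr (- (real (n + N) * a)) = 1 / real b powr (a * real (n + N))"
        by (simp only: powr_minus_divide mult.commute)
      moreover have "2 * (1 / X) \<le> \<delta>" if "2 / \<delta> \<le> X" "X > 0" for X
        using that \<delta> by (simp add: field_simps)
      ultimately show ?thesis using N(2)[of "n + N"] b by simp
    qed
    then show "diameter (V (n, k)) \<le> \<delta>" using \<delta> by (auto simp: V_def)
    show "bounded (V (n, k))" by (auto simp: V_def)
  qed
  have cover: "E \<subseteq> (\<Union>i. U i)"
  proof
    fix x assume "x \<in> E"
    \<comment> \<open>A level that exceeds \<bar>x\<bar> by 1 ensures that the nearest numerator
      lies in the range of the cover.\<close>
    have "\<forall>\<^sub>\<infinity>n. n \<ge> N \<and> n \<ge> nat \<lceil>\<bar>x\<bar>\<rceil> + 1"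
      unfolding cofinite_eq_sequentially by (intro eventually_conj eventually_ge_at_top)
    then obtain n where n: "infdist (real b ^ n * x) \<int> \<le> real b powr (- (real n * (a - 1)))" "n \<ge> N" "n \<ge> nat \<lceil>\<bar>x\<bar>\<rceil> + 1"
      using frequently_ex[OF INFM_conjI[OF E[OF \<open>x \<in> E\<close>]]] by blast
    obtain j where j: "infdist (real b ^ n * x) \<int> = \<bar>real b ^ n * x - of_int j\<bar>"
      by (rule infdist_Ints_attained)
    have bn: "real b ^ n \<ge> 1" using b by simp
    have "\<bar>real_of_int j\<bar> \<le> \<bar>real b ^ n * x\<bar> + 1"
      using j infdist_Ints_le_1[of "real b ^ n * x"] by linarith
    also have "\<dots> \<le> real b ^ n * \<bar>x\<bar> + real b ^ n * 1" using bn by (simp add: abs_mult)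
    also have "\<dots> = real b ^ n * (\<bar>x\<bar> + 1)" by (simp add: distrib_left)
    also have "\<dots> \<le> real b ^ n * real n" using n(3) bn by (intro mult_left_mono) linarith+
    finally have "\<bar>real_of_int j\<bar> \<le> real_of_int (int (n * b ^ n))" by (simp add: mult.commute)
    then have jb: "\<bar>j\<bar> \<le> int (n * b ^ n)" by linarith
    define k where "k = nat (j + int (n * b ^ n))"
    have k: "k \<le> 2 * n * b ^ n" "real k = real_of_int j + real (n * b ^ n)"
      using jb unfolding k_def by linarith+
    have "dist ((real k - real (n * b ^ n)) / real b ^ n) x = \<bar>real b ^ n * x - of_int j\<bar> / real b ^ n"
    proof -
      have "(real k - real (n * b ^ n)) / real b ^ n - x = - ((real b ^ n * x - of_int j) / real b ^ n)"
        using b by (simp add: k field_simps)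
      then show ?thesis using b by (simp add: dist_real_def)
    qed
    also have "\<dots> \<le> real b powr (- (real n * (a - 1))) / real b ^ n"
      using n j b by (intro divide_right_mono) auto
    also have "\<dots> = real b powr (- (real n * a))"
      using b by (simp add: powr_realpow[symmetric] powr_diff[symmetric] algebra_simps)
    finally have dist: "dist ((real k - real (n * b ^ n)) / real b ^ n) x \<le> real b powr (- (real n * a))" .
    have nN: "n - N + N = n" using n by simp
    have "x \<in> V (n - N, k)" using k(1) dist unfolding V_def prod.case nN by simp
    then have "x \<in> U (prod_encode (n - N, k))" by (simp add: U_def)
    then show "x \<in> (\<Union>i. U i)" by blast
  qed
  have inner: "(\<Sum>k. diam_weight s (V (n, k))) = ennreal (g (n + N))" for n
  proof -
    have "(\<Sum>k. diam_weight s (V (n, k))) = (\<Sum>k\<in>{..2 * (n + N) * b ^ (n + N)}. diam_weight s (V (n, k)))"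
      by (rule suminf_finite) (auto simp: V_def diam_weight_def)
    also have "\<dots> = (\<Sum>k\<in>{..2 * (n + N) * b ^ (n + N)}. ennreal ((2 * real b powr (- (real (n + N) * a))) powr s))"
      using s0 b by (intro sum.cong) (auto simp: V_def diam_weight_def)
    also have "\<dots> = ennreal (\<Sum>k\<in>{..2 * (n + N) * b ^ (n + N)}. (2 * real b powr (- (real (n + N) * a))) powr s)"
      by (rule sum_ennreal) simp
    also have "(\<Sum>k\<in>{..2 * (n + N) * b ^ (n + N)}. (2 * real b powr (- (real (n + N) * a))) powr s) = g (n + N)"
      by (simp only: g_def sum_constant card_atMost of_nat_Suc of_nat_mult of_nat_power of_nat_numeral add.commute)
    finally show ?thesis .
  qed
  have "(\<Sum>i. diam_weight s (U i)) = (\<Sum>n. ennreal (g (n + N)))"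
    using suminf_ennreal_2dimen[of "\<lambda>n. ennreal (g (n + N))" "\<lambda>p. diam_weight s (V p)"] inner
    by (simp add: U_def)
  also have "\<dots> = ennreal (\<Sum>n. g (n + N))"
    using sg g0 by (intro suminf_ennreal2) (auto simp: summable_iff_shift)
  also have "\<dots> \<le> ennreal \<epsilon>" using N(1) by (intro ennreal_leI) auto
  finally have "(\<Sum>i. diam_weight s (U i)) \<le> ennreal \<epsilon>" .
  moreover have "\<forall>i. bounded (U i) \<and> diameter (U i) \<le> \<delta>"
  proof
    fix i
    obtain n k where "prod_decode i = (n, k)" by (rule prod.exhaust)
    then show "bounded (U i) \<and> diameter (U i) \<le> \<delta>" using diamV[of n k] by (simp add: U_def)
  qed
  ultimately show "\<exists>U. (\<forall>i. bounded (U i) \<and> diameter (U i) \<le> \<delta>) \<and> E \<subseteq> (\<Union>i. U i) \<and> (\<Sum>i. diam_weight s (U i)) \<le> ennreal \<epsilon>"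
    using cover by blast
qed

text \<open>
  A map from the unit interval into \<open>E\<close> whose inverse is \<open>s\<close>-Hoelder carries covers of \<open>E\<close> to covers of the
  interval, whose lengths add up to at least 1.
\<close>
lemma hausdorff_measure_neq_0I:
  fixes \<phi> :: "real \<Rightarrow> real"
  assumes s: "s > 0" and C: "C > 0"
    and hold: "\<And>t t'. t \<in> {0..<1} \<Longrightarrow> t' \<in> {0..<1} \<Longrightarrow> \<bar>t - t'\<bar> \<le> C * \<bar>\<phi> t - \<phi> t'\<bar> powr s"
    and sub: "\<phi> ` {0..<1} \<subseteq> E"
  shows "hausdorff_measure s E \<noteq> 0"
proof
  assume 0: "hausdorff_measure s E = 0"
  have "ennreal (1 / (2 * C)) \<le> hausdorff_premeasure s 1 E"
    unfolding hausdorff_premeasure_def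
  proof (rule Inf_greatest)
    fix S assume "S \<in> {(\<Sum>i. diam_weight s (U i)) | U :: nat \<Rightarrow> real set.
            (\<forall>i. bounded (U i) \<and> diameter (U i) \<le> 1) \<and> E \<subseteq> (\<Union>i. U i)}"
    then obtain U where U: "S = (\<Sum>i. diam_weight s (U i))" "\<And>i. bounded (U i)" "E \<subseteq> (\<Union>i. U i)"
      by blast
    define V where "V = (\<lambda>i. {t \<in> {0..<1}. \<phi> t \<in> U i})"
    define r where "r = (\<lambda>i. C * diameter (U i) powr s)"
    \<comment> \<open>The preimages \<open>V i\<close> need not be measurable, so each is replaced
      by an interval around one of its points; the doubled radius is the source of the factor 2 in
      \<open>1 / (2 * C)\<close>.\<close>
    define I where "I = (\<lambda>i. if V i = {} then {} else cball (SOME t. t \<in> V i) (r i))"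
    have VI: "V i \<subseteq> I i" for i
    proof
      fix t assume t: "t \<in> V i"
      define t0 where "t0 = (SOME t. t \<in> V i)"
      have t0: "t0 \<in> V i" unfolding t0_def using t by (rule someI)
      have "\<bar>t0 - t\<bar> \<le> C * \<bar>\<phi> t0 - \<phi> t\<bar> powr s" using t t0 by (intro hold) (auto simp: V_def)
      also have "\<dots> \<le> r i" unfolding r_def using t t0 C s diameter_bounded_bound[OF U(2)[of i], of "\<phi> t0" "\<phi> t"]
        by (intro mult_left_mono powr_mono2) (auto simp: V_def dist_real_def)
      finally show "t \<in> I i" using t by (auto simp: I_def t0_def dist_real_def)
    qed
    have "emeasure lborel {0..<1::real} \<le> emeasure lborel (\<Union>i. I i)"
    proof (rule emeasure_mono)
      show "{0..<1} \<subseteq> (\<Union>i. I i)"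
      proof
        fix t :: real assume t: "t \<in> {0..<1}"
        then have "\<phi> t \<in> (\<Union>i. U i)" using sub U(3) by blast
        with t VI show "t \<in> (\<Union>i. I i)" unfolding V_def by blast
      qed
    qed (auto simp: I_def)
    also have "\<dots> \<le> (\<Sum>i. emeasure lborel (I i))"
      by (rule emeasure_subadditive_countably) (auto simp: I_def)
    also have "\<dots> \<le> (\<Sum>i. ennreal (2 * C) * diam_weight s (U i))"
    proof (rule suminf_le)
      fix i
      show "emeasure lborel (I i) \<le> ennreal (2 * C) * diam_weight s (U i)"
      proof (cases "V i = {}")
        case False
        then have "U i \<noteq> {}" by (auto simp: V_def)
        have "r i \<ge> 0" using C by (simp add: r_def)
        then have "emeasure lborel (I i) = ennreal (2 * r i)"
          using False by (simp add: I_def cball_eq_atLeastAtMost)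
        then show ?thesis using \<open>U i \<noteq> {}\<close> s C by (simp add: diam_weight_def r_def ennreal_mult[symmetric] mult_ac)
      qed (simp add: I_def)
    qed auto
    also have "\<dots> = ennreal (2 * C) * S" by (simp add: U)
    finally have "1 \<le> ennreal (2 * C) * S" by simp
    then have "ennreal (1 / (2 * C)) * 1 \<le> ennreal (1 / (2 * C)) * (ennreal (2 * C) * S)"
      by (intro mult_left_mono) auto
    also have "\<dots> = S" using C by (simp add: mult.assoc[symmetric] ennreal_mult[symmetric])
    finally show "ennreal (1 / (2 * C)) \<le> S" by simp
  qed
  also have "hausdorff_premeasure s 1 E \<le> hausdorff_measure s E"
    unfolding hausdorff_measure_def by (rule SUP_upper) simp
  finally show False using 0 C by simp
qed

text \<open>For exponent 0 each nonempty set of a cover has weight 1. This removes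
  \<open>s = 0\<close> from the infimum that defines the dimension, a case that the Hoelder argument
  does not reach.\<close>

lemma hausdorff_measure_zero_exponent:
  assumes "E \<noteq> {}"
  shows "hausdorff_measure 0 E \<noteq> 0"
proof
  assume 0: "hausdorff_measure 0 E = 0"
  have "1 \<le> hausdorff_premeasure 0 1 E" unfolding hausdorff_premeasure_def
  proof (rule Inf_greatest)
    fix S assume "S \<in> {(\<Sum>i. diam_weight 0 (U i)) | U :: nat \<Rightarrow> 'a set.
            (\<forall>i. bounded (U i) \<and> diameter (U i) \<le> 1) \<and> E \<subseteq> (\<Union>i. U i)}"
    then obtain U where U: "S = (\<Sum>i. diam_weight 0 (U i))" "E \<subseteq> (\<Union>i. U i)" by blast
    then obtain i where "U i \<noteq> {}" using assms by blast
    then have "1 = sum (\<lambda>i. diam_weight 0 (U i)) {i}" by (simp add: diam_weight_def)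
    also have "\<dots> \<le> S" unfolding U by (rule sum_le_suminf) auto
    finally show "1 \<le> S" .
  qed
  also have "hausdorff_premeasure 0 1 E \<le> hausdorff_measure 0 E"
    unfolding hausdorff_measure_def by (rule SUP_upper) simp
  finally show False using 0 by simp
qed

section \<open>Digit expansions\<close>

definition digit_val :: "nat \<Rightarrow> (nat \<Rightarrow> nat) \<Rightarrow> real" where
  "digit_val b d = (\<Sum>i. real (d i) / real b ^ Suc i)"

lemma sums_max_digits:
  assumes "b \<ge> 2"
  shows "(\<lambda>i. real (b - 1) / real b ^ Suc i) sums 1"
proof -
  have "(\<lambda>i. 1 / real b ^ i) \<longlonglongrightarrow> 0"
    using assms by real_asymp
  from telescope_sums'[OF this] have "(\<lambda>i. 1 / real b ^ i - 1 / real b ^ Suc i) sums 1" by simp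
  moreover have "1 / real b ^ i - 1 / real b ^ Suc i = real (b - 1) / real b ^ Suc i" for i
    using assms by (simp add: field_simps of_nat_diff)
  ultimately show ?thesis by simp
qed

lemma summable_digits:
  assumes "b \<ge> 2" "\<And>i. d i < b"
  shows "summable (\<lambda>i. real (d i) / real b ^ Suc i)"
proof (rule summable_comparison_test')
  show "summable (\<lambda>i. real (b - 1) / real b ^ Suc i)"
    using sums_max_digits[OF assms(1)] by (rule sums_summable)
  show "norm (real (d i) / real b ^ Suc i) \<le> real (b - 1) / real b ^ Suc i" for i
    using assms(2)[of i] by (simp add: divide_right_mono)
qed

lemma digit_val_nonneg:
  assumes "b \<ge> 2" "\<And>i. d i < b"
  shows "0 \<le> digit_val b d"
  unfolding digit_val_def by (intro suminf_nonneg summable_digits assms) auto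

lemma digit_val_zero [simp]: "digit_val b (\<lambda>_. 0) = 0"
  by (simp add: digit_val_def)

text \<open>Turns lower bounds from a digit that is not 0 into upper bounds from a digit that is not
  b - 1.\<close>

lemma digit_val_complement:
  assumes "b \<ge> 2" "\<And>i. d i < b"
  shows "digit_val b (\<lambda>i. b - 1 - d i) = 1 - digit_val b d"
proof -
  have "(\<lambda>i. real (b - 1) / real b ^ Suc i - real (d i) / real b ^ Suc i) sums (1 - digit_val b d)"
    unfolding digit_val_def by (intro sums_diff sums_max_digits summable_sums summable_digits assms)
  moreover have "real (b - 1) / real b ^ Suc i - real (d i) / real b ^ Suc i = real (b - 1 - d i) / real b ^ Suc i" for i
    using assms(2)[of i] by (simp add: diff_divide_distrib[symmetric] of_nat_diff)
  ultimately show ?thesis by (simp add: digit_val_def sums_iff)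
qed

lemma digit_val_ge:
  assumes "b \<ge> 2" "\<And>i. d i < b" "d i \<noteq> 0"
  shows "1 / real b ^ Suc i \<le> digit_val b d"
proof -
  have "1 / real b ^ Suc i \<le> (\<Sum>j\<in>{i}. real (d j) / real b ^ Suc j)"
    using assms by (auto intro!: divide_right_mono)
  also have "\<dots> \<le> digit_val b d"
    unfolding digit_val_def by (rule sum_le_suminf[OF summable_digits[OF assms(1,2)]]) auto
  finally show ?thesis .
qed

lemma digit_val_le:
  assumes "b \<ge> 2" "\<And>i. d i < b" "Suc (d i) < b"
  shows "digit_val b d \<le> 1 - 1 / real b ^ Suc i"
  using digit_val_ge[OF assms(1), of "\<lambda>i. b - 1 - d i" i] digit_val_complement[OF assms(1,2)] assms
  by force

lemma digit_val_le_1: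
  assumes "b \<ge> 2" "\<And>i. d i < b"
  shows "digit_val b d \<le> 1"
proof -
  have "0 \<le> digit_val b (\<lambda>i. b - 1 - d i)" using assms by (intro digit_val_nonneg) auto
  then show ?thesis using digit_val_complement[of b d] assms by simp
qed

lemma digit_val_Suc:
  assumes "b \<ge> 2" "\<And>i. d i < b"
  shows "real b * digit_val b d = real (d 0) + digit_val b (\<lambda>i. d (Suc i))"
proof -
  have "digit_val b d = real (d 0) / real b + (\<Sum>i. real (d (Suc i)) / real b ^ Suc (Suc i))"
    using suminf_split_head[OF summable_digits[of b d]] assms by (simp add: digit_val_def)
  also have "(\<lambda>i. real (d (Suc i)) / real b ^ Suc (Suc i)) = (\<lambda>i. (real (d (Suc i)) / real b ^ Suc i) / real b)"
    by (simp add: fun_eq_iff)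
  also have "(\<Sum>i. (real (d (Suc i)) / real b ^ Suc i) / real b) = digit_val b (\<lambda>i. d (Suc i)) / real b"
    unfolding digit_val_def by (intro suminf_divide summable_digits assms)
  finally show ?thesis using assms by (simp add: field_simps)
qed

lemma digit_val_shift_agree:
  assumes b: "b \<ge> 2" and "\<And>i. d i < b" "\<And>i. d' i < b" "\<And>i. i < k \<Longrightarrow> d i = d' i"
  shows "real b ^ k * (digit_val b d - digit_val b d')
    = digit_val b (\<lambda>i. d (k + i)) - digit_val b (\<lambda>i. d' (k + i))"
  using assms(2-)
proof (induction k arbitrary: d d')
  case (Suc k)
  have "real b ^ Suc k * (digit_val b d - digit_val b d')
      = real b ^ k * (real b * digit_val b d - real b * digit_val b d')"
    by (simp add: algebra_simps)
  also have "\<dots> = real b ^ k * (digit_val b (\<lambda>i. d (Suc i)) - digit_val b (\<lambda>i. d' (Suc i)))"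
    using Suc.prems(3)[of 0] by (simp add: digit_val_Suc[OF b Suc.prems(1)] digit_val_Suc[OF b Suc.prems(2)])
  also have "\<dots> = digit_val b (\<lambda>i. d (Suc (k + i))) - digit_val b (\<lambda>i. d' (Suc (k + i)))"
    by (rule Suc.IH) (use Suc.prems in auto)
  finally show ?case by simp
qed simp

lemma digit_val_scale:
  assumes b: "b \<ge> 2" and "\<And>i. d i < b"
  shows "\<exists>k::int. real b ^ n * digit_val b d = digit_val b (\<lambda>i. d (n + i)) + of_int k"
  using assms(2)
proof (induction n arbitrary: d)
  case (Suc n)
  obtain k where k: "real b ^ n * digit_val b (\<lambda>i. d (Suc i)) = digit_val b (\<lambda>i. d (Suc (n + i))) + of_int k"
    using Suc.IH[of "\<lambda>i. d (Suc i)"] Suc.prems by auto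
  have "real b ^ Suc n * digit_val b d = real b ^ n * (real b * digit_val b d)" by simp
  also have "\<dots> = digit_val b (\<lambda>i. d (Suc n + i)) + of_int (int b ^ n * int (d 0) + k)"
    by (simp add: digit_val_Suc[OF b Suc.prems] distrib_left k)
  finally show ?case by blast
qed (auto intro: exI[of _ 0])

lemma digit_val_diff_scale:
  assumes b: "b \<ge> 2" and "\<And>i. d i < b" "\<And>i. d' i < b"
  obtains k :: int where "real b ^ n * (digit_val b d - digit_val b d')
    = digit_val b (\<lambda>i. d (n + i)) - digit_val b (\<lambda>i. d' (n + i)) + of_int k"
proof -
  obtain k k' where "real b ^ n * digit_val b d = digit_val b (\<lambda>i. d (n + i)) + of_int k"
    "real b ^ n * digit_val b d' = digit_val b (\<lambda>i. d' (n + i)) + of_int k'"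
    using digit_val_scale[OF b] assms by meson
  then show ?thesis by (intro that[of "k - k'"]) (simp add: algebra_simps)
qed

text \<open>After the common digits both tails lie between 0 and 1. A run of zeros of a single
  number is the case where \<open>d'\<close> vanishes.\<close>

lemma infdist_le_if_digits_agree:
  assumes b: "b \<ge> 2" and d: "\<And>i. d i < b" "\<And>i. d' i < b"
    and agree: "\<And>i. n \<le> i \<Longrightarrow> i < n + k \<Longrightarrow> d i = d' i"
  shows "infdist (real b ^ n * (digit_val b d - digit_val b d')) \<int> \<le> 1 / real b ^ k"
proof -
  define w where "w = digit_val b (\<lambda>i. d (n + i)) - digit_val b (\<lambda>i. d' (n + i))"
  obtain j :: int where j: "real b ^ n * (digit_val b d - digit_val b d') = w + of_int j"
    unfolding w_def by (rule digit_val_diff_scale[OF b d])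
  have "real b ^ k * w = digit_val b (\<lambda>i. d (n + (k + i))) - digit_val b (\<lambda>i. d' (n + (k + i)))"
    unfolding w_def by (rule digit_val_shift_agree[OF b]) (use d agree in auto)
  moreover have "digit_val b (\<lambda>i. d (n + (k + i))) \<le> 1" "digit_val b (\<lambda>i. d' (n + (k + i))) \<le> 1"
    by (intro digit_val_le_1 b d)+
  ultimately have "\<bar>real b ^ k * w\<bar> \<le> 1"
    using digit_val_nonneg[OF b, of "\<lambda>i. d (n + (k + i))"] digit_val_nonneg[OF b, of "\<lambda>i. d' (n + (k + i))"] d
    by auto
  then have "\<bar>w\<bar> \<le> 1 / real b ^ k" using b by (simp add: abs_mult field_simps)
  then show ?thesis using infdist_Ints_le[of "w + of_int j" j] by (simp add: j)
qed

lemma digit_val_le_if_zeros: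
  assumes b: "b \<ge> 2" and d: "\<And>i. d i < b" and z: "\<And>i. i < k \<Longrightarrow> d i = 0"
  shows "digit_val b d \<le> 1 / real b ^ k"
proof -
  have "real b ^ k * (digit_val b d - digit_val b (\<lambda>_. 0)) = digit_val b (\<lambda>i. d (k + i)) - digit_val b (\<lambda>_. 0)"
    by (rule digit_val_shift_agree[OF b]) (use b d z in auto)
  then have "real b ^ k * digit_val b d \<le> 1" using digit_val_le_1[OF b, of "\<lambda>i. d (k + i)"] d by simp
  then show ?thesis using b by (simp add: field_simps)
qed

lemma inverse_power_bounds:
  assumes "b \<ge> 2"
  obtains p q r :: real where "1 / real b = p" "1 / real b ^ 2 = q" "1 / real b ^ 3 = r"
    "p \<le> 1 / 2" "q \<le> p / 2" "r \<le> q / 2" "r > 0"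
  using assms by (intro that[OF refl refl refl]) (auto simp: field_simps power2_eq_square power3_eq_cube)

text \<open>The prefix 01 puts the tail \<open>v\<close> between b^-2 and b^-1, and 000 puts
  \<open>v'\<close> between 0 and b^-3. As b is at least 2, the difference stays at distance b^-3
  from both 0 and 1.\<close>

lemma infdist_ge_pattern01:
  assumes b: "b \<ge> 2" and d: "\<And>i. d i < b" "\<And>i. d' i < b"
    and n: "d n = 0" "d (Suc n) = 1" "d' n = 0" "d' (Suc n) = 0" "d' (Suc (Suc n)) = 0"
  shows "1 / real b ^ 3 \<le> infdist (real b ^ n * (digit_val b d - digit_val b d')) \<int>"
proof -
  define v where "v = digit_val b (\<lambda>i. d (n + i))"
  define v' where "v' = digit_val b (\<lambda>i. d' (n + i))"
  obtain j :: int where j: "real b ^ n * (digit_val b d - digit_val b d') = v - v' + of_int j"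
    unfolding v_def v'_def by (rule digit_val_diff_scale[OF b d])
  have "1 / real b ^ 2 \<le> v"
    using digit_val_ge[OF b, of "\<lambda>i. d (n + i)" 1] d n by (simp add: v_def numeral_2_eq_2)
  moreover have "v \<le> 1 / real b"
    using digit_val_le_if_zeros[OF b, of "\<lambda>i. d (n + i)" 1] d n by (simp add: v_def)
  moreover have "v' \<le> 1 / real b ^ 3"
  proof (unfold v'_def, rule digit_val_le_if_zeros[OF b])
    show "d' (n + i) = 0" if "i < 3" for i
    proof -
      have "i = 0 \<or> i = 1 \<or> i = 2" using that by linarith
      then show ?thesis using n by (auto simp: numeral_2_eq_2)
    qed
  qed (use d in auto)
  moreover have "0 \<le> v'" using b d by (simp add: v'_def digit_val_nonneg)
  moreover obtain p q r :: real where "1 / real b = p" "1 / real b ^ 2 = q" "1 / real b ^ 3 = r"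
    "p \<le> 1 / 2" "q \<le> p / 2" "r \<le> q / 2" "r > 0"
    using inverse_power_bounds[OF b] .
  ultimately have "0 \<le> 1 / real b ^ 3" "1 / real b ^ 3 \<le> v - v'" "v - v' \<le> 1 - 1 / real b ^ 3"
    by (simp_all only:)
  then show ?thesis unfolding j by (rule infdist_Ints_ge)
qed

text \<open>The 0 after the 1 keeps \<open>v\<close> below 1 - b^-2 even for b = 2, where 1 is the
  largest digit, and 00 keeps \<open>v'\<close> below b^-2.\<close>

lemma infdist_ge_pattern10:
  assumes b: "b \<ge> 2" and d: "\<And>i. d i < b" "\<And>i. d' i < b"
    and n: "d n = 1" "d (Suc n) = 0" "d' n = 0" "d' (Suc n) = 0"
  shows "1 / real b ^ 3 \<le> infdist (real b ^ n * (digit_val b d - digit_val b d')) \<int>"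
proof -
  define v where "v = digit_val b (\<lambda>i. d (n + i))"
  define v' where "v' = digit_val b (\<lambda>i. d' (n + i))"
  obtain j :: int where j: "real b ^ n * (digit_val b d - digit_val b d') = v - v' + of_int j"
    unfolding v_def v'_def by (rule digit_val_diff_scale[OF b d])
  have "1 / real b \<le> v"
    using digit_val_ge[OF b, of "\<lambda>i. d (n + i)" 0] d n by (simp add: v_def)
  moreover have "v \<le> 1 - 1 / real b ^ 2"
    using digit_val_le[OF b, of "\<lambda>i. d (n + i)" 1] d n b by (simp add: v_def numeral_2_eq_2)
  moreover have "v' \<le> 1 / real b ^ 2"
  proof (unfold v'_def, rule digit_val_le_if_zeros[OF b])
    show "d' (n + i) = 0" if "i < 2" for i
      using that n by (auto simp: less_2_cases_iff)
  qed (use d in auto)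
  moreover have "0 \<le> v'" using b d by (simp add: v'_def digit_val_nonneg)
  moreover obtain p q r :: real where "1 / real b = p" "1 / real b ^ 2 = q" "1 / real b ^ 3 = r"
    "p \<le> 1 / 2" "q \<le> p / 2" "r \<le> q / 2" "r > 0"
    using inverse_power_bounds[OF b] .
  ultimately have "0 \<le> 1 / real b ^ 3" "1 / real b ^ 3 \<le> v - v'" "v - v' \<le> 1 - 1 / real b ^ 3"
    by (simp_all only:)
  then show ?thesis unfolding j by (rule infdist_Ints_ge)
qed

section \<open>Numbers with geometrically spaced digits 1\<close>

text \<open>A gap of at least 2 puts a 0 behind every 1, so that each 1 starts the pattern
  10.\<close>

locale spaced_ones =
  fixes p :: "nat \<Rightarrow> nat" and \<eta> :: real
  assumes gap: "p k + 2 \<le> p (Suc k)" and p0: "1 \<le> p 0"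
    and eta: "1 < \<eta>"
    and ratio: "(\<lambda>k. real (p (Suc k)) / real (p k)) \<longlonglongrightarrow> \<eta>"
begin

text \<open>The digit of index i has weight b^-(i + 1), hence the shift: multiplication by
  \<open>b ^ p k\<close> brings the digit 1 number k to the units place.\<close>

definition ones :: "nat \<Rightarrow> nat" where
  "ones i = (if Suc i \<in> range p then 1 else 0)"

lemma strict_mono_p: "strict_mono p"
  unfolding strict_mono_Suc_iff
proof
  show "p k < p (Suc k)" for k using gap[of k] by linarith
qed

lemma p_less_iff [simp]: "p i < p j \<longleftrightarrow> i < j" and p_le_iff [simp]: "p i \<le> p j \<longleftrightarrow> i \<le> j"
  using strict_mono_p by (simp_all add: strict_mono_less strict_mono_less_eq)

lemma le_p: "k \<le> p k"
  using strict_mono_p by (rule strict_mono_imp_increasing)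

lemma p_pos: "0 < p k"
  using p0 p_le_iff[of 0 k] by linarith

lemma ones_less: "b \<ge> 2 \<Longrightarrow> ones i < b"
  by (simp add: ones_def)

lemma ones_0_or_1: "ones i = 0 \<or> ones i = 1"
  by (simp add: ones_def)

lemma ones_eq_1D:
  assumes "ones i = 1"
  obtains k where "Suc i = p k"
proof -
  have "Suc i \<in> range p" using assms unfolding ones_def by (meson zero_neq_one)
  then show ?thesis using that by blast
qed

lemma ones_eq_0:
  assumes "p k \<le> i" "Suc i < p (Suc k)"
  shows "ones i = 0"
proof -
  have False if "Suc i = p j" for j
  proof (cases "j \<le> k")
    case True
    then have "p j \<le> p k" by simp
    with that assms show False by linarith
  next
    case False
    then have "p (Suc k) \<le> p j" by simp
    with that assms show False by linarith
  qed
  then show ?thesis by (auto simp: ones_def)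
qed

lemma ones_p: "ones (p k - 1) = 1"
  using p_pos[of k] by (auto simp: ones_def)

lemma ones_p_Suc: "ones (p k) = 0"
  by (rule ones_eq_0[of k]) (use gap[of k] in auto)

section \<open>Growth of the positions of the digits 1, and the exponent of y\<close>

lemma locate:
  assumes "p K \<le> n"
  obtains k where "K \<le> k" "p k \<le> n" "n < p (Suc k)"
proof -
  define k where "k = (GREATEST k. p k \<le> n)"
  have bd: "\<forall>j. p j \<le> n \<longrightarrow> j \<le> n" using le_p order_trans by blast
  have "p k \<le> n" unfolding k_def by (rule GreatestI_nat[where P = "\<lambda>k. p k \<le> n", OF assms]) (use bd in blast)
  moreover have "K \<le> k" unfolding k_def by (rule Greatest_le_nat[where P = "\<lambda>k. p k \<le> n", OF assms]) (use bd in blast)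
  moreover have "n < p (Suc k)"
  proof (rule ccontr)
    assume "\<not> n < p (Suc k)"
    then have "Suc k \<le> k" unfolding k_def by (intro Greatest_le_nat[where P = "\<lambda>k. p k \<le> n" and b = n]) (use bd in auto)
    then show False by simp
  qed
  ultimately show ?thesis by (intro that)
qed

lemma filterlim_p: "filterlim (\<lambda>k. real (p k)) at_top sequentially"
  by (intro filterlim_compose[OF filterlim_real_sequentially] filterlim_subseq strict_mono_p)

lemma eventually_p_Suc_le:
  assumes "\<eta> < a"
  shows "\<forall>\<^sub>F k in sequentially. real (p (Suc k)) \<le> a * real (p k)"
  using order_tendstoD(2)[OF ratio assms]
proof eventually_elim
  case (elim k)
  then show ?case using p_pos[of k] by (simp add: field_simps)
qed

lemma eventually_le_p_Suc:
  assumes "a < \<eta>"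
  shows "\<forall>\<^sub>F k in sequentially. a * real (p k) + C \<le> real (p (Suc k))"
proof -
  define a' where "a' = (a + \<eta>) / 2"
  have a': "a < a'" "a' < \<eta>" using assms by (auto simp: a'_def)
  have "\<forall>\<^sub>F k in sequentially. C / (a' - a) \<le> real (p k)"
    using filterlim_p by (simp add: filterlim_at_top)
  with order_tendstoD(1)[OF ratio a'(2)] show ?thesis
  proof eventually_elim
    case (elim k)
    then have "a' * real (p k) \<le> real (p (Suc k))" "C \<le> (a' - a) * real (p k)"
      using p_pos[of k] a' by (auto simp: field_simps)
    then show ?case by (simp add: algebra_simps)
  qed
qed

lemma eventually_next_p:
  assumes "\<eta> < a"
  shows "\<forall>\<^sub>F n in sequentially. \<exists>j. n < p j \<and> real (p j) \<le> a * real n"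
proof -
  obtain K where K: "\<And>k. k \<ge> K \<Longrightarrow> real (p (Suc k)) \<le> a * real (p k)"
    using eventually_p_Suc_le[OF assms] by (auto simp: eventually_sequentially)
  have "\<exists>j. n < p j \<and> real (p j) \<le> a * real n" if n: "p K \<le> n" for n
  proof -
    obtain k where k: "K \<le> k" "p k \<le> n" "n < p (Suc k)" using locate[OF n] .
    have "real (p (Suc k)) \<le> a * real (p k)" using K k by blast
    also have "\<dots> \<le> a * real n" using k eta assms by (intro mult_left_mono) auto
    finally show ?thesis using k by blast
  qed
  then show ?thesis by (auto simp: eventually_sequentially)
qed

text \<open>Since \<eta> > 1, the differences of consecutive positions are unbounded and eventually
  exceed any given \<open>g\<close>.\<close>

lemma ones_isolated:
  obtains N where "\<And>i j. N \<le> i \<Longrightarrow> i < j \<Longrightarrow> ones i = 1 \<Longrightarrow> ones j = 1 \<Longrightarrow> i + g \<le> j"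
proof -
  have "\<forall>\<^sub>F k in sequentially. 1 * real (p k) + real g \<le> real (p (Suc k))"
    using eta by (intro eventually_le_p_Suc)
  then obtain K where K: "\<And>k. k \<ge> K \<Longrightarrow> p k + g \<le> p (Suc k)"
    by (auto simp: eventually_sequentially of_nat_add[symmetric] simp del: of_nat_add)
  have "i + g \<le> j" if "p K \<le> i" "i < j" "ones i = 1" "ones j = 1" for i j
  proof -
    obtain k l where kl: "Suc i = p k" "Suc j = p l"
      using ones_eq_1D[OF \<open>ones i = 1\<close>] ones_eq_1D[OF \<open>ones j = 1\<close>] by metis
    have "p K < p k" using kl that by linarith
    then have "K \<le> k" by simp
    have "p k < p l" using kl that by linarith
    then have "p (Suc k) \<le> p l" by (simp add: Suc_leI)
    then show ?thesis using K[OF \<open>K \<le> k\<close>] kl by linarith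
  qed
  then show ?thesis by (rule that)
qed

text \<open>The index \<open>p (Suc k) - 1\<close> already carries the 1, so one zero is missing
  from the run; this accounts for the factor b.\<close>

lemma infdist_ones_le:
  assumes "b \<ge> 2" "p k \<le> n" "n < p (Suc k)"
  shows "infdist (real b ^ n * digit_val b ones) \<int> \<le> real b * real b powr (real n - real (p (Suc k)))"
proof -
  have "infdist (real b ^ n * (digit_val b ones - digit_val b (\<lambda>_. 0))) \<int> \<le> 1 / real b ^ (p (Suc k) - 1 - n)"
  proof (rule infdist_le_if_digits_agree)
    show "ones i = 0" if "n \<le> i" "i < n + (p (Suc k) - 1 - n)" for i
      using that assms by (intro ones_eq_0[of k]) auto
  qed (use assms ones_less in auto)
  also have "\<dots> = real b powr (- real (p (Suc k) - 1 - n))"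
    using assms(1) by (rule powr_minus_nat)
  also have "- real (p (Suc k) - 1 - n) = 1 + (real n - real (p (Suc k)))"
    using assms by (simp add: of_nat_diff)
  also have "real b powr (1 + (real n - real (p (Suc k)))) = real b * real b powr (real n - real (p (Suc k)))"
    using assms by (simp add: powr_add)
  finally show ?thesis by simp
qed

text \<open>From above, every n is followed by a pattern 10 at a distance ratio close to \<eta>;
  from below, the zeros after position \<open>p k\<close> last until
  \<open>p (Suc k)\<close>.\<close>

lemma approx_exponent_ones:
  assumes b: "b \<ge> 2"
  shows "approx_exponent b (digit_val b ones) = ereal \<eta>"
proof (rule antisym)
  show "approx_exponent b (digit_val b ones) \<le> ereal \<eta>"
  proof (rule ereal_le_if_real_less)
    fix a assume "ereal \<eta> < ereal a"
    then have a: "\<eta> < a" by simp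
    show "approx_exponent b (digit_val b ones) \<le> ereal a"
    proof (rule approx_exponent_leI[OF b, of "1 / real b ^ 3" a 0])
      show "\<forall>\<^sub>\<infinity>n. \<exists>n'\<ge>n. real n' \<le> a * real n + 0 \<and> 1 / real b ^ 3 \<le> infdist (real b ^ n' * digit_val b ones) \<int>"
        unfolding cofinite_eq_sequentially using eventually_next_p[OF a]
      proof eventually_elim
        case (elim n)
        then obtain j where j: "n < p j" "real (p j) \<le> a * real n" by blast
        have "1 / real b ^ 3 \<le> infdist (real b ^ (p j - 1) * (digit_val b ones - digit_val b (\<lambda>_. 0))) \<int>"
          using b ones_p[of j] ones_p_Suc[of j] p_pos[of j] ones_less[OF b]
          by (intro infdist_ge_pattern10) auto
        then show ?case using j by (intro exI[of _ "p j - 1"]) auto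
      qed
    qed (use b in auto)
  qed
next
  show "ereal \<eta> \<le> approx_exponent b (digit_val b ones)"
  proof (rule ereal_le_if_real_below)
    fix a assume "ereal a < ereal \<eta>"
    then have "a < \<eta>" by simp
    have "\<forall>\<^sub>F k in sequentially. infdist (real b ^ p k * digit_val b ones) \<int> \<le> real b * real b powr (- (real (p k) * (a - 1)))"
      using eventually_le_p_Suc[OF \<open>a < \<eta>\<close>, of 0]
    proof eventually_elim
      case (elim k)
      have "infdist (real b ^ p k * digit_val b ones) \<int> \<le> real b * real b powr (real (p k) - real (p (Suc k)))"
        using infdist_ones_le[OF b, of k "p k"] gap[of k] by simp
      also have "\<dots> \<le> real b * real b powr (- (real (p k) * (a - 1)))"
        using b elim by (intro mult_left_mono powr_mono) (auto simp: algebra_simps)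
      finally show ?case .
    qed
    then obtain K where K: "\<And>k. k \<ge> K \<Longrightarrow> infdist (real b ^ p k * digit_val b ones) \<int> \<le> real b * real b powr (- (real (p k) * (a - 1)))"
      by (auto simp: eventually_sequentially)
    have "\<exists>\<^sub>\<infinity>n. infdist (real b ^ n * digit_val b ones) \<int> \<le> real b * real b powr (- (real n * (a - 1)))"
      unfolding INFM_nat_le
    proof
      fix m
      show "\<exists>n\<ge>m. infdist (real b ^ n * digit_val b ones) \<int> \<le> real b * real b powr (- (real n * (a - 1)))"
        using K[of "max m K"] le_p[of "max m K"] by (intro exI[of _ "p (max m K)"]) auto
    qed
    then show "ereal a \<le> approx_exponent b (digit_val b ones)" by (rule approx_exponent_geI[OF b])
  qed
qed

text \<open>
  If \<open>x\<close> is close to a \<open>b\<close>-adic rational of level \<open>n\<close> and \<open>p\<close> is the next digit 1 of \<open>y\<close>, then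
  \<open>x - y\<close> is close to a \<open>b\<close>-adic rational of level \<open>n\<close> or \<open>p\<close>, according to whether \<open>p\<close> exceeds \<open>n \<gamma>\<close> or not.
\<close>
lemma approx_exponent_diff_ones_ge:
  assumes b: "b \<ge> 2" and \<gamma>: "1 \<le> \<gamma>" "\<gamma> < \<eta>" and x: "ereal (\<gamma>\<^sup>2) < approx_exponent b x"
  shows "ereal \<gamma> \<le> approx_exponent b (x - digit_val b ones)"
proof -
  let ?y = "digit_val b ones"
  obtain K where K: "\<And>k. k \<ge> K \<Longrightarrow> \<gamma> * real (p k) \<le> real (p (Suc k))"
    using eventually_le_p_Suc[OF \<gamma>(2), of 0] by (auto simp: eventually_sequentially)
  have ev: "\<forall>\<^sub>\<infinity>n. p K \<le> n \<and> m \<le> n" for m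
    unfolding cofinite_eq_sequentially by (intro eventually_conj eventually_ge_at_top)
  have "\<exists>\<^sub>\<infinity>n. infdist (real b ^ n * (x - ?y)) \<int> \<le> (1 + real b) * real b powr (- (real n * (\<gamma> - 1)))"
    unfolding INFM_nat_le
  proof
    fix m
    obtain n where n: "infdist (real b ^ n * x) \<int> \<le> real b powr (- (real n * (\<gamma>\<^sup>2 - 1)))" "p K \<le> n" "m \<le> n"
      using frequently_ex[OF INFM_conjI[OF approx_exponent_INFM[OF x] ev]] by blast
    obtain k where k: "K \<le> k" "p k \<le> n" "n < p (Suc k)" using locate[OF n(2)] .
    have \<gamma>2: "\<gamma> \<le> \<gamma>\<^sup>2" using \<gamma> by (simp add: power2_eq_square)
    have diff: "infdist (real b ^ j * (x - ?y)) \<int> \<le> infdist (real b ^ j * x) \<int> + infdist (real b ^ j * ?y) \<int>" for j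
      using infdist_Ints_diff[of "real b ^ j * x" "real b ^ j * ?y"] by (simp add: right_diff_distrib)
    have comb: "infdist (real b ^ j * (x - ?y)) \<int> \<le> (1 + real b) * real b powr (- (real j * (\<gamma> - 1)))"
      if "infdist (real b ^ j * x) \<int> \<le> real b powr u" "infdist (real b ^ j * ?y) \<int> \<le> real b * real b powr v"
        "u \<le> - (real j * (\<gamma> - 1))" "v \<le> - (real j * (\<gamma> - 1))" for j u v
    proof -
      have "real b powr u \<le> real b powr (- (real j * (\<gamma> - 1)))" "real b powr v \<le> real b powr (- (real j * (\<gamma> - 1)))"
        using that b by (auto intro!: powr_mono)
      then have "real b powr u + real b * real b powr v \<le> (1 + real b) * real b powr (- (real j * (\<gamma> - 1)))"
        by (simp add: distrib_right add_mono mult_left_mono)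
      with diff[of j] that show ?thesis by linarith
    qed
    show "\<exists>n\<ge>m. infdist (real b ^ n * (x - ?y)) \<int> \<le> (1 + real b) * real b powr (- (real n * (\<gamma> - 1)))"
    proof (cases "\<gamma> * real n \<le> real (p (Suc k))")
      case True
      have "infdist (real b ^ n * (x - ?y)) \<int> \<le> (1 + real b) * real b powr (- (real n * (\<gamma> - 1)))"
      proof (rule comb[OF n(1) infdist_ones_le[OF b k(2,3)]])
        show "- (real n * (\<gamma>\<^sup>2 - 1)) \<le> - (real n * (\<gamma> - 1))" using \<gamma>2 by (simp add: mult_left_mono)
        show "real n - real (p (Suc k)) \<le> - (real n * (\<gamma> - 1))" using True by (simp add: algebra_simps)
      qed
      then show ?thesis using n by blast
    next
      case False
      define q where "q = p (Suc k)"
      have q: "n < q" "real q < \<gamma> * real n" using k False by (auto simp: q_def)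
      have "infdist (real b ^ q * x) \<int> \<le> real b ^ (q - n) * real b powr (- (real n * (\<gamma>\<^sup>2 - 1)))"
        using infdist_Ints_power_mult[of b n "q - n" x] q n(1) b
        by (simp add: order_trans[OF _ mult_left_mono])
      also have "\<dots> = real b powr (real q - real n * \<gamma>\<^sup>2)"
        using b q by (simp add: powr_realpow[symmetric] powr_add[symmetric] of_nat_diff algebra_simps)
      finally have 1: "infdist (real b ^ q * x) \<int> \<le> real b powr (real q - real n * \<gamma>\<^sup>2)" .
      have "infdist (real b ^ q * (x - ?y)) \<int> \<le> (1 + real b) * real b powr (- (real q * (\<gamma> - 1)))"
      proof (rule comb[OF 1 infdist_ones_le[OF b, of "Suc k"]])
        show "p (Suc k) \<le> q" "q < p (Suc (Suc k))" using gap[of "Suc k"] by (auto simp: q_def)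
        \<comment> \<open>At level \<open>q\<close> the approximation of \<open>x\<close> is still
          good enough because \<open>q < \<gamma> * n\<close>; this is where the square of \<gamma>
          is needed.\<close>
        have "\<gamma> * real q \<le> \<gamma> * (\<gamma> * real n)" using q \<gamma> by (intro mult_left_mono) auto
        then show "real q - real n * \<gamma>\<^sup>2 \<le> - (real q * (\<gamma> - 1))"
          by (simp add: power2_eq_square algebra_simps)
        show "real q - real (p (Suc (Suc k))) \<le> - (real q * (\<gamma> - 1))"
          using K[of "Suc k"] k by (simp add: q_def algebra_simps)
      qed
      then show ?thesis using n q by (intro exI[of _ q]) auto
    qed
  qed
  then show ?thesis by (rule approx_exponent_geI[OF b])
qed

text \<open>If the bound failed, the previous lemma would apply to some \<gamma> slightly above
  \<delta>, for which \<open>\<delta> < \<eta>\<close> leaves room, and give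
  \<open>\<gamma> \<le> \<delta>\<close>.\<close>

lemma approx_exponent_diff_ones_restriction:
  assumes b: "b \<ge> 2" and \<Delta>: "approx_exponent b (x - digit_val b ones) = ereal \<delta>" and \<delta>: "\<delta> < \<eta>"
  shows "approx_exponent b x \<le> ereal (\<delta>\<^sup>2)"
proof (rule ccontr)
  assume "\<not> ?thesis"
  then have lt: "ereal (\<delta>\<^sup>2) < approx_exponent b x" by simp
  have 1: "1 \<le> \<delta>" using approx_exponent_ge_1[of b "x - digit_val b ones"] \<Delta> by (simp add: one_ereal_def)
  obtain c where c: "\<delta>\<^sup>2 < c" "ereal c < approx_exponent b x"
    using ereal_dense2[OF lt] by auto
  have "\<delta> < sqrt c" using 1 c by (simp add: real_less_rsqrt)
  then obtain \<gamma> where \<gamma>: "\<delta> < \<gamma>" "\<gamma> < min (sqrt c) \<eta>" using dense[of \<delta> "min (sqrt c) \<eta>"] \<delta> by auto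
  have "\<gamma>\<^sup>2 \<le> (sqrt c)\<^sup>2" using \<gamma> 1 by (intro power_mono) auto
  moreover have "0 \<le> c" using c by (meson less_eq_real_def order_trans zero_le_power2)
  ultimately have "\<gamma>\<^sup>2 \<le> c" by simp
  then have "ereal (\<gamma>\<^sup>2) < approx_exponent b x" using c(2) by (metis ereal_less_eq(3) order.strict_trans1)
  then have "ereal \<gamma> \<le> ereal \<delta>"
    unfolding \<Delta>[symmetric] using \<gamma> 1 by (intro approx_exponent_diff_ones_ge[OF b]) auto
  then show False using \<gamma> by simp
qed

end

section \<open>Cantor sets with sparse windows\<close>

definition real_digit :: "nat \<Rightarrow> real \<Rightarrow> nat \<Rightarrow> nat" where
  "real_digit b t j = nat (\<lfloor>real b ^ Suc j * t\<rfloor> mod int b)"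

lemma real_digit_less: "b \<ge> 2 \<Longrightarrow> real_digit b t j < b"
  by (simp add: real_digit_def nat_less_iff)

lemma floor_power_Suc:
  assumes "b \<ge> 2"
  shows "\<lfloor>real b ^ Suc j * t\<rfloor> = int b * \<lfloor>real b ^ j * t\<rfloor> + int (real_digit b t j)"
proof -
  have "\<lfloor>real b ^ Suc j * t / real_of_int (int b)\<rfloor> = \<lfloor>real b ^ Suc j * t\<rfloor> div int b"
    by (rule floor_divide_real_eq_div) simp
  moreover have "real b ^ Suc j * t / real_of_int (int b) = real b ^ j * t" using assms by simp
  ultimately have "\<lfloor>real b ^ Suc j * t\<rfloor> div int b = \<lfloor>real b ^ j * t\<rfloor>" by simp
  moreover have "int (real_digit b t j) = \<lfloor>real b ^ Suc j * t\<rfloor> mod int b"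
    using assms by (simp add: real_digit_def)
  ultimately show ?thesis by (metis mult_div_mod_eq)
qed

lemma real_digits_agree:
  assumes b: "b \<ge> 2" and t: "t \<in> {0..<1}" "t' \<in> {0..<1}"
    and agree: "\<And>j. j < n \<Longrightarrow> real_digit b t j = real_digit b t' j"
  shows "\<bar>t - t'\<bar> \<le> 1 / real b ^ n"
proof -
  have "\<lfloor>real b ^ n * t\<rfloor> = \<lfloor>real b ^ n * t'\<rfloor>"
    using agree
  proof (induction n)
    case 0
    have "\<lfloor>t\<rfloor> = 0" "\<lfloor>t'\<rfloor> = 0" using t by (auto simp: floor_eq_iff)
    then show ?case by simp
  qed (simp add: floor_power_Suc[OF b] del: power_Suc)
  then have "\<bar>real b ^ n * t - real b ^ n * t'\<bar> \<le> 1" by linarith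
  then have "real b ^ n * \<bar>t - t'\<bar> \<le> 1" by (simp add: abs_mult right_diff_distrib[symmetric])
  then show ?thesis using b by (simp add: field_simps)
qed

lemma approx_exponent_geI_subseq:
  assumes b: "b \<ge> 2" and f: "\<And>k. k \<le> f k"
    and inf: "\<exists>\<^sub>\<infinity>k. infdist (real b ^ f k * x) \<int> \<le> real b powr (- (real (f k) * (a - 1)))"
  shows "ereal a \<le> approx_exponent b x"
proof (rule approx_exponent_geI[OF b, where C = 1])
  show "\<exists>\<^sub>\<infinity>n. infdist (real b ^ n * x) \<int> \<le> 1 * real b powr (- (real n * (a - 1)))"
    unfolding INFM_nat_le
  proof
    fix m
    obtain k where "k \<ge> m" "infdist (real b ^ f k * x) \<int> \<le> real b powr (- (real (f k) * (a - 1)))"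
      using inf unfolding INFM_nat_le by blast
    then show "\<exists>n\<ge>m. infdist (real b ^ n * x) \<int> \<le> 1 * real b powr (- (real n * (a - 1)))"
      using f[of k] by (intro exI[of _ "f k"]) auto
  qed
qed

text \<open>
  The Cantor set consists of the numbers \<open>digit_val b (digits t)\<close> with \<open>t\<close> in the unit interval.
  The window \<open>k\<close> consists of the positions from \<open>A k\<close> to \<open>B k - 1\<close>; in it the digits are copied from
  \<open>ones\<close> if \<open>c k\<close> and vanish otherwise.  Outside the windows the positions congruent to 0 and 1
  modulo \<open>m\<close> carry these digits, and the others are filled with the digits of \<open>t\<close>.
\<close>
locale windows = spaced_ones p \<eta> for p \<eta> +
  fixes b m :: nat and A B :: "nat \<Rightarrow> nat" and c :: "nat \<Rightarrow> bool"
  assumes b: "2 \<le> b" and m: "3 \<le> m"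
    and A_le_B: "A k \<le> B k" and sparse: "Suc k * Suc (B k) \<le> A (Suc k)"
begin

definition W :: "nat set" where
  "W = (\<Union>k. {A k..<B k})"

definition free :: "nat \<Rightarrow> bool" where
  "free i \<longleftrightarrow> i \<notin> W \<and> 2 \<le> i mod m"

definition template :: "nat \<Rightarrow> nat" where
  "template i = (if i \<in> W then if \<exists>k. i \<in> {A k..<B k} \<and> c k then ones i else 0
    else if i mod m = 1 then 1 else 0)"

definition free_before :: "nat \<Rightarrow> nat" where
  "free_before i = card {j. j < i \<and> free j}"

definition digits :: "real \<Rightarrow> nat \<Rightarrow> nat" where
  "digits t i = (if free i then real_digit b t (free_before i) else template i)"

section \<open>Order of the windows and digits inside them\<close>

lemma B_less_A_Suc: "B k < A (Suc k)"
proof -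
  have "Suc (B k) \<le> Suc k * Suc (B k)" by simp
  also note sparse[of k]
  finally show ?thesis by simp
qed

lemma strict_mono_A: "strict_mono A"
  unfolding strict_mono_Suc_iff using A_le_B B_less_A_Suc le_less_trans by blast

lemma strict_mono_B: "strict_mono B"
  unfolding strict_mono_Suc_iff using A_le_B B_less_A_Suc less_le_trans by blast

lemma le_A: "k \<le> A k"
  using strict_mono_A by (rule strict_mono_imp_increasing)

lemma le_B: "k \<le> B k"
  using le_A A_le_B order_trans by blast

lemma B_less_A:
  assumes "k < l"
  shows "B k < A l"
proof -
  have "A (Suc k) \<le> A l" using assms strict_mono_A by (simp add: strict_mono_less_eq Suc_leI)
  with B_less_A_Suc[of k] show ?thesis by linarith
qed

lemma window_unique: "i \<in> {A k..<B k} \<Longrightarrow> i \<in> {A l..<B l} \<Longrightarrow> k = l"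
  using B_less_A[of k l] B_less_A[of l k] by (cases k l rule: linorder_cases) auto

text \<open>Supplies arbitrarily large positions outside the windows, where
  \<open>free_before\<close> can be bounded below.\<close>

lemma B_notin_W: "B k \<notin> W"
proof
  assume "B k \<in> W"
  then obtain l where l: "A l \<le> B k" "B k < B l" by (auto simp: W_def)
  then have "k < l" using strict_mono_B by (simp add: strict_mono_less)
  then show False using B_less_A[of k l] l by simp
qed

lemma digits_less: "digits t i < b"
  unfolding digits_def template_def using real_digit_less[OF b] ones_less[OF b] b by simp

lemma digits_zero_window:
  assumes "A k \<le> i" "i < B k" "\<not> c k"
  shows "digits t i = 0"
proof -
  have k: "i \<in> {A k..<B k}" using assms by simp
  then have "i \<in> W" unfolding W_def by blast
  moreover have "\<not> (\<exists>l. i \<in> {A l..<B l} \<and> c l)" using window_unique[OF k] assms(3) by blast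
  ultimately show ?thesis
    by (simp only: digits_def template_def free_def if_True if_False simp_thms)
qed

lemma digits_copy_window:
  assumes "A k \<le> i" "i < B k" "c k"
  shows "digits t i = ones i"
proof -
  have k: "i \<in> {A k..<B k}" using assms by simp
  then have "i \<in> W" unfolding W_def by blast
  moreover have "\<exists>l. i \<in> {A l..<B l} \<and> c l" using k assms(3) by blast
  ultimately show ?thesis unfolding digits_def template_def free_def by simp
qed

lemma digits_mult: "i \<notin> W \<Longrightarrow> m dvd i \<Longrightarrow> digits t i = 0"
  by (auto simp: digits_def template_def free_def)

lemma digits_mult_ones: "m dvd i \<Longrightarrow> ones i = 0 \<Longrightarrow> digits t i = 0"
  by (auto simp: digits_def template_def free_def)

lemma digits_mult_Suc:
  assumes "Suc i \<notin> W" "m dvd i"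
  shows "digits t (Suc i) = 1"
proof -
  have "Suc i mod m = 1" using assms m by (auto simp: mod_Suc)
  then show ?thesis using assms by (auto simp: digits_def template_def free_def)
qed

text \<open>Here x reads 01 and y reads 000 for every parameter t, so the pattern 01 applies both to
  x and to x - y.\<close>

definition good :: "nat \<Rightarrow> bool" where
  "good n \<longleftrightarrow> m dvd n \<and> n \<notin> W \<and> Suc n \<notin> W \<and> ones n = 0 \<and> ones (Suc n) = 0 \<and> ones (Suc (Suc n)) = 0"

lemma good_infdist:
  assumes "good n"
  shows "1 / real b ^ 3 \<le> infdist (real b ^ n * digit_val b (digits t)) \<int>"
    and "1 / real b ^ 3 \<le> infdist (real b ^ n * (digit_val b (digits t) - digit_val b ones)) \<int>"
proof -
  have "1 / real b ^ 3 \<le> infdist (real b ^ n * (digit_val b (digits t) - digit_val b (\<lambda>_. 0))) \<int>"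
    using assms b by (intro infdist_ge_pattern01 digits_less) (auto simp: good_def digits_mult digits_mult_Suc)
  then show "1 / real b ^ 3 \<le> infdist (real b ^ n * digit_val b (digits t)) \<int>" by simp
  show "1 / real b ^ 3 \<le> infdist (real b ^ n * (digit_val b (digits t) - digit_val b ones)) \<int>"
    using assms b by (intro infdist_ge_pattern01 digits_less ones_less) (auto simp: good_def digits_mult digits_mult_Suc)
qed

text \<open>The strict inequalities keep both digits of the pattern 10, at the indices
  \<open>p j - 1\<close> and \<open>p j\<close>, inside the window.\<close>

lemma copy_window_infdist:
  assumes "c k" "A k < p j" "p j < B k"
  shows "1 / real b ^ 3 \<le> infdist (real b ^ (p j - 1) * digit_val b (digits t)) \<int>"
proof -
  have "digits t (p j - 1) = ones (p j - 1)" "digits t (p j) = ones (p j)"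
    using assms by (intro digits_copy_window[of k]; simp)+
  then have "1 / real b ^ 3 \<le> infdist (real b ^ (p j - 1) * (digit_val b (digits t) - digit_val b (\<lambda>_. 0))) \<int>"
    using b p_pos[of j] ones_p[of j] ones_p_Suc[of j] by (intro infdist_ge_pattern10 digits_less) auto
  then show ?thesis by simp
qed

text \<open>In a zero window the 1 comes from y, so the pattern 10 is read in y - x and the sign is
  changed afterwards.\<close>

lemma zero_window_infdist:
  assumes "\<not> c k" "A k < p j" "p j < B k"
  shows "1 / real b ^ 3 \<le> infdist (real b ^ (p j - 1) * (digit_val b (digits t) - digit_val b ones)) \<int>"
proof -
  have "digits t (p j - 1) = 0" "digits t (p j) = 0"
    using assms by (intro digits_zero_window[of k]; simp)+
  then have "1 / real b ^ 3 \<le> infdist (real b ^ (p j - 1) * (digit_val b ones - digit_val b (digits t))) \<int>"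
    using b p_pos[of j] ones_p[of j] ones_p_Suc[of j] by (intro infdist_ge_pattern10 digits_less ones_less) auto
  also have "real b ^ (p j - 1) * (digit_val b ones - digit_val b (digits t))
      = - (real b ^ (p j - 1) * (digit_val b (digits t) - digit_val b ones))" by (simp add: algebra_simps)
  finally show ?thesis by simp
qed

section \<open>Recurrence of good positions\<close>

lemma multiple_between:
  obtains q where "n < q" "q \<le> n + m" "m dvd q"
proof -
  define q where "q = m * (n div m) + m"
  have "n < q" "q \<le> n + m"
    using mult_div_mod_eq[of m n] mod_less_divisor[of m n] m unfolding q_def by linarith+
  moreover have "m dvd q" by (simp add: q_def)
  ultimately show ?thesis by (rule that)
qed

text \<open>If a digit 1 of y spoils the first multiple q of m, isolation protects
  \<open>q + m\<close>: the places that matter lie at most m + 2 after the spoiling one, hence the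
  gap m + 3.\<close>

lemma good_in_gap:
  obtains N where "\<And>n. N \<le> n \<Longrightarrow> (\<And>i. n \<le> i \<Longrightarrow> i \<le> n + 3 * m \<Longrightarrow> i \<notin> W) \<Longrightarrow> \<exists>n'\<ge>n. n' \<le> n + 2 * m \<and> good n'"
proof -
  obtain N where N: "\<And>i j. N \<le> i \<Longrightarrow> i < j \<Longrightarrow> ones i = 1 \<Longrightarrow> ones j = 1 \<Longrightarrow> i + (m + 3) \<le> j"
    using ones_isolated[of "m + 3"] by blast
  have "\<exists>n'\<ge>n. n' \<le> n + 2 * m \<and> good n'" if n: "N \<le> n" "\<And>i. n \<le> i \<Longrightarrow> i \<le> n + 3 * m \<Longrightarrow> i \<notin> W" for n
  proof -
    obtain q where q: "n < q" "q \<le> n + m" "m dvd q" by (rule multiple_between)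
    have notW: "q \<notin> W" "Suc q \<notin> W" "q + m \<notin> W" "Suc (q + m) \<notin> W"
      using q m by (intro n(2); linarith)+
    show ?thesis
    proof (cases "good q")
      case True
      then show ?thesis using q by (intro exI[of _ q]) auto
    next
      case False
      then obtain e where e: "ones (q + e) = 1" "e \<le> 2"
        using notW q(3) ones_0_or_1[of q] ones_0_or_1[of "Suc q"] ones_0_or_1[of "Suc (Suc q)"]
          that[of 0] that[of 1] that[of 2] unfolding good_def by (auto simp: numeral_2_eq_2)
      have "ones (q + m + e') = 0" if "e' \<le> 2" for e'
      proof (rule ccontr)
        assume "ones (q + m + e') \<noteq> 0"
        then have "ones (q + m + e') = 1" using ones_0_or_1[of "q + m + e'"] by simp
        with N[of "q + e" "q + m + e'"] e that m q n(1) show False by auto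
      qed
      from this[of 0] this[of 1] this[of 2] have "good (q + m)"
        unfolding good_def using notW q(3) by (auto simp: numeral_2_eq_2)
      then show ?thesis using q by (intro exI[of _ "q + m"]) auto
    qed
  qed
  then show ?thesis by (rule that)
qed

lemma next_good:
  obtains N where "\<And>n. N \<le> n \<Longrightarrow> (\<exists>n'\<ge>n. n' \<le> n + 2 * m \<and> good n') \<or>
    (\<exists>k. n < B k \<and> A k \<le> n + 3 * m \<and> A k < B k \<and> (\<exists>n'\<ge>B k. n' \<le> B k + 2 * m \<and> good n'))"
proof -
  obtain N where N: "\<And>n. N \<le> n \<Longrightarrow> (\<And>i. n \<le> i \<Longrightarrow> i \<le> n + 3 * m \<Longrightarrow> i \<notin> W) \<Longrightarrow> \<exists>n'\<ge>n. n' \<le> n + 2 * m \<and> good n'"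
    by (rule good_in_gap) blast
  have "(\<exists>n'\<ge>n. n' \<le> n + 2 * m \<and> good n') \<or>
    (\<exists>k. n < B k \<and> A k \<le> n + 3 * m \<and> A k < B k \<and> (\<exists>n'\<ge>B k. n' \<le> B k + 2 * m \<and> good n'))"
    if n: "N + B 0 + 3 * m \<le> n" for n
  proof (cases "\<exists>i. n \<le> i \<and> i \<le> n + 3 * m \<and> i \<in> W")
    case False
    then show ?thesis using N[of n] n by auto
  next
    case True
    then obtain i k where ik: "n \<le> i" "i \<le> n + 3 * m" "A k \<le> i" "i < B k" by (auto simp: W_def)
    have "\<exists>n'\<ge>B k. n' \<le> B k + 2 * m \<and> good n'"
    proof (rule N)
      fix j assume j: "B k \<le> j" "j \<le> B k + 3 * m"
      show "j \<notin> W"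
      proof
        assume "j \<in> W"
        then obtain l where l: "A l \<le> j" "j < B l" by (auto simp: W_def)
        then have "B k < B l" using j by linarith
        then have "k < l" using strict_mono_B by (simp add: strict_mono_less)
        then have "A (Suc k) \<le> A l" using strict_mono_A by (simp add: strict_mono_less_eq)
        \<comment> \<open>The bound on \<open>n\<close> excludes window 0, so the factor
          \<open>Suc k\<close> is at least 2. The next window then starts beyond
          \<open>B k + 3 * m\<close>, because \<open>3 * m < B k\<close>.\<close>
        moreover have "k \<noteq> 0"
        proof
          assume "k = 0"
          then show False using ik n by simp
        qed
        then have "2 * Suc (B k) \<le> Suc k * Suc (B k)" by (intro mult_le_mono1) simp
        with sparse[of k] have "2 * Suc (B k) \<le> A (Suc k)" by (rule order_trans[rotated])
        ultimately have "2 * Suc (B k) \<le> B k + 3 * m" using l j by (meson order_trans)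
        moreover have "3 * m < B k" using ik n by linarith
        ultimately show False by simp
      qed
    qed (use ik n in linarith)
    then show ?thesis using ik by (intro disjI2 exI[of _ k]) auto
  qed
  then show ?thesis by (rule that)
qed

text \<open>
  Positions from which the distance to the integers is bounded below recur fast enough: outside the
  windows with bounded gaps, and inside a window either its end or the next digit 1 of \<open>ones\<close> is near.
\<close>
lemma approx_exponent_windows_le:
  assumes a: "1 \<le> a"
    and good: "\<And>n. good n \<Longrightarrow> 1 / real b ^ 3 \<le> infdist (real b ^ n * w) \<int>"
    and jump: "\<And>k j. P k \<Longrightarrow> A k < p j \<Longrightarrow> p j < B k \<Longrightarrow> 1 / real b ^ 3 \<le> infdist (real b ^ (p j - 1) * w) \<int>"
    and ev: "\<forall>\<^sub>F k in sequentially. \<forall>n. A k \<le> n \<longrightarrow> n < B k \<longrightarrow>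
      real (B k) \<le> a * real n \<or> (P k \<and> (\<exists>j. n < p j \<and> real (p j) \<le> a * real n))"
  shows "approx_exponent b w \<le> ereal a"
proof -
  \<comment> \<open>The first summand pays for moving from \<open>n\<close> to the start of a window
    up to \<open>3 * m\<close> ahead, the second for the distance from the window's end to a good
    position.\<close>
  define C where "C = 3 * real m * a + 2 * real m"
  obtain K where K: "\<And>k n. K \<le> k \<Longrightarrow> A k \<le> n \<Longrightarrow> n < B k \<Longrightarrow>
      real (B k) \<le> a * real n \<or> (P k \<and> (\<exists>j. n < p j \<and> real (p j) \<le> a * real n))"
    using ev unfolding eventually_sequentially by blast
  obtain N where N: "\<And>n. N \<le> n \<Longrightarrow> (\<exists>n'\<ge>n. n' \<le> n + 2 * m \<and> good n') \<or>
    (\<exists>k. n < B k \<and> A k \<le> n + 3 * m \<and> A k < B k \<and> (\<exists>n'\<ge>B k. n' \<le> B k + 2 * m \<and> good n'))"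
    by (rule next_good) blast
  have step: "\<exists>n'\<ge>n. real n' \<le> a * real n + C \<and> 1 / real b ^ 3 \<le> infdist (real b ^ n' * w) \<int>"
    if n: "N + B K \<le> n" for n
  proof -
    have an: "real n \<le> a * real n" "0 \<le> real m * a" using a by (simp_all add: mult_le_cancel_right1)
    have "N \<le> n" using n by simp
    from N[OF this] show ?thesis
    proof (elim disjE exE conjE)
      fix n' assume "n \<le> n'" "n' \<le> n + 2 * m" "good n'"
      then have "real n' \<le> real n + 2 * real m" by linarith
      also have "\<dots> \<le> a * real n + C" using an by (simp add: C_def)
      finally show ?thesis using good \<open>good n'\<close> \<open>n \<le> n'\<close> by blast
    next
      fix k n' assume k: "n < B k" "A k \<le> n + 3 * m" "A k < B k" and n': "B k \<le> n'" "n' \<le> B k + 2 * m" "good n'"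
      define n1 where "n1 = max n (A k)"
      have n1: "n \<le> n1" "real n1 \<le> real n + 3 * real m" "A k \<le> n1" "n1 < B k"
        using k by (auto simp: n1_def)
      have an1: "a * real n1 \<le> a * real n + 3 * real m * a"
        using mult_left_mono[OF n1(2), of a] a by (simp add: algebra_simps)
      have window_end: ?thesis if "real (B k) \<le> a * real n1"
      proof -
        have "real n' \<le> real (B k) + 2 * real m" using n' by linarith
        then have "real n' \<le> a * real n + C" using that an1 by (simp add: C_def)
        then show ?thesis using good[OF n'(3)] k n' by (intro exI[of _ n']) auto
      qed
      have "B K < B k" using k n by linarith
      then have "K \<le> k" using strict_mono_B by (simp add: strict_mono_less)
      from K[OF this n1(3,4)] show ?thesis
      proof (elim disjE exE conjE)
        fix j assume j: "P k" "n1 < p j" "real (p j) \<le> a * real n1"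
        show ?thesis
        proof (cases "p j < B k")
          case True
          have "real (p j - 1) \<le> a * real n + C" using j an1 an by (simp add: C_def of_nat_diff)
          moreover have "n \<le> p j - 1" using j n1 by linarith
          moreover have "A k < p j" using j n1 by linarith
          ultimately show ?thesis using jump[OF j(1) _ True] by blast
        next
          case False
          then show ?thesis using j by (intro window_end) linarith
        qed
      qed (rule window_end)
    qed
  qed
  show ?thesis
  proof (rule approx_exponent_leI[OF b, of "1 / real b ^ 3" a C])
    show "\<forall>\<^sub>\<infinity>n. \<exists>n'\<ge>n. real n' \<le> a * real n + C \<and> 1 / real b ^ 3 \<le> infdist (real b ^ n' * w) \<int>"
      unfolding MOST_nat_le using step by blast
  qed (use b in auto)
qed

section \<open>Exponents of the points of the Cantor set\<close>

lemma approx_exponent_digits_le: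
  assumes "1 \<le> a"
    and "\<forall>\<^sub>F k in sequentially. \<forall>n. A k \<le> n \<longrightarrow> n < B k \<longrightarrow>
      real (B k) \<le> a * real n \<or> (c k \<and> (\<exists>j. n < p j \<and> real (p j) \<le> a * real n))"
  shows "approx_exponent b (digit_val b (digits t)) \<le> ereal a"
  by (rule approx_exponent_windows_le[OF assms(1) good_infdist(1) copy_window_infdist assms(2)])

lemma approx_exponent_diff_digits_le:
  assumes "1 \<le> a"
    and "\<forall>\<^sub>F k in sequentially. \<forall>n. A k \<le> n \<longrightarrow> n < B k \<longrightarrow>
      real (B k) \<le> a * real n \<or> (\<not> c k \<and> (\<exists>j. n < p j \<and> real (p j) \<le> a * real n))"
  shows "approx_exponent b (digit_val b (digits t) - digit_val b ones) \<le> ereal a"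
  by (rule approx_exponent_windows_le[OF assms(1) good_infdist(2) zero_window_infdist assms(2)])

lemma infdist_window_le:
  assumes agree: "\<And>i. A k \<le> i \<Longrightarrow> i < R \<Longrightarrow> digits t i = d i" and d: "\<And>i. d i < b"
    and R: "a * real (A k) \<le> real R"
  shows "infdist (real b ^ A k * (digit_val b (digits t) - digit_val b d)) \<int> \<le> real b powr (- (real (A k) * (a - 1)))"
proof -
  have "infdist (real b ^ A k * (digit_val b (digits t) - digit_val b d)) \<int> \<le> 1 / real b ^ (R - A k)"
    using agree by (intro infdist_le_if_digits_agree[OF b] digits_less d) auto
  also have "\<dots> = real b powr (- real (R - A k))" by (rule powr_minus_nat[OF b])
  also have "\<dots> \<le> real b powr (- (real (A k) * (a - 1)))"
    using b R by (intro powr_mono) (auto simp: algebra_simps)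
  finally show ?thesis .
qed

lemma approx_exponent_digits_ge:
  assumes "\<exists>\<^sub>\<infinity>k. \<not> c k \<and> a * real (A k) \<le> real (B k)"
  shows "ereal a \<le> approx_exponent b (digit_val b (digits t))"
proof (rule approx_exponent_geI_subseq[OF b le_A INFM_mono[OF assms]])
  fix k assume k: "\<not> c k \<and> a * real (A k) \<le> real (B k)"
  show "infdist (real b ^ A k * digit_val b (digits t)) \<int> \<le> real b powr (- (real (A k) * (a - 1)))"
    using infdist_window_le[of k "B k" t "\<lambda>_. 0" a] k b by (simp add: digits_zero_window)
qed

text \<open>\<open>R\<close> marks how far x agrees with y: in a copied window it may be the end, in
  a zero window it must stop before the next 1 of y.\<close>

lemma approx_exponent_diff_digits_ge:
  assumes "\<exists>\<^sub>\<infinity>k. \<exists>R\<le>B k. a * real (A k) \<le> real R \<and> (c k \<or> (\<forall>i. A k \<le> i \<longrightarrow> i < R \<longrightarrow> ones i = 0))"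
  shows "ereal a \<le> approx_exponent b (digit_val b (digits t) - digit_val b ones)"
proof (rule approx_exponent_geI_subseq[OF b le_A INFM_mono[OF assms]])
  fix k assume "\<exists>R\<le>B k. a * real (A k) \<le> real R \<and> (c k \<or> (\<forall>i. A k \<le> i \<longrightarrow> i < R \<longrightarrow> ones i = 0))"
  then obtain R where R: "R \<le> B k" "a * real (A k) \<le> real R" "c k \<or> (\<forall>i. A k \<le> i \<longrightarrow> i < R \<longrightarrow> ones i = 0)"
    by blast
  show "infdist (real b ^ A k * (digit_val b (digits t) - digit_val b ones)) \<int> \<le> real b powr (- (real (A k) * (a - 1)))"
  proof (rule infdist_window_le[OF _ ones_less[OF b] R(2)])
    fix i assume "A k \<le> i" "i < R"
    then show "digits t i = ones i" using R digits_copy_window[of k i t] digits_zero_window[of k i t]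
      by (cases "c k") auto
  qed
qed

end

section \<open>Counting free positions, and the dimension of the Cantor set\<close>

context windows
begin

lemma finite_free: "finite {j. j < i \<and> free j}"
  by (rule finite_subset[of _ "{..<i}"]) auto

lemma free_before_Suc: "free_before (Suc i) = (if free i then Suc (free_before i) else free_before i)"
proof (cases "free i")
  case True
  then have "{j. j < Suc i \<and> free j} = insert i {j. j < i \<and> free j}" by (auto simp: less_Suc_eq)
  then show ?thesis using True finite_free by (simp add: free_before_def)
next
  case False
  then have "{j. j < Suc i \<and> free j} = {j. j < i \<and> free j}" by (auto simp: less_Suc_eq)
  then show ?thesis using False by (simp add: free_before_def)
qed

lemma real_digits_agree_if_digits_agree:
  assumes "\<And>j. j < i \<Longrightarrow> digits t j = digits t' j" "l < free_before i"
  shows "real_digit b t l = real_digit b t' l"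
  using assms
proof (induction i)
  case (Suc i)
  show ?case
  proof (cases "l < free_before i")
    case False
    then have "free i" "l = free_before i"
      using Suc.prems(2) by (auto simp: free_before_Suc split: if_splits)
    then show ?thesis using Suc.prems(1)[of i] by (simp add: digits_def)
  qed (use Suc in auto)
qed (simp add: free_before_def)

lemma card_two_residues: "real (card {j. j < i \<and> j mod m < 2}) \<le> 2 * (real i / real m) + 2"
proof -
  have "card {j. j < i \<and> j mod m < 2} \<le> card ({..i div m} \<times> {..<2::nat})"
  proof (rule card_inj_on_le)
    show "inj_on (\<lambda>j. (j div m, j mod m)) {j. j < i \<and> j mod m < 2}"
      by (rule inj_onI) (metis div_mult_mod_eq prod.inject)
  qed (auto intro: div_le_mono)
  also have "\<dots> = 2 * (i div m) + 2" by (simp add: card_cartesian_product)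
  finally have "real (card {j. j < i \<and> j mod m < 2}) \<le> 2 * real (i div m) + 2" by linarith
  moreover have "real (i div m) \<le> real i / real m" by (rule of_nat_div_le_of_nat)
  ultimately show ?thesis by linarith
qed

text \<open>Only the last window before i matters. The earlier ones end by \<open>B k0\<close>,
  which is at most e i by the growing factor in \<open>sparse\<close>; the last one has length at
  most (1 - 1/a) times its end, hence at most (1 - 1/a) i.\<close>

lemma card_windows_le:
  assumes a: "1 \<le> a" and ev: "\<forall>\<^sub>F k in sequentially. real (B k) \<le> a * real (A k)" and e: "0 < e"
  obtains C where "0 \<le> C" "\<And>i. i \<notin> W \<Longrightarrow> real (card (W \<inter> {..<i})) \<le> (1 - 1 / a + e) * real i + C"
proof -
  have "\<forall>\<^sub>F k in sequentially. 1 / e \<le> real k"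
    using filterlim_real_sequentially by (simp add: filterlim_at_top)
  with ev obtain K where K: "\<And>k. K \<le> k \<Longrightarrow> real (B k) \<le> a * real (A k)" "\<And>k. K \<le> k \<Longrightarrow> 1 / e \<le> real k"
    unfolding eventually_sequentially by (meson le_trans nat_le_linear)
  have "real (card (W \<inter> {..<i})) \<le> (1 - 1 / a + e) * real i + real (B K)" if i: "i \<notin> W" for i
  proof (cases "i < A (Suc K)")
    case True
    have "W \<inter> {..<i} \<subseteq> {..<B K}"
    proof
      fix j assume "j \<in> W \<inter> {..<i}"
      then obtain l where l: "A l \<le> j" "j < B l" "j < i" by (auto simp: W_def)
      then have "A l < A (Suc K)" using True by linarith
      then have "l \<le> K" using strict_mono_A by (simp add: strict_mono_less)
      then have "B l \<le> B K" using strict_mono_B by (simp add: strict_mono_less_eq)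
      then show "j \<in> {..<B K}" using l by simp
    qed
    from card_mono[OF _ this] have "real (card (W \<inter> {..<i})) \<le> real (B K)" by simp
    moreover have "0 \<le> (1 - 1 / a + e) * real i" using a e by (intro mult_nonneg_nonneg) auto
    ultimately show ?thesis by linarith
  next
    case False
    define k where "k = (GREATEST k. A k \<le> i)"
    have bd: "\<forall>j. A j \<le> i \<longrightarrow> j \<le> i" using le_A order_trans by blast
    have AK: "A (Suc K) \<le> i" using False by simp
    have k: "A k \<le> i" "Suc K \<le> k"
      unfolding k_def using GreatestI_nat[where P = "\<lambda>k. A k \<le> i", OF AK] Greatest_le_nat[where P = "\<lambda>k. A k \<le> i", OF AK] bd
      by blast+
    have k': "i < A (Suc k)"
    proof (rule ccontr)
      assume "\<not> i < A (Suc k)"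
      then have "Suc k \<le> k" unfolding k_def
        by (intro Greatest_le_nat[where P = "\<lambda>k. A k \<le> i" and b = i]) (use bd in auto)
      then show False by simp
    qed
    have Bi: "B k \<le> i" using i k by (auto simp: W_def not_less[symmetric])
    obtain k0 where k0: "k = Suc k0" "K \<le> k0" using k(2) by (cases k) auto
    have "W \<inter> {..<i} \<subseteq> {..<B k0} \<union> {A k..<B k}"
    proof
      fix j assume "j \<in> W \<inter> {..<i}"
      then obtain l where l: "A l \<le> j" "j < B l" "j < i" by (auto simp: W_def)
      then have "A l < A (Suc k)" using k' by linarith
      then have lk: "l \<le> k" using strict_mono_A by (simp add: strict_mono_less)
      show "j \<in> {..<B k0} \<union> {A k..<B k}"
      proof (cases "l = k")
        case False
        then have "l \<le> k0" using lk k0 by simp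
        then have "B l \<le> B k0" using strict_mono_B by (simp add: strict_mono_less_eq)
        then show ?thesis using l by simp
      qed (use l in auto)
    qed
    then have "card (W \<inter> {..<i}) \<le> card ({..<B k0} \<union> {A k..<B k})" by (intro card_mono) auto
    also have "\<dots> \<le> B k0 + (B k - A k)" using card_Un_le[of "{..<B k0}" "{A k..<B k}"] by simp
    finally have card: "real (card (W \<inter> {..<i})) \<le> real (B k0) + (real (B k) - real (A k))"
      using A_le_B[of k] by linarith
    have "real (B k0) \<le> e * real i"
    proof -
      have "Suc k0 * Suc (B k0) \<le> i" using sparse[of k0] k k0 by simp
      then have "real (Suc k0 * Suc (B k0)) \<le> real i" by (rule of_nat_mono)
      moreover have "real (k0 * B k0) \<le> real (Suc k0 * Suc (B k0))" by (intro of_nat_mono mult_le_mono) auto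
      ultimately have "real k0 * real (B k0) \<le> real i" by simp
      moreover have "1 / e * real (B k0) \<le> real k0 * real (B k0)" using K(2)[OF k0(2)] by (intro mult_right_mono) auto
      ultimately have "real (B k0) / e \<le> real i" by simp
      then show ?thesis using e by (simp add: field_simps)
    qed
    moreover have "real (B k) - real (A k) \<le> (1 - 1 / a) * real i"
    proof -
      have "K \<le> k" using k by simp
      from K(1)[OF this] have "real (B k) / a \<le> real (A k)" using a by (simp add: field_simps)
      then have "real (B k) - real (A k) \<le> (1 - 1 / a) * real (B k)" by (simp add: algebra_simps)
      also have "\<dots> \<le> (1 - 1 / a) * real i" using Bi a by (intro mult_left_mono) auto
      finally show ?thesis .
    qed
    ultimately have "real (card (W \<inter> {..<i})) \<le> (1 - 1 / a + e) * real i"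
      using card by (simp add: algebra_simps)
    then show ?thesis by simp
  qed
  then show ?thesis by (intro that[of "real (B K)"]) auto
qed

lemma free_before_ge:
  assumes a: "1 \<le> a" and ev: "\<forall>\<^sub>F k in sequentially. real (B k) \<le> a * real (A k)"
    and s: "s + 2 / real m < 1 / a"
  obtains C where "\<And>i. i \<notin> W \<Longrightarrow> s * real i - C \<le> real (free_before i)"
proof -
  \<comment> \<open>With this value the density of the windows and of the two reserved residues
    leaves exactly \<open>s\<close> for the free positions.\<close>
  define e where "e = 1 / a - 2 / real m - s"
  have "e > 0" using s by (simp add: e_def)
  then obtain C where C: "0 \<le> C" "\<And>i. i \<notin> W \<Longrightarrow> real (card (W \<inter> {..<i})) \<le> (1 - 1 / a + e) * real i + C"
    using card_windows_le[OF a ev] by blast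
  have "s * real i - (C + 2) \<le> real (free_before i)" if "i \<notin> W" for i
  proof -
    have "{..<i} \<subseteq> {j. j < i \<and> free j} \<union> ({j. j < i \<and> j mod m < 2} \<union> (W \<inter> {..<i}))"
      by (auto simp: free_def)
    then have "card {..<i} \<le> card ({j. j < i \<and> free j} \<union> ({j. j < i \<and> j mod m < 2} \<union> (W \<inter> {..<i})))"
      by (intro card_mono) (use finite_free in auto)
    also have "\<dots> \<le> free_before i + (card {j. j < i \<and> j mod m < 2} + card (W \<inter> {..<i}))"
      unfolding free_before_def by (intro order_trans[OF card_Un_le] add_left_mono card_Un_le)
    finally have "real i \<le> real (free_before i) + (real (card {j. j < i \<and> j mod m < 2}) + real (card (W \<inter> {..<i})))"
      by simp
    moreover have "real i - 2 * (real i / real m) - (1 - 1 / a + e) * real i = s * real i"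
      by (simp add: e_def algebra_simps)
    ultimately show ?thesis using card_two_residues[of i] C(2)[OF that] by linarith
  qed
  then show ?thesis by (rule that)
qed

text \<open>At a multiple of m where y has digit 0, every point has digit 0, whether the position
  lies in a zero window, a copied one or none. By isolation one of two consecutive multiples
  qualifies.\<close>

lemma next_zero:
  obtains C where "\<And>i. \<exists>z. i < z \<and> z \<le> i + C \<and> (\<forall>t. digits t z = 0)"
proof -
  obtain N where N: "\<And>i j. N \<le> i \<Longrightarrow> i < j \<Longrightarrow> ones i = 1 \<Longrightarrow> ones j = 1 \<Longrightarrow> i + (m + 1) \<le> j"
    using ones_isolated[of "m + 1"] by blast
  have "\<exists>z. i < z \<and> z \<le> i + (N + 2 * m) \<and> (\<forall>t. digits t z = 0)" for i
  proof -
    obtain q where q: "i + N < q" "q \<le> i + N + m" "m dvd q" by (rule multiple_between)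
    have "ones q = 0 \<or> ones (q + m) = 0"
    proof (rule ccontr)
      assume "\<not> ?thesis"
      then have "ones q = 1" "ones (q + m) = 1" using ones_0_or_1[of q] ones_0_or_1[of "q + m"] by auto
      then show False using N[of q "q + m"] q m by simp
    qed
    then show ?thesis
    proof
      assume "ones q = 0"
      then show ?thesis using q by (intro exI[of _ q]) (auto simp: digits_mult_ones)
    next
      assume "ones (q + m) = 0"
      then show ?thesis using q by (intro exI[of _ "q + m"]) (auto simp: digits_mult_ones)
    qed
  qed
  then show ?thesis by (rule that)
qed

text \<open>A first difference alone does not separate the values, since the smaller digit may be
  followed by digits b - 1. The 0 at \<open>z\<close> rules this out and leaves a gap of b^-(z +
  1).\<close>

lemma digit_val_separation:
  assumes agree: "\<And>j. j < i \<Longrightarrow> digits t j = digits t' j" and less: "digits t i < digits t' i"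
    and z: "i < z" "digits t z = 0"
  shows "1 / real b ^ Suc z \<le> digit_val b (digits t') - digit_val b (digits t)"
proof -
  define u where "u = digit_val b (\<lambda>j. digits t (i + j))"
  define u' where "u' = digit_val b (\<lambda>j. digits t' (i + j))"
  have eq: "real b ^ i * (digit_val b (digits t') - digit_val b (digits t)) = u' - u"
    unfolding u_def u'_def using agree by (intro digit_val_shift_agree[OF b] digits_less) auto
  have "real b * u = real (digits t i) + digit_val b (\<lambda>j. digits t (i + Suc j))"
    unfolding u_def by (subst digit_val_Suc[OF b]) (auto simp: digits_less)
  moreover have "real b * u' = real (digits t' i) + digit_val b (\<lambda>j. digits t' (i + Suc j))"
    unfolding u'_def by (subst digit_val_Suc[OF b]) (auto simp: digits_less)
  moreover have "0 \<le> digit_val b (\<lambda>j. digits t' (i + Suc j))" by (intro digit_val_nonneg b digits_less)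
  moreover have "digit_val b (\<lambda>j. digits t (i + Suc j)) \<le> 1 - 1 / real b ^ Suc (z - Suc i)"
    using z b by (intro digit_val_le b digits_less) simp
  moreover have "real (digits t i) + 1 \<le> real (digits t' i)" using less by linarith
  ultimately have "1 / real b ^ (z - i) \<le> real b * (u' - u)"
    using z by (simp add: Suc_diff_Suc right_diff_distrib del: power_Suc)
  then have "1 / real b ^ (z - i) / (real b * real b ^ i) \<le> real b * (u' - u) / (real b * real b ^ i)"
    using b by (intro divide_right_mono) auto
  also have "real b * (u' - u) / (real b * real b ^ i) = digit_val b (digits t') - digit_val b (digits t)"
    unfolding eq[symmetric] using b by simp
  also have "1 / real b ^ (z - i) / (real b * real b ^ i) = 1 / real b ^ Suc z"
    using z by (simp add: power_add[symmetric])
  finally show ?thesis .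
qed

text \<open>Let i be the first index where two points differ. It is free, hence outside the windows,
  so t and t' share about s i digits, while the points are b^(- i) apart up to a constant.\<close>

lemma digits_inverse_holder:
  assumes a: "1 \<le> a" and ev: "\<forall>\<^sub>F k in sequentially. real (B k) \<le> a * real (A k)"
    and s: "0 < s" "s + 2 / real m < 1 / a"
  obtains C where "0 < C" "\<And>t t'. t \<in> {0..<1} \<Longrightarrow> t' \<in> {0..<1} \<Longrightarrow>
    \<bar>t - t'\<bar> \<le> C * \<bar>digit_val b (digits t) - digit_val b (digits t')\<bar> powr s"
proof -
  obtain C1 where C1: "\<And>i. i \<notin> W \<Longrightarrow> s * real i - C1 \<le> real (free_before i)"
    using free_before_ge[OF a ev s(2)] by blast
  obtain C0 where C0: "\<And>i. \<exists>z. i < z \<and> z \<le> i + C0 \<and> (\<forall>t. digits t z = 0)"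
    by (rule next_zero) blast
  define C where "C = real b powr (C1 + s * real (Suc C0))"
  have upper: "\<bar>t - t'\<bar> \<le> real b powr (C1 - s * real i)"
    if "t \<in> {0..<1}" "t' \<in> {0..<1}" "i \<notin> W" "\<And>j. j < i \<Longrightarrow> digits t j = digits t' j" for t t' i
  proof -
    have "\<bar>t - t'\<bar> \<le> 1 / real b ^ free_before i"
      using that by (intro real_digits_agree[OF b] real_digits_agree_if_digits_agree) auto
    also have "\<dots> = real b powr (- real (free_before i))" by (rule powr_minus_nat[OF b])
    also have "\<dots> \<le> real b powr (C1 - s * real i)" using C1[OF that(3)] b by (intro powr_mono) auto
    finally show ?thesis .
  qed
  have less: "\<bar>t - t'\<bar> \<le> C * \<bar>digit_val b (digits t) - digit_val b (digits t')\<bar> powr s"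
    if t: "t \<in> {0..<1}" "t' \<in> {0..<1}" and i: "\<And>j. j < i \<Longrightarrow> digits t j = digits t' j" "digits t i < digits t' i"
    for t t' i
  proof -
    obtain z where z: "i < z" "z \<le> i + C0" "digits t z = 0" using C0[of i] by blast
    have "i \<notin> W"
    proof
      assume "i \<in> W"
      then have "\<not> free i" by (simp add: free_def)
      then have "digits t i = digits t' i" by (simp add: digits_def)
      with i(2) show False by simp
    qed
    have "real b powr (- real (i + Suc C0)) \<le> real b powr (- real (Suc z))" using z b by (intro powr_mono) auto
    also have "\<dots> = 1 / real b ^ Suc z" by (rule powr_minus_nat[OF b, symmetric])
    also have "\<dots> \<le> digit_val b (digits t') - digit_val b (digits t)"
      by (rule digit_val_separation[OF i z(1,3)])
    finally have sep: "real b powr (- real (i + Suc C0)) \<le> \<bar>digit_val b (digits t) - digit_val b (digits t')\<bar>"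
      by simp
    have "\<bar>t - t'\<bar> \<le> real b powr (C1 - s * real i)" by (rule upper[OF t \<open>i \<notin> W\<close> i(1)])
    also have "\<dots> = C * (real b powr (- real (i + Suc C0))) powr s"
      by (simp add: C_def powr_powr powr_add[symmetric] algebra_simps)
    also have "\<dots> \<le> C * \<bar>digit_val b (digits t) - digit_val b (digits t')\<bar> powr s"
      using sep s b by (intro mult_left_mono powr_mono2) (auto simp: C_def)
    finally show ?thesis .
  qed
  have "\<bar>t - t'\<bar> \<le> C * \<bar>digit_val b (digits t) - digit_val b (digits t')\<bar> powr s"
    if t: "t \<in> {0..<1}" "t' \<in> {0..<1}" for t t'
  proof (cases "digits t = digits t'")
    case True
    \<comment> \<open>With no difference at all, the estimate \<open>upper\<close> is applied at the
      positions \<open>B k\<close>, which tend to infinity.\<close>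
    have "t = t'"
    proof (rule ccontr)
      assume "t \<noteq> t'"
      have "\<forall>\<^sub>F k in sequentially. 2 * real b powr C1 / \<bar>t - t'\<bar> \<le> real b powr (s * real k)"
        by (intro eventually_powr_dominated b s)
      then obtain k where k: "2 * real b powr C1 / \<bar>t - t'\<bar> \<le> real b powr (s * real k)"
        unfolding eventually_sequentially by blast
      have "\<bar>t - t'\<bar> \<le> real b powr (C1 - s * real (B k))"
        using upper[OF t B_notin_W] True by simp
      also have "\<dots> \<le> real b powr (C1 - s * real k)" using le_B[of k] s b by (intro powr_mono) auto
      also have "\<dots> = real b powr C1 / real b powr (s * real k)" by (rule powr_diff)
      also have "\<dots> \<le> real b powr C1 / (2 * real b powr C1 / \<bar>t - t'\<bar>)"
        using k b \<open>t \<noteq> t'\<close> by (intro divide_left_mono) auto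
      also have "\<dots> = \<bar>t - t'\<bar> / 2" using b by simp
      finally show False using \<open>t \<noteq> t'\<close> by simp
    qed
    then show ?thesis by simp
  next
    case False
    then have ex: "\<exists>i. digits t i \<noteq> digits t' i" by auto
    define i where "i = (LEAST i. digits t i \<noteq> digits t' i)"
    have i: "digits t i \<noteq> digits t' i" unfolding i_def by (rule LeastI_ex[OF ex])
    have agree: "digits t j = digits t' j" if "j < i" for j
      using not_less_Least[OF that[unfolded i_def]] by blast
    show ?thesis
    proof (cases "digits t i < digits t' i")
      case True
      show ?thesis by (rule less[OF t agree True])
    next
      case False
      then have "digits t' i < digits t i" using i by simp
      from less[OF t(2,1) agree[symmetric] this] show ?thesis by (simp add: abs_minus_commute)
    qed
  qed
  then show ?thesis using b by (intro that[of C]) (auto simp: C_def)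
qed

lemma hausdorff_measure_digits_neq_0:
  assumes "1 \<le> a" "\<forall>\<^sub>F k in sequentially. real (B k) \<le> a * real (A k)"
    and "0 < s" "s + 2 / real m < 1 / a"
    and E: "\<And>t. digit_val b (digits t) \<in> E"
  shows "hausdorff_measure s E \<noteq> 0"
proof -
  obtain C where "0 < C" "\<And>t t'. t \<in> {0..<1} \<Longrightarrow> t' \<in> {0..<1} \<Longrightarrow>
    \<bar>t - t'\<bar> \<le> C * \<bar>digit_val b (digits t) - digit_val b (digits t')\<bar> powr s"
    by (rule digits_inverse_holder[OF assms(1-4)]) blast
  then show ?thesis
    using assms(3) E by (intro hausdorff_measure_neq_0I[of s C "\<lambda>t. digit_val b (digits t)"]) auto
qed

end

section \<open>Joint level sets of approximation exponents\<close>

lemma ex_sparse_windows: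
  fixes Q :: "nat \<Rightarrow> nat \<Rightarrow> nat \<Rightarrow> bool"
  assumes "\<And>k M. \<exists>A\<ge>M. \<exists>B\<ge>A. Q k A B"
  obtains A B where "\<And>k. Q k (A k) (B k)" "\<And>k. A k \<le> B k" "\<And>k. Suc k * Suc (B k) \<le> A (Suc k)"
proof -
  have "\<exists>f. \<forall>k. (fst (f k) \<le> snd (f k) \<and> Q k (fst (f k)) (snd (f k))) \<and> Suc k * Suc (snd (f k)) \<le> fst (f (Suc k))"
  proof (rule dependent_nat_choice)
    show "\<exists>x. fst x \<le> snd x \<and> Q 0 (fst x) (snd x)"
      using assms[of 0 0] by auto
    show "\<exists>y. (fst y \<le> snd y \<and> Q (Suc k) (fst y) (snd y)) \<and> Suc k * Suc (snd x) \<le> fst y" for x :: "nat \<times> nat" and k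
      using assms[of "Suc k * Suc (snd x)" "Suc k"] by auto
  qed
  then obtain f where "\<And>k. (fst (f k) \<le> snd (f k) \<and> Q k (fst (f k)) (snd (f k))) \<and> Suc k * Suc (snd (f k)) \<le> fst (f (Suc k))"
    by blast
  then show ?thesis by (intro that[of "fst \<circ> f" "snd \<circ> f"]) auto
qed

lemma eventually_mult_add_le:
  assumes "x < (a::real)" and "\<And>k. k \<le> f k"
  shows "\<forall>\<^sub>F k in sequentially. x * real (f k) + C \<le> a * real (f k)"
proof -
  have "\<forall>\<^sub>F k in sequentially. C / (a - x) \<le> real k"
    using filterlim_real_sequentially by (simp add: filterlim_at_top)
  then show ?thesis
  proof eventually_elim
    case (elim k)
    have "real k \<le> real (f k)" using assms(2) by simp
    with elim have "C / (a - x) \<le> real (f k)" by (rule order_trans)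
    then show ?case using assms(1) by (simp add: field_simps)
  qed
qed

definition joint_level_set :: "nat \<Rightarrow> real \<Rightarrow> ereal \<Rightarrow> ereal \<Rightarrow> real set" where
  "joint_level_set b y d e = {x. approx_exponent b x = d \<and> approx_exponent b (x - y) = e}"

context spaced_ones
begin

text \<open>Common frame of both constructions. The hypotheses concern the windows but not the
  spacing m, which can thus be chosen after \<open>s\<close>.\<close>

lemma joint_level_set_large:
  assumes b: "b \<ge> 2" and AB: "\<And>k. A k \<le> B k" and sparse: "\<And>k. Suc k * Suc (B k) \<le> A (Suc k)"
    and d: "1 \<le> d" and e: "1 \<le> e"
    and d_le: "\<And>a. d < ereal a \<Longrightarrow> \<forall>\<^sub>F k in sequentially. \<forall>n. A k \<le> n \<longrightarrow> n < B k \<longrightarrow>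
      real (B k) \<le> a * real n \<or> (c k \<and> (\<exists>j. n < p j \<and> real (p j) \<le> a * real n))"
    and e_le: "\<And>a. e < ereal a \<Longrightarrow> \<forall>\<^sub>F k in sequentially. \<forall>n. A k \<le> n \<longrightarrow> n < B k \<longrightarrow>
      real (B k) \<le> a * real n \<or> (\<not> c k \<and> (\<exists>j. n < p j \<and> real (p j) \<le> a * real n))"
    and d_ge: "\<And>a. 1 < a \<Longrightarrow> ereal a < d \<Longrightarrow> \<exists>\<^sub>\<infinity>k. \<not> c k \<and> a * real (A k) \<le> real (B k)"
    and e_ge: "\<And>a. 1 < a \<Longrightarrow> ereal a < e \<Longrightarrow>
      \<exists>\<^sub>\<infinity>k. \<exists>R\<le>B k. a * real (A k) \<le> real R \<and> (c k \<or> (\<forall>i. A k \<le> i \<longrightarrow> i < R \<longrightarrow> ones i = 0))"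
    and dim: "\<And>a. d < ereal a \<Longrightarrow> \<forall>\<^sub>F k in sequentially. real (B k) \<le> a * real (A k)"
  shows "joint_level_set b (digit_val b ones) d e \<noteq> {}"
    and "0 < s \<Longrightarrow> ereal s * d < 1 \<Longrightarrow> hausdorff_measure s (joint_level_set b (digit_val b ones) d e) \<noteq> 0"
proof -
  have windows: "windows p \<eta> b m A B" if "3 \<le> m" for m
    using b that AB sparse by unfold_locales auto
  have ge1: "1 \<le> a" if "1 \<le> x" "x < ereal a" for a and x :: ereal
    using order.strict_trans1[OF that] by (simp add: one_ereal_def)
  have mem: "digit_val b (windows.digits p b m A B c t) \<in> joint_level_set b (digit_val b ones) d e"
    if m: "3 \<le> m" for m t
  proof -
    interpret windows p \<eta> b m A B c by (rule windows[OF m])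
    have "approx_exponent b (digit_val b (digits t)) \<le> d"
    proof (rule ereal_le_if_real_less)
      fix a assume a: "d < ereal a"
      then show "approx_exponent b (digit_val b (digits t)) \<le> ereal a"
        by (intro approx_exponent_digits_le ge1[OF d] d_le)
    qed
    moreover have "d \<le> approx_exponent b (digit_val b (digits t))"
    proof (rule ereal_le_if_real_below)
      fix a assume a: "ereal a < d"
      show "ereal a \<le> approx_exponent b (digit_val b (digits t))"
      proof (cases "1 < a")
        case False
        then have "ereal a \<le> 1" by (simp add: one_ereal_def)
        then show ?thesis using approx_exponent_ge_1 by (rule order_trans)
      qed (intro approx_exponent_digits_ge d_ge a)
    qed
    moreover have "approx_exponent b (digit_val b (digits t) - digit_val b ones) \<le> e"
    proof (rule ereal_le_if_real_less)
      fix a assume a: "e < ereal a"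
      then show "approx_exponent b (digit_val b (digits t) - digit_val b ones) \<le> ereal a"
        by (intro approx_exponent_diff_digits_le ge1[OF e] e_le)
    qed
    moreover have "e \<le> approx_exponent b (digit_val b (digits t) - digit_val b ones)"
    proof (rule ereal_le_if_real_below)
      fix a assume a: "ereal a < e"
      show "ereal a \<le> approx_exponent b (digit_val b (digits t) - digit_val b ones)"
      proof (cases "1 < a")
        case False
        then have "ereal a \<le> 1" by (simp add: one_ereal_def)
        then show ?thesis using approx_exponent_ge_1 by (rule order_trans)
      qed (intro approx_exponent_diff_digits_ge e_ge a)
    qed
    ultimately show ?thesis by (simp add: joint_level_set_def antisym)
  qed
  then show "joint_level_set b (digit_val b ones) d e \<noteq> {}" by blast
  assume s: "0 < s" "ereal s * d < 1"
  obtain \<delta> where \<delta>: "d = ereal \<delta>" using s d by (cases d) auto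
  have "1 \<le> \<delta>" "\<delta> < 1 / s" using s d unfolding \<delta> by (auto simp: one_ereal_def field_simps)
  \<comment> \<open>\<open>a\<close> lies strictly between the exponent and \<open>1 / s\<close>;
    the spacing is then taken so large that the loss 2/m fits into \<open>1 / a - s\<close>.\<close>
  then obtain a where a: "\<delta> < a" "a < 1 / s" "1 \<le> a" using dense[of \<delta> "1 / s"] by auto
  then have pos: "0 < 1 / a - s" using s by (simp add: field_simps)
  obtain m where m: "2 / (1 / a - s) < real m" using reals_Archimedean2 by blast
  define m' where "m' = max m 3"
  have "2 / (1 / a - s) < real m'" using m by (simp add: m'_def)
  then have sm: "s + 2 / real m' < 1 / a" using pos by (simp add: m'_def field_simps)
  interpret windows p \<eta> b m' A B c by (rule windows) (simp add: m'_def)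
  show "hausdorff_measure s (joint_level_set b (digit_val b ones) d e) \<noteq> 0"
    using a s sm dim[of a] mem[of m'] by (intro hausdorff_measure_digits_neq_0[of a]) (auto simp: m'_def \<delta>)
qed

text \<open>Even windows vanish and realise \<open>d\<close> in x; odd ones copy y and realise
  \<open>e\<close> in x - y. The respective other exponent sees a digit 1 of y within ratio about
  \<eta>, which does no harm as \<eta> is at most both targets.\<close>

lemma joint_level_set_large_above:
  assumes b: "b \<ge> 2" and e: "ereal \<eta> \<le> e" "e \<le> d"
  shows "joint_level_set b (digit_val b ones) d e \<noteq> {}"
    and "0 < s \<Longrightarrow> ereal s * d < 1 \<Longrightarrow> hausdorff_measure s (joint_level_set b (digit_val b ones) d e) \<noteq> 0"
proof -
  \<comment> \<open>The targets may be infinite; the window ratios then have to grow without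
    bound.\<close>
  have approximants: "\<exists>u. (\<forall>k. 1 \<le> u k \<and> ereal (u k) \<le> z) \<and> (\<forall>a. ereal a < z \<longrightarrow> (\<forall>\<^sub>F k::nat in sequentially. a \<le> u k))"
    if "ereal \<eta> \<le> z" for z
  proof (cases z)
    case (real r)
    then show ?thesis using that eta by (intro exI[of _ "\<lambda>_. r"]) auto
  next
    case PInf
    have "\<forall>\<^sub>F k::nat in sequentially. a \<le> 1 + real k" for a
    proof -
      have "\<forall>\<^sub>F k::nat in sequentially. a \<le> real k"
        using filterlim_real_sequentially by (simp add: filterlim_at_top)
      then show ?thesis by eventually_elim simp
    qed
    then show ?thesis using PInf by (intro exI[of _ "\<lambda>k. 1 + real k"]) auto
  qed (use that in auto)
  obtain u where u: "\<And>k. 1 \<le> u k" "\<And>k. ereal (u k) \<le> d" "\<And>a. ereal a < d \<Longrightarrow> \<forall>\<^sub>F k::nat in sequentially. a \<le> u k"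
    using approximants[of d] e order_trans by blast
  obtain v where v: "\<And>k. 1 \<le> v k" "\<And>k. ereal (v k) \<le> e" "\<And>a. ereal a < e \<Longrightarrow> \<forall>\<^sub>F k::nat in sequentially. a \<le> v k"
    using approximants[of e] e by blast
  define w where "w = (\<lambda>k. if odd k then v k else u k)"
  have w1: "1 \<le> w k" for k using u v by (simp add: w_def)
  obtain A B where AB: "\<And>k. B k = nat \<lceil>w k * real (A k)\<rceil>" "\<And>k. A k \<le> B k" "\<And>k. Suc k * Suc (B k) \<le> A (Suc k)"
  proof (rule ex_sparse_windows[of "\<lambda>k A B. B = nat \<lceil>w k * real A\<rceil>"])
    fix k M
    have "real M \<le> w k * real M" using w1[of k] by (simp add: mult_le_cancel_right1)
    then have "M \<le> nat \<lceil>w k * real M\<rceil>" by linarith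
    then show "\<exists>A\<ge>M. \<exists>B\<ge>A. B = nat \<lceil>w k * real A\<rceil>" by blast
  qed (rule that)
  interpret windows p \<eta> b 3 A B odd
    using b AB by unfold_locales auto
  have B: "w k * real (A k) \<le> real (B k)" "real (B k) \<le> w k * real (A k) + 1" for k
  proof -
    have "0 \<le> w k * real (A k)" using w1[of k] by simp
    then show "w k * real (A k) \<le> real (B k)" "real (B k) \<le> w k * real (A k) + 1"
      unfolding AB(1) by linarith+
  qed
  have B_le: "\<forall>\<^sub>F k in sequentially. ereal (w k) \<le> z \<longrightarrow> real (B k) \<le> a * real (A k)"
    if z: "z < ereal a" "ereal \<eta> \<le> z" for a z
  proof -
    obtain r where r: "z = ereal r" using z by (cases z) auto
    then have "r < a" using z by simp
    from eventually_mult_add_le[OF this le_A, of 1] show ?thesis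
    proof eventually_elim
      case (elim k)
      show ?case
      proof
        assume "ereal (w k) \<le> z"
        then have "w k * real (A k) \<le> r * real (A k)" by (intro mult_right_mono) (auto simp: r)
        with B(2)[of k] elim show "real (B k) \<le> a * real (A k)" by linarith
      qed
    qed
  qed
  have an: "a * real (A k) \<le> a * real n" if "A k \<le> n" "ereal \<eta> < ereal a" for a k n
    using that eta by (intro mult_left_mono) auto
  have next_p: "\<forall>\<^sub>F k in sequentially. \<forall>n\<ge>A k. \<exists>j. n < p j \<and> real (p j) \<le> a * real n"
    if "\<eta> < a" for a
  proof -
    have "\<forall>\<^sub>F k in sequentially. \<forall>n\<ge>k. \<exists>j. n < p j \<and> real (p j) \<le> a * real n"
      by (rule eventually_all_ge_at_top[OF eventually_next_p[OF that]])
    then show ?thesis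
    proof eventually_elim
      case (elim k)
      then show ?case using le_A[of k] by (meson order_trans)
    qed
  qed
  have eta1: "1 \<le> ereal \<eta>" using eta by (simp add: one_ereal_def)
  then have e1: "1 \<le> e" using e by (meson order_trans)
  then have d1: "1 \<le> d" using e by (meson order_trans)
  have d_le: "\<forall>\<^sub>F k in sequentially. \<forall>n. A k \<le> n \<longrightarrow> n < B k \<longrightarrow>
      real (B k) \<le> a * real n \<or> (odd k \<and> (\<exists>j. n < p j \<and> real (p j) \<le> a * real n))" if a: "d < ereal a" for a
  proof -
    have \<eta>a: "ereal \<eta> < ereal a" using e a by (meson order.strict_trans1)
    have "ereal \<eta> \<le> d" using e by (meson order_trans)
    have "\<eta> < a" using \<eta>a by simp
    from B_le[OF a \<open>ereal \<eta> \<le> d\<close>] next_p[OF this] show ?thesis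
    proof eventually_elim
      case (elim k)
      show ?case
      proof (cases "odd k")
        case False
        then have "real (B k) \<le> a * real (A k)" using elim(1) u(2)[of k] by (simp add: w_def)
        then show ?thesis using an[OF _ \<eta>a] by (meson order_trans)
      next
        case True
        then show ?thesis using elim(2) by blast
      qed
    qed
  qed
  have e_le: "\<forall>\<^sub>F k in sequentially. \<forall>n. A k \<le> n \<longrightarrow> n < B k \<longrightarrow>
      real (B k) \<le> a * real n \<or> (\<not> odd k \<and> (\<exists>j. n < p j \<and> real (p j) \<le> a * real n))" if a: "e < ereal a" for a
  proof -
    have \<eta>a: "ereal \<eta> < ereal a" using e a by (meson order.strict_trans1)
    have "\<eta> < a" using \<eta>a by simp
    from B_le[OF a e(1)] next_p[OF this] show ?thesis
    proof eventually_elim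
      case (elim k)
      show ?case
      proof (cases "odd k")
        case True
        then have "real (B k) \<le> a * real (A k)" using elim(1) v(2)[of k] by (simp add: w_def)
        then show ?thesis using an[OF _ \<eta>a] by (meson order_trans)
      next
        case False
        then show ?thesis using elim(2) by blast
      qed
    qed
  qed
  have INFM_even: "\<exists>\<^sub>\<infinity>k::nat. even k"
    unfolding INFM_nat_le
  proof
    show "\<exists>n\<ge>m. even n" for m :: nat by (rule exI[of _ "2 * m"]) simp
  qed
  have INFM_odd: "\<exists>\<^sub>\<infinity>k::nat. odd k"
    unfolding INFM_nat_le
  proof
    show "\<exists>n\<ge>m. odd n" for m :: nat by (rule exI[of _ "2 * m + 1"]) simp
  qed
  have d_ge: "\<exists>\<^sub>\<infinity>k. \<not> odd k \<and> a * real (A k) \<le> real (B k)" if a: "ereal a < d" for a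
  proof -
    have "\<forall>\<^sub>\<infinity>k. a \<le> u k" using u(3)[OF a] by (simp add: cofinite_eq_sequentially)
    from INFM_conjI[OF INFM_even this] show ?thesis
    proof (rule INFM_mono)
      fix k assume k: "even k \<and> a \<le> u k"
      then have "a * real (A k) \<le> w k * real (A k)" by (intro mult_right_mono) (auto simp: w_def)
      then show "\<not> odd k \<and> a * real (A k) \<le> real (B k)" using k B(1)[of k] by auto
    qed
  qed
  have e_ge: "\<exists>\<^sub>\<infinity>k. \<exists>R\<le>B k. a * real (A k) \<le> real R \<and> (odd k \<or> (\<forall>i. A k \<le> i \<longrightarrow> i < R \<longrightarrow> ones i = 0))"
    if a: "ereal a < e" for a
  proof -
    have "\<forall>\<^sub>\<infinity>k. a \<le> v k" using v(3)[OF a] by (simp add: cofinite_eq_sequentially)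
    from INFM_conjI[OF INFM_odd this] show ?thesis
    proof (rule INFM_mono)
      fix k assume k: "odd k \<and> a \<le> v k"
      then have "a * real (A k) \<le> w k * real (A k)" by (intro mult_right_mono) (auto simp: w_def)
      then show "\<exists>R\<le>B k. a * real (A k) \<le> real R \<and> (odd k \<or> (\<forall>i. A k \<le> i \<longrightarrow> i < R \<longrightarrow> ones i = 0))"
        using k B(1)[of k] by (intro exI[of _ "B k"]) auto
    qed
  qed
  have dim: "\<forall>\<^sub>F k in sequentially. real (B k) \<le> a * real (A k)" if a: "d < ereal a" for a
  proof -
    have "ereal \<eta> \<le> d" using e by (meson order_trans)
    from B_le[OF a this] show ?thesis
    proof eventually_elim
      case (elim k)
      have "ereal (v k) \<le> d" using v(2)[of k] e(2) by (rule order_trans)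
      then have "ereal (w k) \<le> d" using u(2)[of k] by (simp add: w_def)
      with elim show ?case by blast
    qed
  qed
  note * = joint_level_set_large[OF b AB(2,3) d1 e1 d_le e_le d_ge e_ge dim]
  show "joint_level_set b (digit_val b ones) d e \<noteq> {}" by (rule *(1))
  show "0 < s \<Longrightarrow> ereal s * d < 1 \<Longrightarrow> hausdorff_measure s (joint_level_set b (digit_val b ones) d e) \<noteq> 0" by (rule *(2))
qed

text \<open>
  Here a digit 1 of \<open>ones\<close> splits each window, which starts at \<open>A\<close> and ends at \<open>\<delta> A\<close>, at the position
  \<open>\<epsilon> A\<close>; the second part has the ratio \<open>\<delta> / \<epsilon> \<le> \<epsilon>\<close>.
\<close>
lemma joint_level_set_large_below:
  assumes b: "b \<ge> 2" and e: "1 \<le> \<epsilon>" "\<epsilon> < \<eta>" and d: "\<epsilon> \<le> \<delta>" "\<delta> \<le> \<epsilon>\<^sup>2"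
  shows "joint_level_set b (digit_val b ones) (ereal \<delta>) (ereal \<epsilon>) \<noteq> {}"
    and "0 < s \<Longrightarrow> ereal s * ereal \<delta> < 1 \<Longrightarrow> hausdorff_measure s (joint_level_set b (digit_val b ones) (ereal \<delta>) (ereal \<epsilon>)) \<noteq> 0"
proof -
  \<comment> \<open>Rounding up \<open>p (Suc j) / \<epsilon>\<close> makes \<epsilon> A the
    position of a digit 1 of y, up to an error of \<epsilon>.\<close>
  obtain A B where AB: "\<And>k. \<exists>j\<ge>k. A k = nat \<lceil>real (p (Suc j)) / \<epsilon>\<rceil> \<and> B k = nat \<lceil>\<delta> * real (A k)\<rceil>"
    "\<And>k. A k \<le> B k" "\<And>k. Suc k * Suc (B k) \<le> A (Suc k)"
  proof (rule ex_sparse_windows[of "\<lambda>k A B. \<exists>j\<ge>k. A = nat \<lceil>real (p (Suc j)) / \<epsilon>\<rceil> \<and> B = nat \<lceil>\<delta> * real A\<rceil>"])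
    fix k M
    define j where "j = max k (nat \<lceil>\<epsilon> * real M\<rceil>)"
    define A where "A = nat \<lceil>real (p (Suc j)) / \<epsilon>\<rceil>"
    have "\<epsilon> * real M \<le> real j" unfolding j_def by linarith
    also have "real j \<le> real (p (Suc j))" using le_p[of "Suc j"] by simp
    finally have "real M \<le> real (p (Suc j)) / \<epsilon>" using e by (simp add: field_simps)
    then have "M \<le> A" unfolding A_def by linarith
    moreover have "real A \<le> \<delta> * real A" using e d by (simp add: mult_le_cancel_right1)
    then have "A \<le> nat \<lceil>\<delta> * real A\<rceil>" by linarith
    moreover have "k \<le> j" by (simp add: j_def)
    ultimately show "\<exists>A\<ge>M. \<exists>B\<ge>A. \<exists>j\<ge>k. A = nat \<lceil>real (p (Suc j)) / \<epsilon>\<rceil> \<and> B = nat \<lceil>\<delta> * real A\<rceil>"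
      using A_def by blast
  qed (rule that)
  then obtain j where j: "\<And>k. k \<le> j k" "\<And>k. A k = nat \<lceil>real (p (Suc (j k))) / \<epsilon>\<rceil>" "\<And>k. B k = nat \<lceil>\<delta> * real (A k)\<rceil>"
    by metis
  \<comment> \<open>All windows vanish; \<epsilon> is realised by the part of a window in front of
    the digit 1 at \<open>q k\<close>.\<close>
  interpret windows p \<eta> b 3 A B "\<lambda>_. False"
    using b AB by unfold_locales auto
  define q where "q = (\<lambda>k. p (Suc (j k)))"
  have le_q: "k \<le> q k" for k using le_p[of "Suc (j k)"] j(1)[of k] by (simp add: q_def)
  have A: "real (q k) \<le> \<epsilon> * real (A k)" "\<epsilon> * real (A k) \<le> real (q k) + \<epsilon>" for k
  proof -
    have "real (q k) / \<epsilon> \<ge> 0" using e by simp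
    then have "real (q k) / \<epsilon> \<le> real (A k)" "real (A k) \<le> real (q k) / \<epsilon> + 1"
      unfolding j(2) q_def by linarith+
    then show "real (q k) \<le> \<epsilon> * real (A k)" "\<epsilon> * real (A k) \<le> real (q k) + \<epsilon>"
      using e by (auto simp: field_simps)
  qed
  have B: "\<delta> * real (A k) \<le> real (B k)" "real (B k) \<le> \<delta> * real (A k) + 1" for k
  proof -
    have "\<delta> * real (A k) \<ge> 0" using e d by simp
    then show "\<delta> * real (A k) \<le> real (B k)" "real (B k) \<le> \<delta> * real (A k) + 1"
      unfolding j(3) by linarith+
  qed
  have dim: "\<forall>\<^sub>F k in sequentially. real (B k) \<le> a * real (A k)" if a: "ereal \<delta> < ereal a" for a
  proof -
    have "\<delta> < a" using a by simp
    from eventually_mult_add_le[OF this le_A, of 1] show ?thesis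
    proof eventually_elim
      case (elim k)
      with B(2)[of k] show ?case by linarith
    qed
  qed
  have d_le: "\<forall>\<^sub>F k in sequentially. \<forall>n. A k \<le> n \<longrightarrow> n < B k \<longrightarrow>
      real (B k) \<le> a * real n \<or> (False \<and> (\<exists>j. n < p j \<and> real (p j) \<le> a * real n))" if a: "ereal \<delta> < ereal a" for a
    using dim[OF a]
  proof eventually_elim
    case (elim k)
    have "a * real (A k) \<le> a * real n" if "A k \<le> n" for n
      using that a e d by (intro mult_left_mono) auto
    with elim show ?case by (meson order_trans)
  qed
  have e_le: "\<forall>\<^sub>F k in sequentially. \<forall>n. A k \<le> n \<longrightarrow> n < B k \<longrightarrow>
      real (B k) \<le> a * real n \<or> (\<not> False \<and> (\<exists>j. n < p j \<and> real (p j) \<le> a * real n))" if "ereal \<epsilon> < ereal a" for a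
  proof -
    have a: "\<epsilon> < a" using that by simp
    from eventually_mult_add_le[OF this le_q, of "\<epsilon>\<^sup>2 + 1"] show ?thesis
    proof eventually_elim
      case (elim k)
      \<comment> \<open>Before \<open>q k\<close> this digit 1 is the near one, at most \<epsilon>
        A. From \<open>q k\<close> on the end of the window is near: it is at most \<epsilon> q plus
        the rounding errors \<epsilon> * \<epsilon> + 1.\<close>
      have "real (B k) \<le> a * real n \<or> (\<exists>j. n < p j \<and> real (p j) \<le> a * real n)" if n: "A k \<le> n" for n
      proof (cases "n < q k")
        case True
        have "real (q k) \<le> \<epsilon> * real (A k)" by (rule A)
        also have "\<dots> \<le> a * real n" using a e n by (intro mult_mono) auto
        finally show ?thesis using True by (auto simp: q_def)
      next
        case False
        have "real (B k) \<le> \<epsilon>\<^sup>2 * real (A k) + 1"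
          using B(2)[of k] mult_right_mono[OF d(2), of "real (A k)"] by simp
        also have "\<dots> = \<epsilon> * (\<epsilon> * real (A k)) + 1" by (simp add: power2_eq_square)
        also have "\<dots> \<le> \<epsilon> * (real (q k) + \<epsilon>) + 1" using A(2)[of k] e by (intro add_right_mono mult_left_mono) auto
        also have "\<dots> \<le> a * real (q k)" using elim by (simp add: power2_eq_square algebra_simps)
        also have "\<dots> \<le> a * real n" using False a e by (intro mult_left_mono) auto
        finally show ?thesis by simp
      qed
      then show ?case by simp
    qed
  qed
  have d_ge: "\<exists>\<^sub>\<infinity>k. \<not> False \<and> a * real (A k) \<le> real (B k)" if "ereal a < ereal \<delta>" for a
  proof -
    have "a * real (A k) \<le> real (B k)" for k
      using B(1)[of k] that mult_right_mono[of a \<delta> "real (A k)"] by simp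
    then show ?thesis by (auto simp: INFM_nat_le)
  qed
  have e_ge: "\<exists>\<^sub>\<infinity>k. \<exists>R\<le>B k. a * real (A k) \<le> real R \<and> (False \<or> (\<forall>i. A k \<le> i \<longrightarrow> i < R \<longrightarrow> ones i = 0))"
    if a1: "1 < a" and "ereal a < ereal \<epsilon>" for a
  proof -
    have a: "a < \<epsilon>" using that by simp
    have "\<forall>\<^sub>F k in sequentially. \<epsilon> * real (p k) + 0 \<le> real (p (Suc k))"
      by (rule eventually_le_p_Suc[OF e(2)])
    then have "\<forall>\<^sub>F k in sequentially. \<forall>l\<ge>k. \<epsilon> * real (p l) + 0 \<le> real (p (Suc l))"
      by (rule eventually_all_ge_at_top)
    \<comment> \<open>The slack pays for rounding \<open>A k\<close>, for rounding \<open>R\<close>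
      and for the unit that makes \<open>R < q k\<close> strict.\<close>
    moreover have "\<forall>\<^sub>F k in sequentially. a * real (q k) + (a * \<epsilon> + 2 * \<epsilon>) \<le> \<epsilon> * real (q k)"
      by (rule eventually_mult_add_le[OF a le_q])
    ultimately have "\<forall>\<^sub>F k in sequentially. \<exists>R\<le>B k. a * real (A k) \<le> real R \<and> (False \<or> (\<forall>i. A k \<le> i \<longrightarrow> i < R \<longrightarrow> ones i = 0))"
    proof eventually_elim
      case (elim k)
      define R where "R = nat \<lceil>a * real (A k)\<rceil>"
      have "a * real (A k) \<le> \<delta> * real (A k)" using a d by (intro mult_right_mono) auto
      then have RB: "R \<le> B k" unfolding R_def j(3) by (intro nat_mono ceiling_mono)
      have "0 \<le> a * real (A k)" using a1 by simp
      then have R: "a * real (A k) \<le> real R" "real R \<le> a * real (A k) + 1"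
        unfolding R_def by linarith+
      \<comment> \<open>As \<open>\<epsilon> < \<eta>\<close>, the digit 1 preceding
        \<open>q k\<close> lies at or before the start of the window, so y has only zeros from there
        up to \<open>R\<close>.\<close>
      have "\<epsilon> * real (p (j k)) \<le> real (q k)" using elim(1) j(1)[of k] by (simp add: q_def)
      also have "\<dots> \<le> \<epsilon> * real (A k)" by (rule A)
      finally have pA: "p (j k) \<le> A k" using e by simp
      have "\<epsilon> * real R \<le> \<epsilon> * (a * real (A k) + 1)" using R(2) e by (intro mult_left_mono) auto
      also have "\<dots> = a * (\<epsilon> * real (A k)) + \<epsilon>" by (simp add: algebra_simps)
      also have "\<dots> \<le> a * (real (q k) + \<epsilon>) + \<epsilon>" using A(2)[of k] a1 by (intro add_right_mono mult_left_mono) auto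
      also have "\<dots> \<le> \<epsilon> * real (q k) - \<epsilon>" using elim(2) by (simp add: algebra_simps)
      also have "\<dots> = \<epsilon> * (real (q k) - 1)" by (simp add: algebra_simps)
      finally have "real R \<le> real (q k) - 1" using e by simp
      then have Rq: "R < q k" by linarith
      have "ones i = 0" if "A k \<le> i" "i < R" for i
        using that pA Rq by (intro ones_eq_0[of "j k"]) (auto simp: q_def)
      then show ?case using RB R by blast
    qed
    then have "\<forall>\<^sub>\<infinity>k. \<exists>R\<le>B k. a * real (A k) \<le> real R \<and> (False \<or> (\<forall>i. A k \<le> i \<longrightarrow> i < R \<longrightarrow> ones i = 0))"
      by (simp only: cofinite_eq_sequentially)
    then show ?thesis by (rule eventually_frequently[rotated]) simp
  qed
  have 1: "1 \<le> ereal \<delta>" "1 \<le> ereal \<epsilon>" using e d by (auto simp: one_ereal_def)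
  note * = joint_level_set_large[OF b AB(2,3) 1 d_le e_le d_ge e_ge dim]
  show "joint_level_set b (digit_val b ones) (ereal \<delta>) (ereal \<epsilon>) \<noteq> {}" by (rule *(1))
  show "0 < s \<Longrightarrow> ereal s * ereal \<delta> < 1 \<Longrightarrow> hausdorff_measure s (joint_level_set b (digit_val b ones) (ereal \<delta>) (ereal \<epsilon>)) \<noteq> 0"
    by (rule *(2))
qed

end

section \<open>The spectrum in terms of joint level sets\<close>

lemma diameter_reflect: "diameter ((\<lambda>x. y - x) ` U) = diameter U" for y :: real
proof (cases "U = {}")
  case False
  have "(\<lambda>x. y - x) ` U \<times> (\<lambda>x. y - x) ` U = (\<lambda>(x, x'). (y - x, y - x')) ` (U \<times> U)" by auto
  then have "(\<lambda>(x, x'). dist x x') ` ((\<lambda>x. y - x) ` U \<times> (\<lambda>x. y - x) ` U) = (\<lambda>(x, x'). dist x x') ` (U \<times> U)"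
    by (simp add: image_image split_beta dist_real_def abs_minus_commute)
  then show ?thesis using False by (simp add: diameter_def)
qed simp

lemma hausdorff_premeasure_reflect_le:
  fixes y :: real
  shows "hausdorff_premeasure s \<delta> ((\<lambda>x. y - x) ` E) \<le> hausdorff_premeasure s \<delta> E"
  unfolding hausdorff_premeasure_def[of s \<delta> E]
proof (rule Inf_greatest)
  fix S assume "S \<in> {(\<Sum>i. diam_weight s (U i)) | U :: nat \<Rightarrow> real set.
            (\<forall>i. bounded (U i) \<and> diameter (U i) \<le> \<delta>) \<and> E \<subseteq> (\<Union>i. U i)}"
  then obtain U :: "nat \<Rightarrow> real set" where U: "S = (\<Sum>i. diam_weight s (U i))"
    "\<And>i. bounded (U i)" "\<And>i. diameter (U i) \<le> \<delta>" "E \<subseteq> (\<Union>i. U i)"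
    by blast
  define V where "V = (\<lambda>i. (\<lambda>x. y - x) ` U i)"
  have "bounded (V i)" for i
  proof -
    obtain r where "\<And>x. x \<in> U i \<Longrightarrow> norm x \<le> r" using U(2)[of i] by (auto simp: bounded_iff)
    then have "norm x \<le> norm y + r" if "x \<in> V i" for x
      using that norm_triangle_ineq4[of y] by (fastforce simp: V_def intro: order_trans)
    then show ?thesis by (auto simp: bounded_iff)
  qed
  moreover have "diameter (V i) \<le> \<delta>" for i using U(3) by (simp add: V_def diameter_reflect)
  moreover have "(\<lambda>x. y - x) ` E \<subseteq> (\<Union>i. V i)" using U(4) unfolding V_def by blast
  moreover have "diam_weight s (V i) = diam_weight s (U i)" for i
    unfolding diam_weight_def V_def diameter_reflect by simp
  then have "(\<Sum>i. diam_weight s (V i)) = S" by (simp add: U(1))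
  ultimately show "hausdorff_premeasure s \<delta> ((\<lambda>x. y - x) ` E) \<le> S"
    unfolding hausdorff_premeasure_def by (intro Inf_lower) blast
qed

lemma hausdorff_dim_reflect:
  fixes y :: real
  shows "hausdorff_dim ((\<lambda>x. y - x) ` E) = hausdorff_dim E"
proof -
  have "hausdorff_premeasure s \<delta> ((\<lambda>x. y - x) ` E) = hausdorff_premeasure s \<delta> E" for s \<delta>
    using hausdorff_premeasure_reflect_le[of s \<delta> y E]
      hausdorff_premeasure_reflect_le[of s \<delta> y "(\<lambda>x. y - x) ` E"]
    by (intro antisym) (simp_all add: image_image)
  then show ?thesis by (simp add: hausdorff_dim_def hausdorff_measure_def)
qed

text \<open>Rests on the invariance of the approximation exponent under change of sign.\<close>

lemma joint_level_set_swap: "joint_level_set b y e d = (\<lambda>x. y - x) ` joint_level_set b y d e"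
proof -
  have *: "y - x \<in> joint_level_set b y d e" if "x \<in> joint_level_set b y e d" for x d e
    using that approx_exponent_uminus[of b "x - y"] approx_exponent_uminus[of b x]
    by (simp add: joint_level_set_def)
  show ?thesis
  proof (intro equalityI subsetI)
    fix x assume "x \<in> joint_level_set b y e d"
    from *[OF this] show "x \<in> (\<lambda>x. y - x) ` joint_level_set b y d e"
      by (intro image_eqI[of _ _ "y - x"]) auto
  qed (auto intro: *)
qed

text \<open>The approximation exponent that belongs to the Hoelder exponent u \<alpha>; u = 0 stands
  for infinite \<Delta>.\<close>

definition ereal_recip :: "real \<Rightarrow> ereal" where
  "ereal_recip u = (if u = 0 then \<infinity> else ereal (1 / u))"

lemma divide_eq_ereal_iff:
  assumes "0 < \<alpha>" "1 \<le> \<Delta>"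
  shows "ereal \<alpha> / \<Delta> = ereal H \<longleftrightarrow> 0 \<le> H \<and> \<Delta> = ereal_recip (H / \<alpha>)"
proof (cases \<Delta>)
  case (real d)
  then have "1 \<le> d" using assms by (simp add: one_ereal_def)
  then show ?thesis using real assms by (auto simp: ereal_recip_def field_simps zero_less_mult_iff)
qed (use assms in \<open>auto simp: ereal_recip_def zero_ereal_def\<close>)

lemma bivariate_spectrum_levy:
  assumes "b \<ge> 2" "\<alpha> > 0" "\<beta> > 0"
  shows "bivariate_spectrum (levy b \<alpha>) (translated_levy b \<beta> y) H G
    = (if 0 \<le> H \<and> 0 \<le> G then hausdorff_dim (joint_level_set b y (ereal_recip (H / \<alpha>)) (ereal_recip (G / \<beta>))) else - \<infinity>)"
  unfolding bivariate_spectrum_def joint_level_set_def holder_exponent_levy[OF assms(1,2)]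
    holder_exponent_translated_levy[OF assms(1,3)]
    divide_eq_ereal_iff[OF assms(2) approx_exponent_ge_1] divide_eq_ereal_iff[OF assms(3) approx_exponent_ge_1]
  by (auto simp: hausdorff_dim_def)

lemma hausdorff_dim_joint_level_set_le:
  assumes b: "b \<ge> 2" and u: "0 \<le> u" "u \<le> 1" and ne: "joint_level_set b y (ereal_recip u) e \<noteq> {}"
  shows "hausdorff_dim (joint_level_set b y (ereal_recip u) e) \<le> ereal u"
proof (rule ereal_le_if_real_less)
  fix s assume "ereal u < ereal s"
  then have s: "u < s" "0 < s" using u by auto
  \<comment> \<open>The cover needs \<open>1 / s < a < 1 / u\<close>. For s > 1 one takes
    \<open>a = 1\<close>, for which approximability is trivial even if u = 1.\<close>
  obtain a where a: "1 \<le> a" "1 < s * a" "a = 1 \<or> ereal a < ereal_recip u"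
  proof (cases "1 < s")
    case True
    then show ?thesis by (intro that[of 1]) auto
  next
    case False
    show ?thesis
    proof (cases "u = 0")
      case True
      then show ?thesis using s False by (intro that[of "2 / s"]) (auto simp: ereal_recip_def)
    next
      case u0: False
      then have "1 / s < 1 / u" using s u by (simp add: field_simps)
      then obtain a where a: "1 / s < a" "a < 1 / u" using dense by blast
      have "1 \<le> 1 / s" using s False by simp
      then have "1 \<le> a" using a by linarith
      then show ?thesis using a u0 s by (intro that[of a]) (auto simp: ereal_recip_def field_simps)
    qed
  qed
  have "hausdorff_measure s (joint_level_set b y (ereal_recip u) e) = 0"
  proof (rule hausdorff_measure_approximable_eq_0[OF b a(2) s(2) a(1)])
    fix x assume "x \<in> joint_level_set b y (ereal_recip u) e"
    then have x: "approx_exponent b x = ereal_recip u" by (simp add: joint_level_set_def)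
    from a(3) show "\<exists>\<^sub>\<infinity>n. infdist (real b ^ n * x) \<int> \<le> real b powr (- (real n * (a - 1)))"
    proof
      assume "a = 1"
      then show ?thesis using b infdist_Ints_le_1 by (auto simp: INFM_nat)
    next
      assume "ereal a < ereal_recip u"
      then show ?thesis unfolding x[symmetric] by (rule approx_exponent_INFM)
    qed
  qed
  then show "hausdorff_dim (joint_level_set b y (ereal_recip u) e) \<le> ereal s"
    unfolding hausdorff_dim_def using ne s by (auto intro!: Inf_lower)
qed

context spaced_ones
begin

text \<open>The arguments \<open>u\<close> and \<open>v\<close> are the reciprocals of \<open>\<Delta> x\<close> and \<open>\<Delta> (x - y)\<close>.\<close>
definition in_region :: "real \<Rightarrow> real \<Rightarrow> bool" where
  "in_region u v \<longleftrightarrow> 0 \<le> u \<and> u \<le> v \<and> v \<le> 1 \<and> (v \<le> 1 / \<eta> \<or> v\<^sup>2 \<le> u)"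

lemma hausdorff_dim_joint_level_set:
  assumes b: "b \<ge> 2" and uv: "in_region u v"
  shows "hausdorff_dim (joint_level_set b (digit_val b ones) (ereal_recip u) (ereal_recip v)) = ereal u"
proof -
  let ?E = "joint_level_set b (digit_val b ones) (ereal_recip u) (ereal_recip v)"
  have u: "0 \<le> u" "u \<le> v" "v \<le> 1" using uv by (auto simp: in_region_def)
  have large: "?E \<noteq> {} \<and> (\<forall>s. 0 < s \<longrightarrow> ereal s * ereal_recip u < 1 \<longrightarrow> hausdorff_measure s ?E \<noteq> 0)"
  proof (cases "v \<le> 1 / \<eta>")
    case True
    have "ereal \<eta> \<le> ereal_recip v" "ereal_recip v \<le> ereal_recip u"
      using True u eta by (auto simp: ereal_recip_def field_simps)
    from joint_level_set_large_above[OF b this] show ?thesis by blast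
  next
    case False
    then have v: "1 / \<eta> < v" "v\<^sup>2 \<le> u" using uv by (auto simp: in_region_def)
    have v0: "0 < v" using v(1) eta by (smt (verit) divide_pos_pos)
    have u0: "0 < u" using v(2) v0 by (smt (verit) zero_less_power2)
    have "1 \<le> 1 / v" "1 / v < \<eta>" "1 / v \<le> 1 / u" "1 / u \<le> (1 / v)\<^sup>2"
      using u v u0 v0 eta by (auto simp: field_simps power2_eq_square)
    from joint_level_set_large_below[OF b this] show ?thesis
      using u0 v0 by (simp add: ereal_recip_def)
  qed
  have "ereal u \<le> hausdorff_dim ?E"
    unfolding hausdorff_dim_def using large
  proof (simp, intro Inf_greatest)
    fix z assume "z \<in> {ereal s |s. 0 \<le> s \<and> hausdorff_measure s ?E = 0}"
    then obtain s where s: "z = ereal s" "0 \<le> s" "hausdorff_measure s ?E = 0" by blast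
    have "s \<noteq> 0" using s hausdorff_measure_zero_exponent large by blast
    then have "\<not> ereal s * ereal_recip u < 1" using s large by auto
    then show "ereal u \<le> z" using s u \<open>s \<noteq> 0\<close>
      by (cases "u = 0") (auto simp: ereal_recip_def one_ereal_def field_simps)
  qed
  moreover have "hausdorff_dim ?E \<le> ereal u"
    using b u large by (intro hausdorff_dim_joint_level_set_le) auto
  ultimately show ?thesis by (rule antisym[rotated])
qed

lemma joint_level_set_empty:
  assumes b: "b \<ge> 2" and u: "0 \<le> u" "u \<le> v" and not: "\<not> in_region u v"
  shows "joint_level_set b (digit_val b ones) (ereal_recip u) (ereal_recip v) = {}"
proof (rule ccontr)
  assume "\<not> ?thesis"
  then obtain x where x: "approx_exponent b x = ereal_recip u"
    "approx_exponent b (x - digit_val b ones) = ereal_recip v"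
    by (auto simp: joint_level_set_def)
  have v0: "0 < v" using not u eta by (cases "v = 0") (auto simp: in_region_def)
  have "1 \<le> ereal_recip v" using approx_exponent_ge_1[of b] unfolding x(2)[symmetric] .
  then have "v \<le> 1" using v0 by (simp add: ereal_recip_def one_ereal_def field_simps)
  then have v: "1 / \<eta> < v" "u < v\<^sup>2" using not u by (auto simp: in_region_def)
  have "approx_exponent b x \<le> ereal ((1 / v)\<^sup>2)"
  proof (rule approx_exponent_diff_ones_restriction[OF b])
    show "approx_exponent b (x - digit_val b ones) = ereal (1 / v)" using x v0 by (simp add: ereal_recip_def)
    show "1 / v < \<eta>" using v v0 eta by (simp add: field_simps)
  qed
  then have "u \<noteq> 0" "1 / u \<le> (1 / v)\<^sup>2" unfolding x by (auto simp: ereal_recip_def split: if_splits)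
  then have "v\<^sup>2 \<le> u" using u v0 by (simp add: field_simps power2_eq_square)
  then show False using v by simp
qed

lemma hausdorff_dim_joint_level_set_cases:
  assumes b: "b \<ge> 2" and u: "0 \<le> u" "0 \<le> v"
  shows "hausdorff_dim (joint_level_set b (digit_val b ones) (ereal_recip u) (ereal_recip v))
    = (if in_region u v \<or> in_region v u then ereal (min u v) else - \<infinity>)"
proof -
  have *: "hausdorff_dim (joint_level_set b (digit_val b ones) (ereal_recip u) (ereal_recip v))
    = (if in_region u v then ereal u else - \<infinity>)" if "0 \<le> u" "u \<le> v" for u v
    using hausdorff_dim_joint_level_set[OF b] joint_level_set_empty[OF b that]
    by (auto simp: hausdorff_dim_def[of "{}"])
  show ?thesis
  proof (cases "u \<le> v")
    case True
    have "in_region v u \<Longrightarrow> u = v" using True by (auto simp: in_region_def)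
    then show ?thesis using *[OF u(1) True] True by auto
  next
    case False
    then have "v \<le> u" by simp
    have "\<not> in_region u v" using False by (auto simp: in_region_def)
    then show ?thesis using *[OF u(2) \<open>v \<le> u\<close>] \<open>v \<le> u\<close>
      unfolding joint_level_set_swap[of b _ "ereal_recip u"] hausdorff_dim_reflect by (auto simp: min_def)
  qed
qed

end

section \<open>The digits of \<open>y\<close>\<close>

text \<open>Each block ends in its 1, so the digits 1 sit at the partial sums of the block lengths.
  Removing the first block raises the start \<open>n\<close>, which is therefore arbitrary in the
  induction.\<close>

lemma flat_replicate_snth:
  fixes g :: "nat \<Rightarrow> nat"
  shows "flat (smap (\<lambda>i. replicate (g i) 0 @ [1::nat]) (fromN n)) !! i
    = (if \<exists>k. Suc i = (\<Sum>j<Suc k. Suc (g (n + j))) then 1 else 0)"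
proof (induction i arbitrary: n rule: less_induct)
  case (less i)
  let ?w = "\<lambda>i. replicate (g i) 0 @ [1::nat]"
  have unfold: "flat (smap ?w (fromN n)) = ?w n @- flat (smap ?w (fromN (Suc n)))"
    by (subst flat_unfold) auto
  have sum: "(\<Sum>j<Suc k. Suc (g (n + j))) = Suc (g n) + (\<Sum>j<k. Suc (g (Suc n + j)))" for k
    by (subst sum.lessThan_Suc_shift) simp
  consider "i < g n" | "i = g n" | "g n < i" by linarith
  then show ?case
  proof cases
    case 1
    then have "\<not> (\<exists>k. Suc i = (\<Sum>j<Suc k. Suc (g (n + j))))" unfolding sum by simp
    moreover have "(?w n @- flat (smap ?w (fromN (Suc n)))) !! i = 0"
      using 1 by (simp add: nth_append)
    ultimately show ?thesis unfolding unfold by simp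
  next
    case 2
    then have "\<exists>k. Suc i = (\<Sum>j<Suc k. Suc (g (n + j)))" unfolding sum by (intro exI[of _ 0]) simp
    moreover have "(?w n @- flat (smap ?w (fromN (Suc n)))) !! i = 1"
      using 2 by (simp add: nth_append)
    ultimately show ?thesis unfolding unfold by simp
  next
    case 3
    define i' where "i' = i - Suc (g n)"
    have i: "i = Suc (g n) + i'" using 3 by (simp add: i'_def)
    have "(\<exists>k. Suc i = (\<Sum>j<Suc k. Suc (g (n + j)))) \<longleftrightarrow> (\<exists>k. Suc i' = (\<Sum>j<k. Suc (g (Suc n + j))))"
      unfolding sum i by simp
    also have "\<dots> \<longleftrightarrow> (\<exists>k. Suc i' = (\<Sum>j<Suc k. Suc (g (Suc n + j))))"
    proof
      assume "\<exists>k. Suc i' = (\<Sum>j<k. Suc (g (Suc n + j)))"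
      then obtain k where k: "Suc i' = (\<Sum>j<k. Suc (g (Suc n + j)))" by blast
      then have "k \<noteq> 0" by (intro notI) simp
      then obtain k' where "k = Suc k'" by (cases k) auto
      with k show "\<exists>k. Suc i' = (\<Sum>j<Suc k. Suc (g (Suc n + j)))" by blast
    qed blast
    finally have iff: "(\<exists>k. Suc i = (\<Sum>j<Suc k. Suc (g (n + j)))) \<longleftrightarrow> (\<exists>k. Suc i' = (\<Sum>j<Suc k. Suc (g (Suc n + j))))" .
    have "(?w n @- flat (smap ?w (fromN (Suc n)))) !! i = flat (smap ?w (fromN (Suc n))) !! i'"
      unfolding i by (subst shift_snth_ge) auto
    also have "\<dots> = (if \<exists>k. Suc i' = (\<Sum>j<Suc k. Suc (g (Suc n + j))) then 1 else 0)"
      by (rule less) (simp add: i)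
    finally show ?thesis unfolding unfold iff .
  qed
qed

text \<open>The constant 3 is 2 + 1: the floor loses less than 1, and consecutive terms must still
  differ by at least 2.\<close>

context
  fixes \<eta> :: real and l :: "nat \<Rightarrow> int"
  assumes eta: "1 < \<eta>" and l1: "1 \<le> l 1" "3 \<le> of_int (l 1) * (\<eta> - 1)"
    and rec: "\<And>i. 1 \<le> i \<Longrightarrow> l (Suc i) = \<lfloor>of_int (l i) * \<eta>\<rfloor>"
begin

lemma floor_seq_gap: 
  assumes "1 \<le> i"
  shows "l 1 \<le> l i \<and> l i + 2 \<le> l (Suc i)"
proof -
  have step: "l i + 2 \<le> l (Suc i)" if "1 \<le> i" "l 1 \<le> l i" for i
  proof -
    have "of_int (l 1) * (\<eta> - 1) \<le> of_int (l i) * (\<eta> - 1)" using that eta by (intro mult_right_mono) auto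
    then have "of_int (l i) + 3 \<le> of_int (l i) * \<eta>" using l1 by (simp add: right_diff_distrib)
    then show ?thesis unfolding rec[OF that(1)] by linarith
  qed
  have "l 1 \<le> l i" using assms
  proof (induction i rule: dec_induct)
    case (step i)
    then show ?case using \<open>\<And>i. 1 \<le> i \<Longrightarrow> l 1 \<le> l i \<Longrightarrow> l i + 2 \<le> l (Suc i)\<close>[of i] by linarith
  qed simp
  then show ?thesis using step assms by blast
qed

lemma strict_mono_on_floor_seq: "strict_mono_on {1..} l"
proof (rule strict_mono_onI)
  fix i j :: nat assume "i \<in> {1..}" "i < j"
  then have "1 \<le> i" "Suc i \<le> j" by auto
  from this(2) show "l i < l j"
  proof (induction j rule: dec_induct)
    case base
    then show ?case using floor_seq_gap[OF \<open>1 \<le> i\<close>] by linarith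
  next
    case (step j)
    then show ?case using floor_seq_gap[of j] by linarith
  qed
qed

text \<open>The block lengths telescope to this difference; the index is shifted by 2 because
  \<open>l\<close> starts at 1 and the digit 1 number k, counted from 0, closes block k + 1.\<close>

definition floor_seq_ones :: "nat \<Rightarrow> nat" where
  "floor_seq_ones k = nat (l (Suc (Suc k)) - l 1)"

lemma of_nat_floor_seq_ones: "real (floor_seq_ones k) = of_int (l (Suc (Suc k))) - of_int (l 1)"
  using floor_seq_gap[of "Suc (Suc k)"] by (simp add: floor_seq_ones_def)

lemma floor_seq_ones_eq_sum:
  "(\<Sum>j<Suc k. Suc (nat (\<lfloor>of_int (l (1 + j)) * \<eta>\<rfloor> - l (1 + j) - 1))) = floor_seq_ones k"
proof -
  have "int (Suc (nat (\<lfloor>of_int (l (1 + j)) * \<eta>\<rfloor> - l (1 + j) - 1))) = l (Suc (Suc j)) - l (Suc j)" for j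
    using floor_seq_gap[of "Suc j"] rec[of "Suc j"] by simp
  then have "int (\<Sum>j<Suc k. Suc (nat (\<lfloor>of_int (l (1 + j)) * \<eta>\<rfloor> - l (1 + j) - 1))) = (\<Sum>j<Suc k. l (Suc (Suc j)) - l (Suc j))"
    by (simp only: of_nat_sum)
  also have "\<dots> = l (Suc (Suc k)) - l 1" by (induction k) auto
  finally show ?thesis by (simp only: floor_seq_ones_def nat_int)
qed

text \<open>Neither the floor nor the subtraction of \<open>l 1\<close> changes the limit of the
  ratios, since the terms tend to infinity.\<close>

lemma spaced_ones_floor_seq: "spaced_ones floor_seq_ones \<eta>"
proof
  show "floor_seq_ones k + 2 \<le> floor_seq_ones (Suc k)" for k
    using floor_seq_gap[of "Suc (Suc k)"] unfolding floor_seq_ones_def by linarith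
  show "1 \<le> floor_seq_ones 0" using floor_seq_gap[of 1] by (simp add: floor_seq_ones_def)
  show "1 < \<eta>" by (rule eta)
  define c where "c = real_of_int (l 1)"
  define x where "x = (\<lambda>k. real_of_int (l (Suc (Suc k))))"
  have pos: "x k - c > 0" for k
    using strict_mono_onD[OF strict_mono_on_floor_seq, of 1 "Suc (Suc k)"] by (simp add: x_def c_def)
  have "int k \<le> l (Suc (Suc k))" for k
  proof (induction k)
    case 0
    then show ?case using floor_seq_gap[of 2] l1 by (simp add: numeral_2_eq_2)
  next
    case (Suc k)
    then show ?case using floor_seq_gap[of "Suc (Suc k)"] by simp
  qed
  then have "real k \<le> x k" for k by (simp add: x_def) (metis of_int_le_iff of_int_of_nat_eq)
  then have x: "filterlim x at_top sequentially"
    by (intro filterlim_at_top_mono[OF filterlim_real_sequentially] always_eventually) auto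
  have floor: "x k * \<eta> - 1 \<le> x (Suc k)" "x (Suc k) \<le> x k * \<eta>" for k
    unfolding x_def rec[of "Suc (Suc k)", simplified] by linarith+
  have "(\<lambda>k. (x (Suc k) - c) / (x k - c)) \<longlonglongrightarrow> \<eta>"
  proof (rule tendsto_sandwich)
    show "\<forall>\<^sub>F k in sequentially. (x k * \<eta> - 1 - c) / (x k - c) \<le> (x (Suc k) - c) / (x k - c)"
      using floor(1) pos by (intro always_eventually allI divide_right_mono) (auto simp: less_imp_le)
    show "\<forall>\<^sub>F k in sequentially. (x (Suc k) - c) / (x k - c) \<le> (x k * \<eta> - c) / (x k - c)"
      using floor(2) pos by (intro always_eventually allI divide_right_mono) (auto simp: less_imp_le)
    have "((\<lambda>x. (x * \<eta> - 1 - c) / (x - c)) \<longlongrightarrow> \<eta>) at_top" "((\<lambda>x. (x * \<eta> - c) / (x - c)) \<longlongrightarrow> \<eta>) at_top"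
      using eta by real_asymp+
    then show "(\<lambda>k. (x k * \<eta> - 1 - c) / (x k - c)) \<longlonglongrightarrow> \<eta>" "(\<lambda>k. (x k * \<eta> - c) / (x k - c)) \<longlonglongrightarrow> \<eta>"
      by (auto intro: filterlim_compose[OF _ x])
  qed
  then show "(\<lambda>k. real (floor_seq_ones (Suc k)) / real (floor_seq_ones k)) \<longlonglongrightarrow> \<eta>"
    by (simp add: of_nat_floor_seq_ones x_def c_def)
qed

lemma has_expansion_floor_seq:
  assumes "has_expansion b y (flat (smap (\<lambda>i. zeros_one \<eta> (l i)) (fromN 1)))"
  shows "y = digit_val b (spaced_ones.ones floor_seq_ones)"
proof -
  interpret spaced_ones floor_seq_ones \<eta> by (rule spaced_ones_floor_seq)
  have "flat (smap (\<lambda>i. zeros_one \<eta> (l i)) (fromN 1)) !! i = ones i" for i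
    unfolding zeros_one_def flat_replicate_snth floor_seq_ones_eq_sum ones_def by (auto simp: image_iff)
  then show ?thesis using assms by (simp add: has_expansion_def digit_val_def sums_iff)
qed

end

section \<open>The three cases of the spectrum in normalised exponents\<close>

theorem proposition2p6:
  fixes \<eta> :: real
  assumes "\<eta> > 1"
  shows "\<exists>L::int. \<forall>l :: nat \<Rightarrow> int.
    l 1 \<ge> L \<longrightarrow> (\<forall>i\<ge>1. l (Suc i) = \<lfloor>of_int (l i) * \<eta>\<rfloor>) \<longrightarrow>
    strict_mono_on {1..} l \<and>
    (\<forall>(b::nat) (\<alpha>\<^sub>1::real) (\<alpha>\<^sub>2::real) (y::real).
      b \<ge> 2 \<longrightarrow> \<alpha>\<^sub>1 > 0 \<longrightarrow> \<alpha>\<^sub>2 > 0 \<longrightarrow>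
      has_expansion b y (flat (smap (\<lambda>i. zeros_one \<eta> (l i)) (fromN 1))) \<longrightarrow>
      approx_exponent b y = ereal \<eta> \<and>
      (\<forall>(H\<^sub>1::real) (H\<^sub>2::real).
        let D = bivariate_spectrum (levy b \<alpha>\<^sub>1) (translated_levy b \<alpha>\<^sub>2 y) H\<^sub>1 H\<^sub>2;
            case1 = (H\<^sub>1 \<in> {0..\<alpha>\<^sub>1} \<and> H\<^sub>2 = \<alpha>\<^sub>2 / \<alpha>\<^sub>1 * H\<^sub>1);
            case2a = ((H\<^sub>1, H\<^sub>2) \<in> {0..\<alpha>\<^sub>1 / \<eta>} \<times> {0..\<alpha>\<^sub>2 / \<eta>});
            case2b = (H\<^sub>2 \<in> {\<alpha>\<^sub>2 / \<eta>..\<alpha>\<^sub>2} \<and>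
                      H\<^sub>1 \<in> {\<alpha>\<^sub>1 * H\<^sub>2\<^sup>2 / \<alpha>\<^sub>2\<^sup>2..\<alpha>\<^sub>1 * H\<^sub>2 / \<alpha>\<^sub>2});
            case2c = (H\<^sub>1 \<in> {\<alpha>\<^sub>1 / \<eta>..\<alpha>\<^sub>1} \<and>
                      H\<^sub>2 \<in> {\<alpha>\<^sub>2 * H\<^sub>1\<^sup>2 / \<alpha>\<^sub>1\<^sup>2..\<alpha>\<^sub>2 * H\<^sub>1 / \<alpha>\<^sub>1});
            case2 = (case2a \<or> case2b \<or> case2c)
        in (case1 \<longrightarrow> D = ereal (H\<^sub>1 / \<alpha>\<^sub>1)) \<and>
           (case2 \<longrightarrow> D = ereal (min (H\<^sub>1 / \<alpha>\<^sub>1) (H\<^sub>2 / \<alpha>\<^sub>2))) \<and>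
           (\<not> case1 \<and> \<not> case2 \<longrightarrow> D = - \<infinity>)))"
proof -
  define L where "L = max 1 \<lceil>3 / (\<eta> - 1)\<rceil>"
  have L: "1 \<le> L" "3 / (\<eta> - 1) \<le> of_int L"
    by (simp_all add: L_def ceiling_le_iff[symmetric])
  show ?thesis
  proof (intro exI[of _ L] allI impI)
    fix l :: "nat \<Rightarrow> int"
    assume lL: "L \<le> l 1" and rec: "\<forall>i\<ge>1. l (Suc i) = \<lfloor>of_int (l i) * \<eta>\<rfloor>"
    have "3 / (\<eta> - 1) \<le> of_int (l 1)" using L lL by (meson of_int_le_iff order_trans)
    then have l1: "1 \<le> l 1" "3 \<le> of_int (l 1) * (\<eta> - 1)"
      using assms L lL by (auto simp: field_simps)
    note seq = assms l1 rec[rule_format]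
    interpret spaced_ones "floor_seq_ones l" \<eta> by (rule spaced_ones_floor_seq[OF seq])
    show "strict_mono_on {1..} l \<and>
    (\<forall>(b::nat) (\<alpha>\<^sub>1::real) (\<alpha>\<^sub>2::real) (y::real).
      b \<ge> 2 \<longrightarrow> \<alpha>\<^sub>1 > 0 \<longrightarrow> \<alpha>\<^sub>2 > 0 \<longrightarrow>
      has_expansion b y (flat (smap (\<lambda>i. zeros_one \<eta> (l i)) (fromN 1))) \<longrightarrow>
      approx_exponent b y = ereal \<eta> \<and>
      (\<forall>(H\<^sub>1::real) (H\<^sub>2::real).
        let D = bivariate_spectrum (levy b \<alpha>\<^sub>1) (translated_levy b \<alpha>\<^sub>2 y) H\<^sub>1 H\<^sub>2;
            case1 = (H\<^sub>1 \<in> {0..\<alpha>\<^sub>1} \<and> H\<^sub>2 = \<alpha>\<^sub>2 / \<alpha>\<^sub>1 * H\<^sub>1);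
            case2a = ((H\<^sub>1, H\<^sub>2) \<in> {0..\<alpha>\<^sub>1 / \<eta>} \<times> {0..\<alpha>\<^sub>2 / \<eta>});
            case2b = (H\<^sub>2 \<in> {\<alpha>\<^sub>2 / \<eta>..\<alpha>\<^sub>2} \<and>
                      H\<^sub>1 \<in> {\<alpha>\<^sub>1 * H\<^sub>2\<^sup>2 / \<alpha>\<^sub>2\<^sup>2..\<alpha>\<^sub>1 * H\<^sub>2 / \<alpha>\<^sub>2});
            case2c = (H\<^sub>1 \<in> {\<alpha>\<^sub>1 / \<eta>..\<alpha>\<^sub>1} \<and>
                      H\<^sub>2 \<in> {\<alpha>\<^sub>2 * H\<^sub>1\<^sup>2 / \<alpha>\<^sub>1\<^sup>2..\<alpha>\<^sub>2 * H\<^sub>1 / \<alpha>\<^sub>1});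
            case2 = (case2a \<or> case2b \<or> case2c)
        in (case1 \<longrightarrow> D = ereal (H\<^sub>1 / \<alpha>\<^sub>1)) \<and>
           (case2 \<longrightarrow> D = ereal (min (H\<^sub>1 / \<alpha>\<^sub>1) (H\<^sub>2 / \<alpha>\<^sub>2))) \<and>
           (\<not> case1 \<and> \<not> case2 \<longrightarrow> D = - \<infinity>)))"
    proof (intro conjI allI impI)
      show "strict_mono_on {1..} l" by (rule strict_mono_on_floor_seq[OF seq])
      fix b :: nat and \<alpha>\<^sub>1 \<alpha>\<^sub>2 y :: real
      assume b: "2 \<le> b" and \<alpha>: "0 < \<alpha>\<^sub>1" "0 < \<alpha>\<^sub>2"
        and "has_expansion b y (flat (smap (\<lambda>i. zeros_one \<eta> (l i)) (fromN 1)))"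
      then have y: "y = digit_val b ones" by (intro has_expansion_floor_seq[OF seq])
      show "approx_exponent b y = ereal \<eta>" unfolding y by (rule approx_exponent_ones[OF b])
      fix H\<^sub>1 H\<^sub>2 :: real
      define u where "u = H\<^sub>1 / \<alpha>\<^sub>1"
      define v where "v = H\<^sub>2 / \<alpha>\<^sub>2"
      have H: "H\<^sub>1 = \<alpha>\<^sub>1 * u" "H\<^sub>2 = \<alpha>\<^sub>2 * v" using \<alpha> by (simp_all add: u_def v_def)
      have D: "bivariate_spectrum (levy b \<alpha>\<^sub>1) (translated_levy b \<alpha>\<^sub>2 y) H\<^sub>1 H\<^sub>2
          = (if in_region u v \<or> in_region v u then ereal (min u v) else - \<infinity>)"
      proof (cases "0 \<le> u \<and> 0 \<le> v")
        case True
        then show ?thesis using \<alpha> hausdorff_dim_joint_level_set_cases[OF b, of u v]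
          by (simp add: bivariate_spectrum_levy[OF b \<alpha>] y H)
      next
        case False
        then have "\<not> (0 \<le> H\<^sub>1 \<and> 0 \<le> H\<^sub>2)" "\<not> (in_region u v \<or> in_region v u)"
          using \<alpha> by (auto simp: H zero_le_mult_iff in_region_def)
        then show ?thesis by (simp only: bivariate_spectrum_levy[OF b \<alpha>] if_False)
      qed
      have case1: "(H\<^sub>1 \<in> {0..\<alpha>\<^sub>1} \<and> H\<^sub>2 = \<alpha>\<^sub>2 / \<alpha>\<^sub>1 * H\<^sub>1) \<longleftrightarrow> 0 \<le> u \<and> u \<le> 1 \<and> v = u"
        using \<alpha> by (auto simp: H zero_le_mult_iff mult_le_cancel_left1)
      have case2a: "((H\<^sub>1, H\<^sub>2) \<in> {0..\<alpha>\<^sub>1 / \<eta>} \<times> {0..\<alpha>\<^sub>2 / \<eta>}) \<longleftrightarrow> 0 \<le> u \<and> u \<le> 1 / \<eta> \<and> 0 \<le> v \<and> v \<le> 1 / \<eta>"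
        using \<alpha> assms by (auto simp: H zero_le_mult_iff field_simps)
      \<comment> \<open>Stated with free names because (b) and (c) are mirror images.\<close>
      have case2: "(G \<in> {\<beta> / \<eta>..\<beta>} \<and> F \<in> {\<alpha> * G\<^sup>2 / \<beta>\<^sup>2..\<alpha> * G / \<beta>}) \<longleftrightarrow> 1 / \<eta> \<le> t \<and> t \<le> 1 \<and> t\<^sup>2 \<le> s \<and> s \<le> t"
        if "0 < \<alpha>" "0 < \<beta>" "F = \<alpha> * s" "G = \<beta> * t" for \<alpha> \<beta> F G s t :: real
      proof -
        have "\<alpha> * G\<^sup>2 / \<beta>\<^sup>2 = \<alpha> * t\<^sup>2" "\<alpha> * G / \<beta> = \<alpha> * t" "\<beta> / \<eta> = \<beta> * (1 / \<eta>)"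
          using that by (simp_all add: power_mult_distrib)
        moreover have "\<beta> * t \<le> \<beta> \<longleftrightarrow> t \<le> 1" using that(2) mult_le_cancel_left_pos[of \<beta> t 1] by simp
        ultimately show ?thesis using that by (simp only: atLeastAtMost_iff mult_le_cancel_left_pos) auto
      qed
      \<comment> \<open>The diagonal lies in the region because the square of a number between 0 and
        1 does not exceed it.\<close>
      have iff: "(0 \<le> u \<and> u \<le> 1 \<and> v = u) \<or> (0 \<le> u \<and> u \<le> 1 / \<eta> \<and> 0 \<le> v \<and> v \<le> 1 / \<eta>)
          \<or> (1 / \<eta> \<le> v \<and> v \<le> 1 \<and> v\<^sup>2 \<le> u \<and> u \<le> v) \<or> (1 / \<eta> \<le> u \<and> u \<le> 1 \<and> u\<^sup>2 \<le> v \<and> v \<le> u)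
        \<longleftrightarrow> in_region u v \<or> in_region v u" (is "?L \<longleftrightarrow> ?R")
      proof
        have \<eta>: "1 / \<eta> \<le> 1" "0 < 1 / \<eta>" using assms by simp_all
        have sq: "t\<^sup>2 \<le> t" if "0 \<le> t" "t \<le> 1" for t :: real
          using that by (simp add: power2_eq_square mult_left_le)
        have pos: "0 \<le> s" if "t\<^sup>2 \<le> s" for s t :: real using that zero_le_power2[of t] by linarith
        show ?R if ?L using that sq[of u] \<eta> pos[of v u] pos[of u v] unfolding in_region_def by linarith
        show ?L if ?R using that unfolding in_region_def by linarith
      qed
      show "let D = bivariate_spectrum (levy b \<alpha>\<^sub>1) (translated_levy b \<alpha>\<^sub>2 y) H\<^sub>1 H\<^sub>2;
            case1 = (H\<^sub>1 \<in> {0..\<alpha>\<^sub>1} \<and> H\<^sub>2 = \<alpha>\<^sub>2 / \<alpha>\<^sub>1 * H\<^sub>1);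
            case2a = ((H\<^sub>1, H\<^sub>2) \<in> {0..\<alpha>\<^sub>1 / \<eta>} \<times> {0..\<alpha>\<^sub>2 / \<eta>});
            case2b = (H\<^sub>2 \<in> {\<alpha>\<^sub>2 / \<eta>..\<alpha>\<^sub>2} \<and>
                      H\<^sub>1 \<in> {\<alpha>\<^sub>1 * H\<^sub>2\<^sup>2 / \<alpha>\<^sub>2\<^sup>2..\<alpha>\<^sub>1 * H\<^sub>2 / \<alpha>\<^sub>2});
            case2c = (H\<^sub>1 \<in> {\<alpha>\<^sub>1 / \<eta>..\<alpha>\<^sub>1} \<and>
                      H\<^sub>2 \<in> {\<alpha>\<^sub>2 * H\<^sub>1\<^sup>2 / \<alpha>\<^sub>1\<^sup>2..\<alpha>\<^sub>2 * H\<^sub>1 / \<alpha>\<^sub>1});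
            case2 = (case2a \<or> case2b \<or> case2c)
        in (case1 \<longrightarrow> D = ereal (H\<^sub>1 / \<alpha>\<^sub>1)) \<and>
           (case2 \<longrightarrow> D = ereal (min (H\<^sub>1 / \<alpha>\<^sub>1) (H\<^sub>2 / \<alpha>\<^sub>2))) \<and>
           (\<not> case1 \<and> \<not> case2 \<longrightarrow> D = - \<infinity>)"
        unfolding Let_def D case1 case2a case2[OF \<alpha> H] case2[OF \<alpha>(2,1) H(2,1)]
          u_def[symmetric] v_def[symmetric] using iff by auto
    qed
  qed
qed

end
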